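(* Let $f:M\to\mathbb{S}^3\times\mathbb{S}^3$, $x\mapsto f(x)=(p(x),q(x))$, be a Lagrangian immersion into the nearly Kähler $\mathbb{S}^3\times\mathbb{S}^3$ which is neither totally geodesic nor of constant sectional curvature. Let $\theta_1,\theta_2,\theta_3$ be its angle functions and assume that $\theta_1$ is constant. Then, up to a multiple of $\pi$, $\theta_1$ equals $0$, $\frac{\pi}{3}$ or $\frac{2\pi}{3}$.
   Context: Identify $\mathbb{S}^3$ with the unit quaternions in $\mathbb{H}\cong\mathbb{R}^4$, with Euclidean metric $\langle\cdot,\cdot\rangle$; tangent vectors at $p$ are $p\alpha$ with $\alpha$ an imaginary quaternion. For $(U,V)\in T_{(p,q)}(\mathbb{S}^3\times\mathbb{S}^3)\cong T_p\mathbb{S}^3\oplus T_q\mathbb{S}^3$ define the almost complex structure $$J(U,V)_{(p,q)}=\tfrac{1}{\sqrt3}\left(2pq^{-1}V-U,\,-2qp^{-1}U+V\right),$$ and the metric $g(Z,Z')=\frac12(\langle Z,Z'\rangle+\langle JZ,JZ'\rangle)$, where $\langle\cdot,\cdot\rangle$ is the usual Euclidean product metric on $\mathbb{S}^3\times\mathbb{S}^3$. With $(g,J)$, $\mathbb{S}^3\times\mathbb{S}^3$ is a nearly Kähler manifold. Define also the almost product structure $P(U,V)_{(p,q)}=(pq^{-1}V,\,qp^{-1}U)$. An immersion $f:M\to\mathbb{S}^3\times\mathbb{S}^3$ is Lagrangian if $\dim M=3$ and $J$ maps $df(T_xM)$ into the $g$-normal space for every $x\in M$. $M$ carries the induced metric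 $f^*g$. For a Lagrangian immersion there are symmetric endomorphisms $A,B$ of $TM$ with $P\,df(X)=df(AX)+J\,df(BX)$; they commute and satisfy $A^2+B^2=\mathrm{Id}$. Hence around each point of an open dense subset of $M$ there is a local orthonormal frame $E_1,E_2,E_3$ and functions $\theta_1,\theta_2,\theta_3$ (the angle functions, each determined modulo $\pi$) such that $AE_i=\cos(2\theta_i)E_i$ and $BE_i=\sin(2\theta_i)E_i$, i.e. $P\,df(E_i)=\cos(2\theta_i)\,df(E_i)+\sin(2\theta_i)\,J\,df(E_i)$, for $i=1,2,3$. Saying that an angle function is constant means that it can be chosen equal to one fixed real number over $M$. "Totally geodesic" means that the second fundamental form of $f$ vanishes identically; "of constant sectional curvature" refers to the induced metric on $M$. *)

theory Defs
  imports "HOL-Analysis.Analysis"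
begin

section \<open>Smooth maps\<close>

primrec Ck_on :: "nat \<Rightarrow> 'a::euclidean_space set \<Rightarrow> ('a \<Rightarrow> 'b::euclidean_space) \<Rightarrow> bool" where
  "Ck_on 0 U f \<longleftrightarrow> continuous_on U f"
| "Ck_on (Suc k) U f \<longleftrightarrow>
     (\<forall>x\<in>U. f differentiable (at x)) \<and> (\<forall>v. Ck_on k U (\<lambda>x. frechet_derivative f (at x) v))"

text \<open>\<open>smooth_on\<close> is meant for open sets. For other sets, such as a closed submanifold of a
  Euclidean space, \<open>smooth_near\<close> asks for smoothness on an open neighbourhood; every function that
  is smooth on a properly embedded submanifold is the restriction of such a function.\<close>

definition smooth_on :: "'a::euclidean_space set \<Rightarrow> ('a \<Rightarrow> 'b::euclidean_space) \<Rightarrow> bool" where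
  "smooth_on U f \<longleftrightarrow> (\<forall>k. Ck_on k U f)"

definition smooth_near :: "'a::euclidean_space set \<Rightarrow> ('a \<Rightarrow> 'b::euclidean_space) \<Rightarrow> bool" where
  "smooth_near S f \<longleftrightarrow> (\<exists>U. open U \<and> S \<subseteq> U \<and> smooth_on U f)"

abbreviation deriv_at :: "('a::euclidean_space \<Rightarrow> 'b::euclidean_space) \<Rightarrow> 'a \<Rightarrow> 'a \<Rightarrow> 'b" where
  "deriv_at f x \<equiv> frechet_derivative f (at x)"


section \<open>Riemannian geometry of submanifolds of Euclidean spaces\<close>

text \<open>A submanifold is given by its point set \<open>S\<close>, its tangent spaces \<open>T x\<close> (for \<open>x \<in> S\<close>) and a
  Riemannian metric \<open>g x\<close> on \<open>T x\<close>. This is used for \<open>S\<^sup>3 \<times> S\<^sup>3\<close>, and for open subsets of \<open>\<real>\<^sup>3\<close>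
  (images of charts), where \<open>T x\<close> is the whole space. All the equations below are required on \<open>S\<close>
  only, and there they do not depend on the values of the fields outside \<open>S\<close>.\<close>

definition vector_fields :: "'a::euclidean_space set \<Rightarrow> ('a \<Rightarrow> 'a set) \<Rightarrow> ('a \<Rightarrow> 'a) set" where
  "vector_fields S T = {X. smooth_near S X \<and> (\<forall>x\<in>S. X x \<in> T x)}"

definition lie_bracket :: "('a::euclidean_space \<Rightarrow> 'a) \<Rightarrow> ('a \<Rightarrow> 'a) \<Rightarrow> 'a \<Rightarrow> 'a" where
  "lie_bracket X Y = (\<lambda>x. deriv_at Y x (X x) - deriv_at X x (Y x))"

definition affine_connection ::
  "'a::euclidean_space set \<Rightarrow> ('a \<Rightarrow> 'a set) \<Rightarrow> (('a \<Rightarrow> 'a) \<Rightarrow> ('a \<Rightarrow> 'a) \<Rightarrow> 'a \<Rightarrow> 'a) \<Rightarrow> bool" where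
  "affine_connection S T D \<longleftrightarrow>
     (\<forall>X\<in>vector_fields S T. \<forall>Y\<in>vector_fields S T. D X Y \<in> vector_fields S T) \<and>
     (\<forall>X\<in>vector_fields S T. \<forall>Y\<in>vector_fields S T. \<forall>Z\<in>vector_fields S T. \<forall>x\<in>S.
        D (\<lambda>y. X y + Y y) Z x = D X Z x + D Y Z x \<and>
        D X (\<lambda>y. Y y + Z y) x = D X Y x + D X Z x) \<and>
     (\<forall>X\<in>vector_fields S T. \<forall>Y\<in>vector_fields S T. \<forall>\<phi> :: 'a \<Rightarrow> real. smooth_near S \<phi> \<longrightarrow>
        (\<forall>x\<in>S. D (\<lambda>y. \<phi> y *\<^sub>R X y) Y x = \<phi> x *\<^sub>R D X Y x \<and>
               D X (\<lambda>y. \<phi> y *\<^sub>R Y y) x = \<phi> x *\<^sub>R D X Y x + deriv_at \<phi> x (X x) *\<^sub>R Y x))"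

definition levi_civita ::
  "'a::euclidean_space set \<Rightarrow> ('a \<Rightarrow> 'a set) \<Rightarrow> ('a \<Rightarrow> 'a \<Rightarrow> 'a \<Rightarrow> real) \<Rightarrow>
   (('a \<Rightarrow> 'a) \<Rightarrow> ('a \<Rightarrow> 'a) \<Rightarrow> 'a \<Rightarrow> 'a) \<Rightarrow> bool" where
  "levi_civita S T g D \<longleftrightarrow>
     affine_connection S T D \<and>
     (\<forall>X\<in>vector_fields S T. \<forall>Y\<in>vector_fields S T. \<forall>x\<in>S.
        D X Y x - D Y X x = lie_bracket X Y x) \<and>
     (\<forall>X\<in>vector_fields S T. \<forall>Y\<in>vector_fields S T. \<forall>Z\<in>vector_fields S T. \<forall>x\<in>S.
        deriv_at (\<lambda>y. g y (Y y) (Z y)) x (X x) = g x (D X Y x) (Z x) + g x (Y x) (D X Z x))"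

definition curvature ::
  "(('a::euclidean_space \<Rightarrow> 'a) \<Rightarrow> ('a \<Rightarrow> 'a) \<Rightarrow> 'a \<Rightarrow> 'a) \<Rightarrow>
   ('a \<Rightarrow> 'a) \<Rightarrow> ('a \<Rightarrow> 'a) \<Rightarrow> ('a \<Rightarrow> 'a) \<Rightarrow> 'a \<Rightarrow> 'a" where
  "curvature D X Y Z x = D X (D Y Z) x - D Y (D X Z) x - D (lie_bracket X Y) Z x"

definition sectional_curvature ::
  "('a::euclidean_space \<Rightarrow> 'a \<Rightarrow> 'a \<Rightarrow> real) \<Rightarrow> (('a \<Rightarrow> 'a) \<Rightarrow> ('a \<Rightarrow> 'a) \<Rightarrow> 'a \<Rightarrow> 'a) \<Rightarrow>
   ('a \<Rightarrow> 'a) \<Rightarrow> ('a \<Rightarrow> 'a) \<Rightarrow> 'a \<Rightarrow> real" where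
  "sectional_curvature g D X Y x =
     g x (curvature D X Y Y x) (X x) / (g x (X x) (X x) * g x (Y x) (Y x) - (g x (X x) (Y x))\<^sup>2)"


section \<open>The nearly Kaehler \<open>S\<^sup>3 \<times> S\<^sup>3\<close>\<close>

text \<open>The pair \<open>(a, u)\<close> is the quaternion with real part \<open>a\<close> and imaginary part \<open>u\<close>. The inner product
  of the product type is the Euclidean one on \<open>\<real>\<^sup>4\<close>.\<close>

type_synonym quat = "real \<times> (real ^ 3)"

definition qmult :: "quat \<Rightarrow> quat \<Rightarrow> quat" (infixl "\<odot>" 70) where
  "x \<odot> y = (fst x * fst y - snd x \<bullet> snd y, fst x *\<^sub>R snd y + fst y *\<^sub>R snd x + cross3 (snd x) (snd y))"

definition qinv :: "quat \<Rightarrow> quat" where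
  "qinv x = (1 / (norm x)\<^sup>2) *\<^sub>R (fst x, - snd x)"

definition S3S3 :: "(quat \<times> quat) set" where
  "S3S3 = sphere 0 1 \<times> sphere 0 1"

definition TS3S3 :: "quat \<times> quat \<Rightarrow> (quat \<times> quat) set" where
  "TS3S3 x = {(fst x \<odot> a, snd x \<odot> b) | a b. fst a = 0 \<and> fst b = 0}"

definition acs :: "quat \<times> quat \<Rightarrow> quat \<times> quat \<Rightarrow> quat \<times> quat" ("\<J>") where
  "\<J> x Z = (case (x, Z) of ((p, q), (U, V)) \<Rightarrow>
     (1 / sqrt 3) *\<^sub>R (2 *\<^sub>R (p \<odot> qinv q \<odot> V) - U, - 2 *\<^sub>R (q \<odot> qinv p \<odot> U) + V))"

definition aps :: "quat \<times> quat \<Rightarrow> quat \<times> quat \<Rightarrow> quat \<times> quat" ("\<P>") where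
  "\<P> x Z = (case (x, Z) of ((p, q), (U, V)) \<Rightarrow> (p \<odot> qinv q \<odot> V, q \<odot> qinv p \<odot> U))"

definition nk_metric :: "quat \<times> quat \<Rightarrow> quat \<times> quat \<Rightarrow> quat \<times> quat \<Rightarrow> real" where
  "nk_metric x Z Z' = (1 / 2) * (Z \<bullet> Z' + \<J> x Z \<bullet> \<J> x Z')"


section \<open>Three-dimensional manifolds and Lagrangian immersions\<close>

text \<open>A chart is a pair of its domain and its coordinate map. The manifold is the union of the
  domains of the charts of an atlas.\<close>

type_synonym 'm chart = "'m set \<times> ('m \<Rightarrow> real ^ 3)"

definition chart_image :: "'m chart \<Rightarrow> (real ^ 3) set" where
  "chart_image c = snd c ` fst c"

definition chart_inv :: "'m chart \<Rightarrow> real ^ 3 \<Rightarrow> 'm" where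
  "chart_inv c = inv_into (fst c) (snd c)"

definition smooth_atlas :: "'m::{t2_space, second_countable_topology} chart set \<Rightarrow> bool" where
  "smooth_atlas A \<longleftrightarrow>
     (\<forall>c\<in>A. open (fst c) \<and> open (chart_image c) \<and>
            homeomorphism (fst c) (chart_image c) (snd c) (chart_inv c)) \<and>
     (\<forall>c\<in>A. \<forall>d\<in>A. smooth_on (snd c ` (fst c \<inter> fst d)) (snd d \<circ> chart_inv c))"

definition manifold_carrier :: "'m chart set \<Rightarrow> 'm set" where
  "manifold_carrier A = (\<Union>c\<in>A. fst c)"

text \<open>In the sequel \<open>F\<close> is the expression \<open>local_rep c f\<close> of the immersion in a chart.\<close>

definition local_rep :: "'m chart \<Rightarrow> ('m \<Rightarrow> quat \<times> quat) \<Rightarrow> real ^ 3 \<Rightarrow> quat \<times> quat" where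
  "local_rep c f = f \<circ> chart_inv c"

definition induced_metric ::
  "(real ^ 3 \<Rightarrow> quat \<times> quat) \<Rightarrow> real ^ 3 \<Rightarrow> real ^ 3 \<Rightarrow> real ^ 3 \<Rightarrow> real" where
  "induced_metric F y u v = nk_metric (F y) (deriv_at F y u) (deriv_at F y v)"

definition immersion_into_S3S3 :: "'m chart set \<Rightarrow> ('m \<Rightarrow> quat \<times> quat) \<Rightarrow> bool" where
  "immersion_into_S3S3 A f \<longleftrightarrow>
     (\<forall>x\<in>manifold_carrier A. f x \<in> S3S3) \<and>
     (\<forall>c\<in>A. smooth_on (chart_image c) (local_rep c f) \<and>
            (\<forall>y\<in>chart_image c. inj (deriv_at (local_rep c f) y)))"

definition normal_space :: "(real ^ 3 \<Rightarrow> quat \<times> quat) \<Rightarrow> real ^ 3 \<Rightarrow> (quat \<times> quat) set" where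
  "normal_space F y = {n \<in> TS3S3 (F y). \<forall>u. nk_metric (F y) n (deriv_at F y u) = 0}"

definition lagrangian_immersion :: "'m chart set \<Rightarrow> ('m \<Rightarrow> quat \<times> quat) \<Rightarrow> bool" where
  "lagrangian_immersion A f \<longleftrightarrow>
     immersion_into_S3S3 A f \<and>
     (\<forall>c\<in>A. \<forall>y\<in>chart_image c. \<forall>u.
        \<J> (local_rep c f y) (deriv_at (local_rep c f) y u) \<in> normal_space (local_rep c f) y)"

definition normal_part ::
  "(real ^ 3 \<Rightarrow> quat \<times> quat) \<Rightarrow> real ^ 3 \<Rightarrow> quat \<times> quat \<Rightarrow> quat \<times> quat" where
  "normal_part F y w = (THE n. n \<in> normal_space F y \<and> w - n \<in> range (deriv_at F y))"

text \<open>The value at \<open>y\<close> of the second fundamental form on the tangent vectors \<open>u\<close>, \<open>v\<close> with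
  \<open>dF u = X (F y)\<close> and \<open>dF v = Y (F y)\<close> is the normal part of \<open>D X Y\<close> (Gauss formula), where \<open>D\<close> is the
  Levi-Civita connection of the ambient space and \<open>X\<close>, \<open>Y\<close> are ambient vector fields which are
  tangent to the immersed submanifold near \<open>y\<close>. It depends only on \<open>u\<close> and \<open>v\<close>, and as \<open>F\<close> is locally an
  embedding all \<open>u\<close> and \<open>v\<close> arise in this way.\<close>

definition tangent_along ::
  "(real ^ 3 \<Rightarrow> quat \<times> quat) \<Rightarrow> (real ^ 3) set \<Rightarrow> (quat \<times> quat \<Rightarrow> quat \<times> quat) \<Rightarrow> bool" where
  "tangent_along F N X \<longleftrightarrow> (\<forall>z\<in>N. X (F z) \<in> range (deriv_at F z))"

definition second_fundamental_form ::
  "((quat \<times> quat \<Rightarrow> quat \<times> quat) \<Rightarrow> (quat \<times> quat \<Rightarrow> quat \<times> quat) \<Rightarrow> quat \<times> quat \<Rightarrow> quat \<times> quat) \<Rightarrow>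
   (real ^ 3 \<Rightarrow> quat \<times> quat) \<Rightarrow> (quat \<times> quat \<Rightarrow> quat \<times> quat) \<Rightarrow> (quat \<times> quat \<Rightarrow> quat \<times> quat) \<Rightarrow>
   real ^ 3 \<Rightarrow> quat \<times> quat" where
  "second_fundamental_form D F X Y y = normal_part F y (D X Y (F y))"

definition totally_geodesic :: "'m chart set \<Rightarrow> ('m \<Rightarrow> quat \<times> quat) \<Rightarrow> bool" where
  "totally_geodesic A f \<longleftrightarrow>
     (\<forall>D. levi_civita S3S3 TS3S3 nk_metric D \<longrightarrow>
       (\<forall>c\<in>A. \<forall>y\<in>chart_image c.
         \<forall>X\<in>vector_fields S3S3 TS3S3. \<forall>Y\<in>vector_fields S3S3 TS3S3.
         \<forall>N. open N \<and> y \<in> N \<and> N \<subseteq> chart_image c \<and>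
             tangent_along (local_rep c f) N X \<and> tangent_along (local_rep c f) N Y \<longrightarrow>
           second_fundamental_form D (local_rep c f) X Y y = 0))"

definition constant_sectional_curvature :: "'m chart set \<Rightarrow> ('m \<Rightarrow> quat \<times> quat) \<Rightarrow> bool" where
  "constant_sectional_curvature A f \<longleftrightarrow>
     (\<exists>K. \<forall>c\<in>A. \<forall>D.
        levi_civita (chart_image c) (\<lambda>_. UNIV) (induced_metric (local_rep c f)) D \<longrightarrow>
        (\<forall>X\<in>vector_fields (chart_image c) (\<lambda>_. UNIV).
         \<forall>Y\<in>vector_fields (chart_image c) (\<lambda>_. UNIV). \<forall>y\<in>chart_image c.
           dim {X y, Y y} = 2 \<longrightarrow>
           sectional_curvature (induced_metric (local_rep c f)) D X Y y = K))"


section \<open>Angle functions\<close>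

text \<open>The angle functions are indexed by the three-element type \<open>3\<close>, with elements \<open>1\<close>, \<open>2\<close>, \<open>3\<close>.\<close>

definition angle_functions_on ::
  "(real ^ 3 \<Rightarrow> quat \<times> quat) \<Rightarrow> (real ^ 3) set \<Rightarrow> (3 \<Rightarrow> real ^ 3 \<Rightarrow> real) \<Rightarrow> bool" where
  "angle_functions_on F N \<theta> \<longleftrightarrow>
     (\<forall>i. smooth_on N (\<theta> i)) \<and>
     (\<exists>E :: 3 \<Rightarrow> real ^ 3 \<Rightarrow> real ^ 3.
        (\<forall>i. smooth_on N (E i)) \<and>
        (\<forall>y\<in>N. \<forall>i j. induced_metric F y (E i y) (E j y) = (if i = j then 1 else 0)) \<and>
        (\<forall>y\<in>N. \<forall>i. \<P> (F y) (deriv_at F y (E i y)) =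
            cos (2 * \<theta> i y) *\<^sub>R deriv_at F y (E i y) +
            sin (2 * \<theta> i y) *\<^sub>R \<J> (F y) (deriv_at F y (E i y))))"

text \<open>Around each point of an open dense subset of the manifold there are angle functions, the first
  of which is equal to the real number \<open>t\<close>, which does not depend on the point.\<close>

definition constant_first_angle ::
  "'m::topological_space chart set \<Rightarrow> ('m \<Rightarrow> quat \<times> quat) \<Rightarrow> real \<Rightarrow> bool" where
  "constant_first_angle A f t \<longleftrightarrow>
     (\<exists>W. open W \<and> W \<subseteq> manifold_carrier A \<and> manifold_carrier A \<subseteq> closure W \<and>
        (\<forall>x\<in>W. \<exists>c\<in>A. x \<in> fst c \<and>
           (\<exists>N \<theta>. open N \<and> snd c x \<in> N \<and> N \<subseteq> chart_image c \<and>
              angle_functions_on (local_rep c f) N \<theta> \<and> (\<forall>y\<in>N. \<theta> 1 y = t))))"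

end

theory Submission
  imports Defs
begin

text \<open>
  The proof shows that a Lagrangian immersion with \<open>\<theta> 1 = t\<close> constant and \<open>sin (3 * t) \<noteq> 0\<close> is totally
  geodesic; the remaining values of \<open>t\<close> are the multiples of \<open>pi / 3\<close>.

  Left translation identifies every tangent space of \<open>S\<^sup>3 \<times> S\<^sup>3\<close> with two copies of the imaginary
  quaternions. In the coordinates \<open>(u, v)\<close> of \<open>ltriv\<close> the nearly Kaehler metric is the standard
  inner product of \<open>\<real>\<^sup>6\<close>, and \<open>\<J> (u, v) = (v, - u)\<close>, \<open>\<P> (u, v) = (u, - v)\<close> have constant coefficients.
  All the geometry sits in the Lie bracket, which is built from cross products. A frame that diagonalizes
  \<open>\<P>\<close> becomes \<open>w\<^sub>i = (cos \<theta>\<^sub>i b\<^sub>i, sin \<theta>\<^sub>i b\<^sub>i)\<close>, and the Lagrangian condition says exactly that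
  \<open>b\<^sub>1, b\<^sub>2, b\<^sub>3\<close> is orthonormal in \<open>\<real>\<^sup>3\<close> (\<open>w_polar\<close>, \<open>b_inner\<close>).

  Two integrability conditions remain: the Maurer-Cartan equation for the \<open>w\<^sub>i\<close> (\<open>maurer_cartan\<close>),
  and the flatness of the connection \<open>\<Gamma>\<close> that differentiates the moving basis \<open>b\<^sub>i\<close> of the fixed space
  \<open>\<real>\<^sup>3\<close> (\<open>flatness\<close>). The former gives \<open>\<theta>\<^sub>1 + \<theta>\<^sub>2 + \<theta>\<^sub>3 \<in> pi \<int>\<close> and expresses all structure functions by
  the derivatives of the angles and one function \<open>m\<close>, which up to sign is the component of the second fundamental
  form with three distinct indices (\<open>h_distinct\<close>).

  Let \<open>\<theta>\<^sub>1 = t\<close>, \<open>x\<^sub>i = E\<^sub>i(\<theta>\<^sub>2)\<close>, and let \<open>s\<^sub>1, s\<^sub>2, s\<^sub>3\<close> and \<open>d\<^sub>1, d\<^sub>2, d\<^sub>3\<close> be the sines and cosines of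
  \<open>\<theta>\<^sub>2 - \<theta>\<^sub>3\<close>, \<open>\<theta>\<^sub>3 - \<theta>\<^sub>1\<close>, \<open>\<theta>\<^sub>1 - \<theta>\<^sub>2\<close>. Where no \<open>s\<^sub>i\<close> vanishes, flatness computes \<open>E\<^sub>1(x\<^sub>1)\<close> in two ways, and the
  difference of the results is, up to a nonvanishing factor, \<open>sin (3 * t)\<close> times \<open>x\<^sub>1\<^sup>2 + m\<^sup>2 - \<kappa>\<^sup>2 s\<^sub>2 s\<^sub>3 d\<^sub>1\<close>. Differentiating the constraint
  \<open>x\<^sub>1\<^sup>2 + m\<^sup>2 = \<kappa>\<^sup>2 s\<^sub>2 s\<^sub>3 d\<^sub>1\<close> along \<open>E\<^sub>1\<close> forces \<open>x\<^sub>1 = 0\<close>. Then \<open>m s\<^sub>1 = 2 \<kappa> s\<^sub>2 s\<^sub>3\<close> and \<open>d\<^sub>1 s\<^sub>1\<^sup>2 = 4 s\<^sub>2 s\<^sub>3\<close>; differentiating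
  the latter gives \<open>x\<^sub>2 = x\<^sub>3 = 0\<close>, and the flatness equation for \<open>E\<^sub>2, E\<^sub>3\<close> yields \<open>s\<^sub>2 s\<^sub>3 = 0\<close>, a
  contradiction. Hence two of the angles agree modulo \<open>pi\<close> at every point (\<open>two_angles_equal\<close>). It follows that
  all angles are locally constant and \<open>m = 0\<close>, so the second fundamental form vanishes near every
  point that has an adapted frame. These points are dense, and continuity extends the result to the whole manifold
  (\<open>second_form_zero\<close>).
\<close>

section \<open>Calculus of smooth maps\<close>

text \<open>\<open>Ck_on\<close> asks for derivatives at full neighbourhoods, so on an open set only the values there matter.\<close>
lemma Ck_on_cong:
  assumes "open U" "\<And>x. x \<in> U \<Longrightarrow> f x = g x"
  shows "Ck_on k U f \<longleftrightarrow> Ck_on k U g"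
  using assms(2)
proof (induction k arbitrary: f g)
  case 0
  then show ?case by (auto intro: continuous_on_eq)
next
  case (Suc k)
  have d: "(f has_derivative D) (at x) \<longleftrightarrow> (g has_derivative D) (at x)" if "x \<in> U" for x D
    using has_derivative_transform_within_open[OF _ assms(1) that] Suc.prems by metis
  have "frechet_derivative f (at x) v = frechet_derivative g (at x) v" if "x \<in> U" for x v
    unfolding frechet_derivative_def using d[OF that] by simp
  then show ?case
    using Suc.IH[of "\<lambda>x. frechet_derivative f (at x) v" "\<lambda>x. frechet_derivative g (at x) v" for v] d
    unfolding Ck_on.simps differentiable_def by simp
qed

lemma deriv_at_cong:
  assumes "open U" "x \<in> U" "\<And>x. x \<in> U \<Longrightarrow> f x = g x"
  shows "deriv_at f x = deriv_at g x"
proof -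
  have "(f has_derivative D) (at x) \<longleftrightarrow> (g has_derivative D) (at x)" for D
    using has_derivative_transform_within_open[OF _ assms(1,2)] assms(3) by metis
  then show ?thesis unfolding frechet_derivative_def by simp
qed

text \<open>Lets the inductive proofs below work with an explicit derivative instead of the choice made by
  \<open>frechet_derivative\<close>.\<close>
lemma Ck_on_SucI:
  assumes "open U" "\<And>x. x \<in> U \<Longrightarrow> (f has_derivative f' x) (at x)"
    and "\<And>v. Ck_on k U (\<lambda>x. f' x v)"
  shows "Ck_on (Suc k) U f"
proof -
  have "Ck_on k U (\<lambda>x. frechet_derivative f (at x) v)" for v
    by (subst Ck_on_cong[OF assms(1), of _ "\<lambda>x. f' x v"])
      (use assms frechet_derivative_at in \<open>metis+\<close>)
  then show ?thesis using assms(2) by (auto simp: differentiable_def)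
qed

lemma Ck_on_SucD: "Ck_on (Suc k) U f \<Longrightarrow> Ck_on k U f"
proof (induction k arbitrary: f)
  case 0
  then show ?case
    by (auto intro!: continuous_at_imp_continuous_on differentiable_imp_continuous_within)
next
  case (Suc k)
  then show ?case by (metis Ck_on.simps(2))
qed

lemma smooth_on_differentiable: "smooth_on U f \<Longrightarrow> x \<in> U \<Longrightarrow> f differentiable (at x)"
  unfolding smooth_on_def by (metis Ck_on.simps(2))

lemma smooth_on_has_derivative:
  "smooth_on U f \<Longrightarrow> x \<in> U \<Longrightarrow> (f has_derivative deriv_at f x) (at x)"
  using smooth_on_differentiable frechet_derivative_works by blast

lemma smooth_on_continuous: "smooth_on U f \<Longrightarrow> continuous_on U f"
  unfolding smooth_on_def by (metis Ck_on.simps(1))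

lemma smooth_on_deriv: "smooth_on U f \<Longrightarrow> smooth_on U (\<lambda>x. deriv_at f x v)"
  unfolding smooth_on_def by (metis Ck_on.simps(2))

lemma smooth_on_cong:
  assumes "open U" "\<And>x. x \<in> U \<Longrightarrow> f x = g x"
  shows "smooth_on U f \<longleftrightarrow> smooth_on U g"
  unfolding smooth_on_def using Ck_on_cong[OF assms] by auto

lemma Ck_on_subset: "Ck_on k U f \<Longrightarrow> V \<subseteq> U \<Longrightarrow> Ck_on k V f"
  by (induction k arbitrary: f) (auto intro: continuous_on_subset)

lemma smooth_on_subset: "smooth_on U f \<Longrightarrow> V \<subseteq> U \<Longrightarrow> smooth_on V f"
  unfolding smooth_on_def using Ck_on_subset by blast

lemma Ck_on_const: "open U \<Longrightarrow> Ck_on k U (\<lambda>x. c)"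
proof (induction k arbitrary: c)
  case (Suc k)
  show ?case by (rule Ck_on_SucI[OF Suc.prems, where f' = "\<lambda>x v. 0"]) (use Suc in auto)
qed auto

lemma Ck_on_Suc_has_derivative:
  "Ck_on (Suc k) U f \<Longrightarrow> x \<in> U \<Longrightarrow> (f has_derivative deriv_at f x) (at x)"
  by (simp add: frechet_derivative_works[symmetric])

lemma Ck_on_Suc_deriv: "Ck_on (Suc k) U f \<Longrightarrow> Ck_on k U (\<lambda>x. deriv_at f x v)"
  by simp

lemma Ck_on_linear_image:
  assumes h: "bounded_linear h" and U: "open U"
  shows "Ck_on k U f \<Longrightarrow> Ck_on k U (\<lambda>x. h (f x))"
proof (induction k arbitrary: f)
  case 0
  then show ?case using bounded_linear.continuous_on[OF h] by auto
next
  case (Suc k)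
  show ?case
  proof (rule Ck_on_SucI[OF U])
    show "((\<lambda>x. h (f x)) has_derivative (\<lambda>v. h (deriv_at f x v))) (at x)" if "x \<in> U" for x
      by (intro bounded_linear.has_derivative[OF h] Ck_on_Suc_has_derivative[OF Suc.prems that])
    show "Ck_on k U (\<lambda>x. h (deriv_at f x v))" for v
      using Suc by auto
  qed
qed

lemma Ck_on_add:
  assumes U: "open U"
  shows "Ck_on k U f \<Longrightarrow> Ck_on k U g \<Longrightarrow> Ck_on k U (\<lambda>x. f x + g x)"
proof (induction k arbitrary: f g)
  case 0
  then show ?case by (auto intro: continuous_intros)
next
  case (Suc k)
  show ?case
  proof (rule Ck_on_SucI[OF U])
    show "((\<lambda>x. f x + g x) has_derivative (\<lambda>v. deriv_at f x v + deriv_at g x v)) (at x)" if "x \<in> U" for x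
      by (intro has_derivative_add Ck_on_Suc_has_derivative[OF Suc.prems(1) that]
          Ck_on_Suc_has_derivative[OF Suc.prems(2) that])
    show "Ck_on k U (\<lambda>x. deriv_at f x v + deriv_at g x v)" for v
      using Suc by auto
  qed
qed

lemma Ck_on_bilinear:
  assumes h: "bounded_bilinear h" and U: "open U"
  shows "Ck_on k U f \<Longrightarrow> Ck_on k U g \<Longrightarrow> Ck_on k U (\<lambda>x. h (f x) (g x))"
proof (induction k arbitrary: f g)
  case 0
  then show ?case using bounded_bilinear.continuous_on[OF h] by auto
next
  case (Suc k)
  show ?case
  proof (rule Ck_on_SucI[OF U])
    show "((\<lambda>x. h (f x) (g x)) has_derivative
        (\<lambda>v. h (f x) (deriv_at g x v) + h (deriv_at f x v) (g x))) (at x)" if "x \<in> U" for x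
      by (intro bounded_bilinear.FDERIV[OF h] Ck_on_Suc_has_derivative[OF Suc.prems(1) that]
          Ck_on_Suc_has_derivative[OF Suc.prems(2) that])
    show "Ck_on k U (\<lambda>x. h (f x) (deriv_at g x v) + h (deriv_at f x v) (g x))" for v
      by (intro Ck_on_add[OF U] Suc.IH Ck_on_SucD[OF Suc.prems(1)] Ck_on_SucD[OF Suc.prems(2)]
          Ck_on_Suc_deriv[OF Suc.prems(1)] Ck_on_Suc_deriv[OF Suc.prems(2)])
  qed
qed

text \<open>Sine and cosine are treated together because each is the derivative of the other up to sign.\<close>
lemma Ck_on_cos_sin:
  fixes \<theta> :: "'a::euclidean_space \<Rightarrow> real"
  assumes U: "open U"
  shows "Ck_on k U \<theta> \<Longrightarrow> Ck_on k U (\<lambda>x. cos (\<theta> x)) \<and> Ck_on k U (\<lambda>x. sin (\<theta> x))"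
proof (induction k)
  case 0
  then show ?case by (auto intro: continuous_intros)
next
  case (Suc k)
  have d: "(\<theta> has_derivative deriv_at \<theta> x) (at x)" if "x \<in> U" for x
    using Suc.prems that frechet_derivative_works by auto
  have IH: "Ck_on k U (\<lambda>x. cos (\<theta> x))" "Ck_on k U (\<lambda>x. sin (\<theta> x))"
    using Suc Ck_on_SucD by blast+
  have \<theta>': "Ck_on k U (\<lambda>x. deriv_at \<theta> x v)" for v using Suc.prems by auto
  have "Ck_on (Suc k) U (\<lambda>x. cos (\<theta> x))"
  proof (rule Ck_on_SucI[OF U])
    show "((\<lambda>x. cos (\<theta> x)) has_derivative (\<lambda>v. - (sin (\<theta> x) * deriv_at \<theta> x v))) (at x)" if "x \<in> U" for x
      using d[OF that] by (auto intro!: derivative_eq_intros)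
    show "Ck_on k U (\<lambda>x. - (sin (\<theta> x) * deriv_at \<theta> x v))" for v
      by (intro Ck_on_linear_image[OF bounded_linear_minus[OF bounded_linear_ident] U]
          Ck_on_bilinear[OF bounded_bilinear_mult U] IH \<theta>')
  qed
  moreover have "Ck_on (Suc k) U (\<lambda>x. sin (\<theta> x))"
  proof (rule Ck_on_SucI[OF U])
    show "((\<lambda>x. sin (\<theta> x)) has_derivative (\<lambda>v. cos (\<theta> x) * deriv_at \<theta> x v)) (at x)" if "x \<in> U" for x
      using d[OF that] by (auto intro!: derivative_eq_intros)
    show "Ck_on k U (\<lambda>x. cos (\<theta> x) * deriv_at \<theta> x v)" for v
      by (intro Ck_on_bilinear[OF bounded_bilinear_mult U] IH \<theta>')
  qed
  ultimately show ?case by simp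
qed

lemma smooth_on_const [simp]: "open U \<Longrightarrow> smooth_on U (\<lambda>x. c)"
  unfolding smooth_on_def using Ck_on_const by blast

lemma smooth_on_linear_image:
  "bounded_linear h \<Longrightarrow> open U \<Longrightarrow> smooth_on U f \<Longrightarrow> smooth_on U (\<lambda>x. h (f x))"
  unfolding smooth_on_def using Ck_on_linear_image by blast

lemma smooth_on_add:
  "open U \<Longrightarrow> smooth_on U f \<Longrightarrow> smooth_on U g \<Longrightarrow> smooth_on U (\<lambda>x. f x + g x)"
  unfolding smooth_on_def using Ck_on_add by blast

lemma smooth_on_bilinear:
  "bounded_bilinear h \<Longrightarrow> open U \<Longrightarrow> smooth_on U f \<Longrightarrow> smooth_on U g
    \<Longrightarrow> smooth_on U (\<lambda>x. h (f x) (g x))"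
  unfolding smooth_on_def using Ck_on_bilinear by blast

lemma smooth_on_cos: "open U \<Longrightarrow> smooth_on U \<theta> \<Longrightarrow> smooth_on U (\<lambda>x. cos (\<theta> x))"
  and smooth_on_sin: "open U \<Longrightarrow> smooth_on U \<theta> \<Longrightarrow> smooth_on U (\<lambda>x. sin (\<theta> x))"
  for \<theta> :: "'a::euclidean_space \<Rightarrow> real"
  unfolding smooth_on_def using Ck_on_cos_sin by blast+

lemma smooth_on_sum:
  "open U \<Longrightarrow> (\<And>i. i \<in> I \<Longrightarrow> smooth_on U (f i)) \<Longrightarrow> smooth_on U (\<lambda>x. \<Sum>i\<in>I. f i x)"
  by (induction I rule: infinite_finite_induct) (auto intro: smooth_on_add)

lemma smooth_on_linear:
  assumes "bounded_linear h" shows "smooth_on UNIV h"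
proof -
  have "Ck_on k UNIV h" for k
  proof (cases k)
    case 0 then show ?thesis using assms linear_continuous_on by auto
  next
    case (Suc n)
    show ?thesis unfolding Suc
      by (rule Ck_on_SucI[where f' = "\<lambda>x. h"])
        (use assms Ck_on_const in \<open>auto intro: bounded_linear_imp_has_derivative\<close>)
  qed
  then show ?thesis by (simp add: smooth_on_def)
qed

lemma deriv_at_expand:
  assumes "f differentiable (at x)"
  shows "deriv_at f x v = (\<Sum>b\<in>Basis. (v \<bullet> b) *\<^sub>R deriv_at f x b)"
proof -
  have l: "linear (deriv_at f x)" using assms by (rule linear_frechet_derivative)
  have "deriv_at f x (\<Sum>b\<in>Basis. (v \<bullet> b) *\<^sub>R b) = (\<Sum>b\<in>Basis. (v \<bullet> b) *\<^sub>R deriv_at f x b)"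
    unfolding linear_sum[OF l] linear_scale[OF l] ..
  then show ?thesis unfolding euclidean_representation .
qed

lemma smooth_on_deriv_along:
  assumes U: "open U" and f: "smooth_on U f" and X: "smooth_on U X"
  shows "smooth_on U (\<lambda>x. deriv_at f x (X x))"
proof -
  have "smooth_on U (\<lambda>x. \<Sum>b\<in>Basis. (X x \<bullet> b) *\<^sub>R deriv_at f x b)"
    by (intro smooth_on_sum[OF U] smooth_on_bilinear[OF bounded_bilinear_scaleR U] 
      smooth_on_linear_image[OF bounded_linear_inner_left U X] smooth_on_deriv[OF f])
  then show ?thesis
    by (rule smooth_on_cong[OF U, THEN iffD2, rotated])
      (erule deriv_at_expand[OF smooth_on_differentiable[OF f]])
qed

text \<open>The direction \<open>X y\<close> varies with the point, which produces the first summand; in the second one the direction is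
  frozen at \<open>x\<close>.\<close>
lemma deriv_along_product_rule:
  assumes U: "open U" and x: "x \<in> U" and f: "smooth_on U f" and X: "smooth_on U X"
  shows "deriv_at (\<lambda>y. deriv_at f y (X y)) x e
    = deriv_at f x (deriv_at X x e) + deriv_at (\<lambda>y. deriv_at f y (X x)) x e"
proof -
  note dX = smooth_on_has_derivative[OF X x]
  note df = smooth_on_has_derivative[OF smooth_on_deriv[OF f] x]
  note ex = deriv_at_expand[OF smooth_on_differentiable[OF f]]
  have "deriv_at (\<lambda>y. deriv_at f y (X y)) x e = deriv_at (\<lambda>y. \<Sum>b\<in>Basis. (X y \<bullet> b) *\<^sub>R deriv_at f y b) x e"
    by (rule fun_cong[OF deriv_at_cong[OF U x]]) (erule ex)
  also have "\<dots> = (\<Sum>b\<in>Basis. (deriv_at X x e \<bullet> b) *\<^sub>R deriv_at f x b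
       + (X x \<bullet> b) *\<^sub>R deriv_at (\<lambda>y. deriv_at f y b) x e)"
    by (rule fun_cong[OF frechet_derivative_at[symmetric]])
      (auto intro!: derivative_eq_intros dX df simp: add_ac)
  also have "\<dots> = deriv_at f x (deriv_at X x e) + (\<Sum>b\<in>Basis. (X x \<bullet> b) *\<^sub>R deriv_at (\<lambda>y. deriv_at f y b) x e)"
    by (simp only: ex[OF x, of "deriv_at X x e"] sum.distrib)
  also have "(\<Sum>b\<in>Basis. (X x \<bullet> b) *\<^sub>R deriv_at (\<lambda>y. deriv_at f y b) x e)
      = deriv_at (\<lambda>y. \<Sum>b\<in>Basis. (X x \<bullet> b) *\<^sub>R deriv_at f y b) x e"
    by (rule fun_cong[OF frechet_derivative_at])
      (auto intro!: derivative_eq_intros df)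
  also have "\<dots> = deriv_at (\<lambda>y. deriv_at f y (X x)) x e"
    by (rule fun_cong[OF deriv_at_cong[OF U x]]) (erule ex[symmetric])
  finally show ?thesis .
qed

lemma smooth_on_line_derivative:
  fixes f :: "'a::euclidean_space \<Rightarrow> real"
  assumes "smooth_on U f" "c + s *\<^sub>R v \<in> U"
  shows "((\<lambda>s. f (c + s *\<^sub>R v)) has_real_derivative deriv_at f (c + s *\<^sub>R v) v) (at s)"
proof -
  note d = smooth_on_has_derivative[OF assms]
  have "((\<lambda>s. f (c + s *\<^sub>R v)) has_derivative (\<lambda>d. deriv_at f (c + s *\<^sub>R v) (d *\<^sub>R v))) (at s)"
    by (rule has_derivative_compose[where f = "\<lambda>s. c + s *\<^sub>R v" and g = f, OF _ d])
      (auto intro!: derivative_eq_intros)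
  moreover have "deriv_at f (c + s *\<^sub>R v) (d *\<^sub>R v) = deriv_at f (c + s *\<^sub>R v) v * d" for d
    using linear_scale[OF has_derivative_linear[OF d]] by (simp add: mult.commute)
  ultimately show ?thesis by (simp add: has_field_derivative_def)
qed

text \<open>The second difference of \<open>f\<close> over a small parallelogram is an exact mixed derivative at a
  point of the parallelogram. It is symmetric in \<open>v\<close> and \<open>w\<close>, which is what makes the mixed derivatives commute in the limit.\<close>
lemma second_difference_mean_value:
  fixes f :: "'a::euclidean_space \<Rightarrow> real"
  assumes f: "smooth_on U f" and h: "h > 0"
    and U: "\<And>s r. 0 \<le> s \<Longrightarrow> s \<le> h \<Longrightarrow> 0 \<le> r \<Longrightarrow> r \<le> h \<Longrightarrow> x + s *\<^sub>R v + r *\<^sub>R w \<in> U"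
  shows "\<exists>s r. 0 \<le> s \<and> s \<le> h \<and> 0 \<le> r \<and> r \<le> h \<and>
    f (x + h *\<^sub>R v + h *\<^sub>R w) - f (x + h *\<^sub>R v) - f (x + h *\<^sub>R w) + f x
      = h * h * deriv_at (\<lambda>y. deriv_at f y v) (x + s *\<^sub>R v + r *\<^sub>R w) w"
proof -
  let ?g = "\<lambda>s. f ((x + h *\<^sub>R w) + s *\<^sub>R v) - f (x + s *\<^sub>R v)"
  let ?fv = "\<lambda>y. deriv_at f y v"
  have "DERIV ?g s :> ?fv ((x + h *\<^sub>R w) + s *\<^sub>R v) - ?fv (x + s *\<^sub>R v)" if "0 \<le> s" "s \<le> h" for s
    using U[OF that, of h] U[OF that, of 0] h
    by (intro DERIV_diff smooth_on_line_derivative[OF f]) (auto simp: algebra_simps)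
  from MVT2[OF h this] obtain s where s: "0 < s" "s < h"
    and gs: "?g h - ?g 0 = h * (?fv ((x + h *\<^sub>R w) + s *\<^sub>R v) - ?fv (x + s *\<^sub>R v))" by auto
  have "DERIV (\<lambda>r. ?fv ((x + s *\<^sub>R v) + r *\<^sub>R w)) r :> deriv_at ?fv ((x + s *\<^sub>R v) + r *\<^sub>R w) w"
    if "0 \<le> r" "r \<le> h" for r
    using U[of s r] s that by (intro smooth_on_line_derivative[OF smooth_on_deriv[OF f]]) auto
  from MVT2[OF h this] obtain r where r: "0 < r" "r < h"
    and gr: "?fv ((x + s *\<^sub>R v) + h *\<^sub>R w) - ?fv (x + s *\<^sub>R v) = h * deriv_at ?fv ((x + s *\<^sub>R v) + r *\<^sub>R w) w"
    by auto
  show ?thesis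
    using gs gr s r by (intro exI[of _ s] exI[of _ r]) (auto simp: algebra_simps)
qed

lemma second_derivative_symmetric_real:
  fixes f :: "'a::euclidean_space \<Rightarrow> real"
  assumes U: "open U" and x: "x \<in> U" and f: "smooth_on U f"
  shows "deriv_at (\<lambda>y. deriv_at f y v) x w = deriv_at (\<lambda>y. deriv_at f y w) x v"
proof (rule ccontr)
  let ?a = "\<lambda>y. deriv_at (\<lambda>y. deriv_at f y v) y w" and ?b = "\<lambda>y. deriv_at (\<lambda>y. deriv_at f y w) y v"
  assume ne: "?a x \<noteq> ?b x"
  define e where "e = dist (?a x) (?b x) / 2"
  have e: "e > 0" using ne by (simp add: e_def)
  have c: "continuous_on U ?a" "continuous_on U ?b"
    by (rule smooth_on_continuous[OF smooth_on_deriv[OF smooth_on_deriv[OF f]]])+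
  obtain d1 where d1: "d1 > 0" "\<And>y. y \<in> U \<Longrightarrow> dist y x < d1 \<Longrightarrow> dist (?a y) (?a x) < e"
    using c(1)[unfolded continuous_on_iff, rule_format, OF x e] by auto
  obtain d2 where d2: "d2 > 0" "\<And>y. y \<in> U \<Longrightarrow> dist y x < d2 \<Longrightarrow> dist (?b y) (?b x) < e"
    using c(2)[unfolded continuous_on_iff, rule_format, OF x e] by auto
  obtain d3 where d3: "d3 > 0" "ball x d3 \<subseteq> U" using U x by (rule openE)
  define d where "d = min d1 (min d2 d3)"
  have d: "d > 0" using d1 d2 d3 by (simp add: d_def)
  \<comment> \<open>The parallelogram of side \<open>h\<close> lies in the ball of radius \<open>d\<close>; the summand 1 covers the case of zero directions.\<close>
  define h where "h = d / (2 * (1 + norm v + norm w))"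
  have np: "1 + norm v + norm w > 0" by (smt (verit) norm_ge_zero)
  have h: "h > 0" using d np by (simp add: h_def)
  have hd: "h * (norm v + norm w) < d"
  proof -
    have "h * (norm v + norm w) \<le> h * (1 + norm v + norm w)" using h by simp
    also have "\<dots> = d / 2" using np by (simp add: h_def field_simps)
    finally show ?thesis using d by simp
  qed
  have near: "dist (x + s *\<^sub>R v + r *\<^sub>R w) x < d" if "0 \<le> s" "s \<le> h" "0 \<le> r" "r \<le> h" for s r
  proof -
    have "dist (x + s *\<^sub>R v + r *\<^sub>R w) x = norm (s *\<^sub>R v + r *\<^sub>R w)" by (simp add: dist_norm add.assoc)
    also have "\<dots> \<le> s * norm v + r * norm w" using norm_triangle_ineq[of "s *\<^sub>R v" "r *\<^sub>R w"] that by simp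
    also have "\<dots> \<le> h * norm v + h * norm w" using that by (intro add_mono mult_right_mono) auto
    also have "\<dots> < d" using hd by (simp add: distrib_left)
    finally show ?thesis .
  qed
  have inU: "x + s *\<^sub>R v + r *\<^sub>R w \<in> U" if "0 \<le> s" "s \<le> h" "0 \<le> r" "r \<le> h" for s r
    using near[OF that] d3 by (auto simp: d_def dist_commute)
  have inU': "x + s *\<^sub>R w + r *\<^sub>R v \<in> U" if "0 \<le> s" "s \<le> h" "0 \<le> r" "r \<le> h" for s r
    using inU[of r s] that by (simp add: algebra_simps)
  obtain s r where sr: "0 \<le> s" "s \<le> h" "0 \<le> r" "r \<le> h"
    and A: "f (x + h *\<^sub>R v + h *\<^sub>R w) - f (x + h *\<^sub>R v) - f (x + h *\<^sub>R w) + f x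
      = h * h * ?a (x + s *\<^sub>R v + r *\<^sub>R w)"
    using second_difference_mean_value[where U = U and x = x and v = v and w = w, OF f h inU] by auto
  obtain s' r' where sr': "0 \<le> s'" "s' \<le> h" "0 \<le> r'" "r' \<le> h"
    and B: "f (x + h *\<^sub>R w + h *\<^sub>R v) - f (x + h *\<^sub>R w) - f (x + h *\<^sub>R v) + f x
      = h * h * ?b (x + s' *\<^sub>R w + r' *\<^sub>R v)"
    using second_difference_mean_value[where U = U and x = x and v = w and w = v, OF f h inU'] by auto
  have "h * h * ?a (x + s *\<^sub>R v + r *\<^sub>R w) = h * h * ?b (x + r' *\<^sub>R v + s' *\<^sub>R w)"
    using A B by (simp add: algebra_simps)
  then have eq: "?a (x + s *\<^sub>R v + r *\<^sub>R w) = ?b (x + r' *\<^sub>R v + s' *\<^sub>R w)" using h by simp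
  have "dist (?a (x + s *\<^sub>R v + r *\<^sub>R w)) (?a x) < e"
    using near[OF sr] inU[OF sr] by (intro d1) (simp_all add: d_def)
  moreover have "dist (?b (x + r' *\<^sub>R v + s' *\<^sub>R w)) (?b x) < e"
    using near[OF sr'(3,4,1,2)] inU[OF sr'(3,4,1,2)] by (intro d2) (simp_all add: d_def)
  ultimately have "dist (?a x) (?b x) < dist (?a x) (?b x)"
    unfolding eq e_def by (rule dist_triangle_half_r)
  then show False by simp
qed

lemma deriv_at_inner:
  assumes "f differentiable (at x)"
  shows "deriv_at (\<lambda>y. f y \<bullet> b) x v = deriv_at f x v \<bullet> b"
  by (rule fun_cong[OF frechet_derivative_at[symmetric]])
    (use assms frechet_derivative_works in \<open>auto intro!: derivative_eq_intros\<close>)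

lemma second_derivative_symmetric:
  assumes U: "open U" and x: "x \<in> U" and f: "smooth_on U f"
  shows "deriv_at (\<lambda>y. deriv_at f y v) x w = deriv_at (\<lambda>y. deriv_at f y w) x v"
proof (rule euclidean_eqI)
  fix b :: 'b assume "b \<in> Basis"
  have fb: "smooth_on U (\<lambda>y. f y \<bullet> b)" by (rule smooth_on_linear_image[OF bounded_linear_inner_left U f])
  have *: "deriv_at (\<lambda>y. deriv_at f y v) x w \<bullet> b = deriv_at (\<lambda>y. deriv_at (\<lambda>y. f y \<bullet> b) y v) x w" for v w
  proof -
    have "deriv_at (\<lambda>y. deriv_at f y v) x w \<bullet> b = deriv_at (\<lambda>y. deriv_at f y v \<bullet> b) x w"
      by (rule deriv_at_inner[symmetric]) (rule smooth_on_differentiable[OF smooth_on_deriv[OF f] x])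
    also have "\<dots> = deriv_at (\<lambda>y. deriv_at (\<lambda>y. f y \<bullet> b) y v) x w"
      by (rule fun_cong[OF deriv_at_cong[OF U x]])
        (rule deriv_at_inner[symmetric], erule smooth_on_differentiable[OF f])
    finally show ?thesis .
  qed
  show "deriv_at (\<lambda>y. deriv_at f y v) x w \<bullet> b = deriv_at (\<lambda>y. deriv_at f y w) x v \<bullet> b"
    using *[of v w] *[of w v] second_derivative_symmetric_real[OF U x fb, of v w] by argo
qed

text \<open>Vector fields are first-order operators whose commutator is the Lie bracket: the second derivatives of \<open>f\<close> cancel
  by symmetry.\<close>
lemma deriv_along_commutator:
  assumes U: "open U" and x: "x \<in> U" and f: "smooth_on U f" and X: "smooth_on U X" and Y: "smooth_on U Y"
  shows "deriv_at (\<lambda>y. deriv_at f y (Y y)) x (X x) - deriv_at (\<lambda>y. deriv_at f y (X y)) x (Y x)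
    = deriv_at f x (lie_bracket X Y x)"
proof -
  have l: "linear (deriv_at f x)"
    by (rule linear_frechet_derivative[OF smooth_on_differentiable[OF f x]])
  have "deriv_at f x (lie_bracket X Y x) = deriv_at f x (deriv_at Y x (X x)) - deriv_at f x (deriv_at X x (Y x))"
    unfolding lie_bracket_def by (rule linear_diff[OF l])
  then show ?thesis
    by (simp only: deriv_along_product_rule[OF U x f X, of "Y x"] deriv_along_product_rule[OF U x f Y, of "X x"]
      second_derivative_symmetric[OF U x f, of "X x" "Y x"] add_diff_cancel_right)
qed

lemma deriv_at_bilinear:
  assumes "bounded_bilinear h" "f differentiable (at x)" "g differentiable (at x)"
  shows "deriv_at (\<lambda>y. h (f y) (g y)) x v = h (f x) (deriv_at g x v) + h (deriv_at f x v) (g x)"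
  by (rule fun_cong[OF frechet_derivative_at[symmetric]])
    (rule bounded_bilinear.FDERIV[OF assms(1) assms(2,3)[unfolded frechet_derivative_works]])

lemma deriv_at_linear_image:
  assumes "bounded_linear h" "f differentiable (at x)"
  shows "deriv_at (\<lambda>y. h (f y)) x v = h (deriv_at f x v)"
  by (rule fun_cong[OF frechet_derivative_at[symmetric]])
    (rule bounded_linear.has_derivative[OF assms(1) assms(2)[unfolded frechet_derivative_works]])

lemma deriv_at_cos:
  fixes \<theta> :: "'a::euclidean_space \<Rightarrow> real"
  assumes "\<theta> differentiable (at x)"
  shows "deriv_at (\<lambda>y. cos (\<theta> y)) x v = - sin (\<theta> x) * deriv_at \<theta> x v"
  by (rule fun_cong[OF frechet_derivative_at[symmetric]])
    (use assms[unfolded frechet_derivative_works] in \<open>auto intro!: derivative_eq_intros\<close>)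

lemma deriv_at_sin:
  fixes \<theta> :: "'a::euclidean_space \<Rightarrow> real"
  assumes "\<theta> differentiable (at x)"
  shows "deriv_at (\<lambda>y. sin (\<theta> y)) x v = cos (\<theta> x) * deriv_at \<theta> x v"
  by (rule fun_cong[OF frechet_derivative_at[symmetric]])
    (use assms[unfolded frechet_derivative_works] in \<open>auto intro!: derivative_eq_intros\<close>)

lemma deriv_at_const: "deriv_at (\<lambda>y. c) x v = 0"
  by (simp add: frechet_derivative_const)

lemma deriv_at_zero_of_constant_on:
  assumes "open U" "x \<in> U" "\<And>y. y \<in> U \<Longrightarrow> f y = c" shows "deriv_at f x v = 0"
  by (subst deriv_at_cong[OF assms(1,2), of f "\<lambda>_. c"]) (simp_all add: assms(3) deriv_at_const)

lemma fst_deriv_at: "f differentiable (at x) \<Longrightarrow> fst (deriv_at f x v) = deriv_at (\<lambda>y. fst (f y)) x v"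
  and snd_deriv_at: "f differentiable (at x) \<Longrightarrow> snd (deriv_at f x v) = deriv_at (\<lambda>y. snd (f y)) x v"
  using deriv_at_linear_image[OF bounded_linear_fst] deriv_at_linear_image[OF bounded_linear_snd] by metis+

lemma deriv_at_mult:
  fixes f g :: "'a::euclidean_space \<Rightarrow> real"
  assumes "f differentiable (at x)" "g differentiable (at x)"
  shows "deriv_at (\<lambda>y. f y * g y) x v = f x * deriv_at g x v + deriv_at f x v * g x"
  by (rule deriv_at_bilinear[OF bounded_bilinear_mult assms])

lemma deriv_at_add:
  assumes "f differentiable (at x)" "g differentiable (at x)"
  shows "deriv_at (\<lambda>y. f y + g y) x v = deriv_at f x v + deriv_at g x v"
  by (rule fun_cong[OF frechet_derivative_at[symmetric]])
    (use assms[unfolded frechet_derivative_works] in \<open>auto intro!: derivative_eq_intros\<close>)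

lemma differentiable_bilinear:
  assumes "bounded_bilinear h" "f differentiable (at x)" "g differentiable (at x)"
  shows "(\<lambda>y. h (f y) (g y)) differentiable (at x)"
  using bounded_bilinear.FDERIV[OF assms(1) assms(2,3)[unfolded frechet_derivative_works]]
  unfolding differentiable_def by blast

lemma differentiable_linear_image:
  assumes "bounded_linear h" "f differentiable (at x)"
  shows "(\<lambda>y. h (f y)) differentiable (at x)"
  using bounded_linear.has_derivative[OF assms(1) assms(2)[unfolded frechet_derivative_works]]
  unfolding differentiable_def by blast

lemma differentiable_Pair:
  assumes "f differentiable (at x)" "g differentiable (at x)"
  shows "(\<lambda>y. (f y, g y)) differentiable (at x)"
  using has_derivative_Pair[OF assms[unfolded frechet_derivative_works]] unfolding differentiable_def by blast

lemma deriv_at_ident: "deriv_at (\<lambda>y. y) x v = v"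
  by (rule fun_cong[OF frechet_derivative_at[symmetric]]) (rule has_derivative_ident)

section \<open>Quaternions and the left trivialization\<close>

definition qcnj :: "quat \<Rightarrow> quat" where "qcnj x = (fst x, - snd x)"

lemma qmult_assoc: "(x \<odot> y) \<odot> z = x \<odot> (y \<odot> z)"
  by (auto simp: qmult_def prod_eq_iff vec_eq_iff forall_3 cross3_simps inner_vec_def sum_3 algebra_simps)

lemma bounded_bilinear_qmult: "bounded_bilinear (\<odot>)"
proof -
  have "bilinear (\<odot>)"
    unfolding bilinear_def
    by (auto intro!: linearI simp: qmult_def prod_eq_iff algebra_simps inner_add_left inner_add_right
        cross_add_left cross_add_right cross_mult_left cross_mult_right)
  then show ?thesis by (simp add: bilinear_conv_bounded_bilinear)
qed

lemma qmult_1 [simp]: "(1, 0) \<odot> x = x" "x \<odot> (1, 0) = x"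
  by (auto simp: qmult_def prod_eq_iff)

lemma qcnj_qmult_self: "qcnj x \<odot> x = ((norm x)\<^sup>2, 0)" "x \<odot> qcnj x = ((norm x)\<^sup>2, 0)"
  by (auto simp: qmult_def qcnj_def prod_eq_iff norm_prod_def dot_square_norm power2_eq_square)

lemma qinv_unit: "norm x = 1 \<Longrightarrow> qinv x = qcnj x"
  by (simp add: qinv_def qcnj_def)

lemma qcnj_qmult: "qcnj (x \<odot> y) = qcnj y \<odot> qcnj x"
  by (auto simp: qmult_def qcnj_def prod_eq_iff vec_eq_iff forall_3 cross3_simps)

lemma inner_qmult: "(x \<odot> y) \<bullet> (x \<odot> z) = (x \<bullet> x) * (y \<bullet> z)"
  by (simp add: qmult_def inner_prod_def inner_vec_def sum_3 cross3_simps algebra_simps)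

lemma qmult_linear_right: "x \<odot> (y + z) = x \<odot> y + x \<odot> z" "x \<odot> (y - z) = x \<odot> y - x \<odot> z"
    "x \<odot> (r *\<^sub>R y) = r *\<^sub>R (x \<odot> y)"
  using bounded_bilinear_qmult
  by (auto simp: bounded_bilinear.add_right bounded_bilinear.diff_right bounded_bilinear.scaleR_right)

type_synonym alg = "(real ^ 3) \<times> (real ^ 3)"

text \<open>Left translation to the identity, followed by the linear change \<open>(\<alpha>, \<beta>) \<mapsto> ((\<alpha> + \<beta>) / sqrt 3, \<beta> - \<alpha>)\<close>
  of the two imaginary quaternions. The change is chosen so that the nearly Kaehler metric becomes the standard inner product.
  The definition makes sense for all pairs and is bilinear in them, which allows it to be differentiated in the base point.\<close>
definition ltriv :: "quat \<times> quat \<Rightarrow> quat \<times> quat \<Rightarrow> alg" where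
  "ltriv x Z = (let \<alpha> = snd (qcnj (fst x) \<odot> fst Z); \<beta> = snd (qcnj (snd x) \<odot> snd Z)
     in ((1 / sqrt 3) *\<^sub>R (\<alpha> + \<beta>), \<beta> - \<alpha>))"

text \<open>For fixed \<open>w\<close> these are the left-invariant vector fields.\<close>
definition linv :: "quat \<times> quat \<Rightarrow> alg \<Rightarrow> quat \<times> quat" where
  "linv x w = (fst x \<odot> (0, (1 / 2) *\<^sub>R (sqrt 3 *\<^sub>R fst w - snd w)),
     snd x \<odot> (0, (1 / 2) *\<^sub>R (sqrt 3 *\<^sub>R fst w + snd w)))"

definition jrot :: "alg \<Rightarrow> alg" where "jrot w = (snd w, - fst w)"

text \<open>The Lie bracket of \<open>S\<^sup>3 \<times> S\<^sup>3\<close> in the coordinates of \<open>ltriv\<close>: for imaginary quaternions it is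
  \<open>[\<alpha>, \<alpha>'] = 2 \<alpha> \<times> \<alpha>'\<close> in each factor.\<close>
definition bracket :: "alg \<Rightarrow> alg \<Rightarrow> alg" where
  "bracket w z = ((1 / sqrt 3) *\<^sub>R (3 *\<^sub>R cross3 (fst w) (fst z) + cross3 (snd w) (snd z)),
     sqrt 3 *\<^sub>R (cross3 (fst w) (snd z) + cross3 (snd w) (fst z)))"

lemma S3S3_norm: "x \<in> S3S3 \<Longrightarrow> norm (fst x) = 1" "x \<in> S3S3 \<Longrightarrow> norm (snd x) = 1"
  by (auto simp: S3S3_def)

lemma unit_qcnj_cancel: "norm p = 1 \<Longrightarrow> qcnj p \<odot> (p \<odot> y) = y"
  "norm p = 1 \<Longrightarrow> p \<odot> (qcnj p \<odot> y) = y"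
  by (simp_all add: qmult_assoc[symmetric] qcnj_qmult_self)

lemma ltriv_left_mult:
  assumes "x \<in> S3S3"
  shows "ltriv x (fst x \<odot> (0, a), snd x \<odot> (0, b)) = ((1 / sqrt 3) *\<^sub>R (a + b), b - a)"
  using S3S3_norm[OF assms] by (simp add: ltriv_def unit_qcnj_cancel)

lemma ltriv_linv: "x \<in> S3S3 \<Longrightarrow> ltriv x (linv x w) = w"
  unfolding linv_def by (simp add: ltriv_left_mult prod_eq_iff vec_eq_iff field_simps)

lemma TS3S3_left_mult: "Z \<in> TS3S3 x \<longleftrightarrow> (\<exists>a b. Z = (fst x \<odot> (0, a), snd x \<odot> (0, b)))"
  unfolding TS3S3_def by (force simp: prod_eq_iff)

lemma linv_tangent: "linv x w \<in> TS3S3 x"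
  unfolding linv_def TS3S3_left_mult by blast

lemma linv_ltriv:
  assumes "x \<in> S3S3" "Z \<in> TS3S3 x" shows "linv x (ltriv x Z) = Z"
proof -
  obtain a b where Z: "Z = (fst x \<odot> (0, a), snd x \<odot> (0, b))" using assms(2) TS3S3_left_mult by blast
  have "(1 / 2) *\<^sub>R (sqrt 3 *\<^sub>R (1 / sqrt 3) *\<^sub>R (a + b) - (b - a)) = a"
    "(1 / 2) *\<^sub>R (sqrt 3 *\<^sub>R (1 / sqrt 3) *\<^sub>R (a + b) + (b - a)) = b"
    by (simp_all add: vec_eq_iff)
  then show ?thesis unfolding Z ltriv_left_mult[OF assms(1)] linv_def fst_conv snd_conv by simp
qed

lemma TS3S3_iff_orthogonal:
  assumes "x \<in> S3S3"
  shows "Z \<in> TS3S3 x \<longleftrightarrow> fst x \<bullet> fst Z = 0 \<and> snd x \<bullet> snd Z = 0"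
proof -
  have *: "(\<exists>a. U = p \<odot> (0, a)) \<longleftrightarrow> p \<bullet> U = 0" if p: "norm p = 1" for p U :: quat
  proof
    assume "\<exists>a. U = p \<odot> (0, a)"
    then show "p \<bullet> U = 0" using inner_qmult[of p "(1, 0)"] by auto
  next
    assume "p \<bullet> U = 0"
    then have "qcnj p \<odot> U = (0, snd (qcnj p \<odot> U))"
      by (simp add: prod_eq_iff qmult_def qcnj_def inner_prod_def)
    then show "\<exists>a. U = p \<odot> (0, a)" using unit_qcnj_cancel(2)[OF p, of U] by metis
  qed
  show ?thesis unfolding TS3S3_left_mult
    using *[OF S3S3_norm(1)[OF assms], of "fst Z"] *[OF S3S3_norm(2)[OF assms], of "snd Z"]
    by (auto simp: prod_eq_iff)
qed

lemma acs_left_mult: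
  assumes "x \<in> S3S3"
  shows "\<J> x (fst x \<odot> (0, a), snd x \<odot> (0, b))
    = (fst x \<odot> (0, (1 / sqrt 3) *\<^sub>R (2 *\<^sub>R b - a)), snd x \<odot> (0, (1 / sqrt 3) *\<^sub>R (b - 2 *\<^sub>R a)))"
proof -
  have lin: "p \<odot> (0, r *\<^sub>R (c *\<^sub>R u + v)) = r *\<^sub>R (c *\<^sub>R (p \<odot> (0, u)) + p \<odot> (0, v))" for p r c u v
    unfolding qmult_linear_right[symmetric] by simp
  have neg: "p \<odot> (0, - u) = - (p \<odot> (0, u))" for p u
    using qmult_linear_right(3)[of p "-1" "(0, u)"] by simp
  note n = S3S3_norm[OF assms]
  have "\<J> x (fst x \<odot> (0, a), snd x \<odot> (0, b))
    = (1 / sqrt 3) *\<^sub>R (2 *\<^sub>R (fst x \<odot> (0, b)) - fst x \<odot> (0, a), - 2 *\<^sub>R (snd x \<odot> (0, a)) + snd x \<odot> (0, b))"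
    by (simp add: acs_def split_beta qinv_unit n qmult_assoc unit_qcnj_cancel)
  then show ?thesis
    using lin[of "fst x" "1 / sqrt 3" 2 b "- a"] lin[of "snd x" "1 / sqrt 3" "-2" a b]
    by (simp add: neg)
qed

lemma aps_left_mult:
  assumes "x \<in> S3S3"
  shows "\<P> x (fst x \<odot> (0, a), snd x \<odot> (0, b)) = (fst x \<odot> (0, b), snd x \<odot> (0, a))"
  using S3S3_norm[OF assms] by (simp add: aps_def split_beta qinv_unit qmult_assoc unit_qcnj_cancel)

lemma ltriv_acs:
  assumes "x \<in> S3S3" "Z \<in> TS3S3 x" shows "ltriv x (\<J> x Z) = jrot (ltriv x Z)"
proof -
  obtain a b where Z: "Z = (fst x \<odot> (0, a), snd x \<odot> (0, b))" using assms(2) TS3S3_left_mult by blast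
  have "(1 / 3) *\<^sub>R c = (1 / sqrt 3) *\<^sub>R (1 / sqrt 3) *\<^sub>R c" for c :: "real ^ 3" by simp
  then show ?thesis unfolding Z acs_left_mult[OF assms(1)] ltriv_left_mult[OF assms(1)]
    by (simp add: jrot_def prod_eq_iff vec_eq_iff field_simps)
qed

lemma acs_tangent: "x \<in> S3S3 \<Longrightarrow> Z \<in> TS3S3 x \<Longrightarrow> \<J> x Z \<in> TS3S3 x"
  unfolding TS3S3_left_mult using acs_left_mult by metis

lemma ltriv_aps:
  assumes "x \<in> S3S3" "Z \<in> TS3S3 x" shows "ltriv x (\<P> x Z) = (fst (ltriv x Z), - snd (ltriv x Z))"
proof -
  obtain a b where Z: "Z = (fst x \<odot> (0, a), snd x \<odot> (0, b))" using assms(2) TS3S3_left_mult by blast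
  show ?thesis unfolding Z aps_left_mult[OF assms(1)] ltriv_left_mult[OF assms(1)]
    by (simp add: add.commute)
qed

lemma nk_metric_ltriv:
  assumes "x \<in> S3S3" "Z \<in> TS3S3 x" "Z' \<in> TS3S3 x"
  shows "nk_metric x Z Z' = ltriv x Z \<bullet> ltriv x Z'"
proof -
  obtain a b where Z: "Z = (fst x \<odot> (0, a), snd x \<odot> (0, b))" using assms(2) TS3S3_left_mult by blast
  obtain a' b' where Z': "Z' = (fst x \<odot> (0, a'), snd x \<odot> (0, b'))" using assms(3) TS3S3_left_mult by blast
  have n: "fst x \<bullet> fst x = 1" "snd x \<bullet> snd x = 1"
    using S3S3_norm[OF assms(1)] by (simp_all add: dot_square_norm)
  show ?thesis unfolding Z Z' acs_left_mult[OF assms(1)] ltriv_left_mult[OF assms(1)] nk_metric_def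
    unfolding inner_Pair inner_qmult n
    by (simp add: algebra_simps inner_add_left inner_add_right inner_diff_left inner_diff_right)
qed

lemma bounded_bilinear_ltriv: "bounded_bilinear ltriv"
proof -
  have "bilinear ltriv"
    unfolding bilinear_def
    by (auto intro!: linearI simp: add_divide_distrib scaleR_left_distrib ltriv_def Let_def qcnj_def qmult_def prod_eq_iff algebra_simps
        cross_add_left cross_add_right cross_mult_left cross_mult_right)
  then show ?thesis by (simp add: bilinear_conv_bounded_bilinear)
qed

lemma bounded_linear_jrot: "bounded_linear jrot"
  by (auto intro!: linear_conv_bounded_linear[THEN iffD1] linearI simp: jrot_def)

text \<open>The derivative of the trivialization in its base point is \<open>ltriv X Y\<close>. Its skew part is the only
  correction when a commutator of vector fields is computed in the trivialization, so this identity
  produces both the Maurer-Cartan equation and the torsion formula of the Levi-Civita connection.\<close>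
lemma ltriv_commutator:
  assumes "x \<in> S3S3" "X \<in> TS3S3 x" "Y \<in> TS3S3 x"
  shows "ltriv Y X - ltriv X Y = bracket (ltriv x X) (ltriv x Y)"
proof -
  obtain a b where X: "X = (fst x \<odot> (0, a), snd x \<odot> (0, b))" using assms(2) TS3S3_left_mult by blast
  obtain c d where Y: "Y = (fst x \<odot> (0, c), snd x \<odot> (0, d))" using assms(3) TS3S3_left_mult by blast
  have *: "snd (qcnj (p \<odot> (0, a)) \<odot> (p \<odot> (0, c))) = - cross3 a c" if "norm p = 1" for p a c
    by (simp add: qcnj_qmult qmult_assoc unit_qcnj_cancel[OF that]) (simp add: qcnj_def qmult_def)
  have e: "ltriv x X = ((1 / sqrt 3) *\<^sub>R (a + b), b - a)" "ltriv x Y = ((1 / sqrt 3) *\<^sub>R (c + d), d - c)"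
    unfolding X Y by (rule ltriv_left_mult[OF assms(1)])+
  have e': "ltriv X Y = ((1 / sqrt 3) *\<^sub>R (- cross3 a c - cross3 b d), cross3 a c - cross3 b d)"
    "ltriv Y X = ((1 / sqrt 3) *\<^sub>R (- cross3 c a - cross3 d b), cross3 c a - cross3 d b)"
    unfolding X Y ltriv_def fst_conv snd_conv *[OF S3S3_norm(1)[OF assms(1)]] *[OF S3S3_norm(2)[OF assms(1)]] Let_def
    by simp_all
  have q: "sqrt 3 * (sqrt 3 * x) = 3 * x" for x by (simp add: mult.assoc[symmetric])
  show ?thesis unfolding e e' bracket_def fst_conv snd_conv
    by (simp add: prod_eq_iff vec_eq_iff forall_3 cross3_simps field_simps) (simp add: q field_simps)
qed

section \<open>Moving frames along a Lagrangian immersion\<close>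

text \<open>Differentiate \<open>G \<bullet> G = 1\<close> in both factors.\<close>
lemma sphere_product_map_tangent:
  assumes U: "open U" and x: "x \<in> U" and F: "F differentiable (at x)"
    and S: "\<And>y. y \<in> U \<Longrightarrow> F y \<in> S3S3"
  shows "deriv_at F x v \<in> TS3S3 (F x)"
proof -
  have *: "G x \<bullet> deriv_at G x v = 0"
    if d: "G differentiable (at x)" and n: "\<And>y. y \<in> U \<Longrightarrow> norm (G y) = 1" for G :: "_ \<Rightarrow> quat"
  proof -
    have "deriv_at (\<lambda>y. G y \<bullet> G y) x v = 0"
      by (rule deriv_at_zero_of_constant_on[OF U x, where c = 1]) (simp add: dot_square_norm n)
    then show ?thesis unfolding deriv_at_bilinear[OF bounded_bilinear_inner d d] by (simp add: inner_commute)
  qed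
  note fd = deriv_at_linear_image[OF bounded_linear_fst F] deriv_at_linear_image[OF bounded_linear_snd F]
  have d: "(\<lambda>y. fst (F y)) differentiable (at x)" "(\<lambda>y. snd (F y)) differentiable (at x)"
    using F bounded_linear.has_derivative[OF bounded_linear_fst] bounded_linear.has_derivative[OF bounded_linear_snd]
    unfolding differentiable_def by blast+
  show ?thesis
    unfolding TS3S3_iff_orthogonal[OF S[OF x]] fd[symmetric]
    using *[OF d(1)] *[OF d(2)] S3S3_norm S by simp
qed

text \<open>Used for two maps \<open>T\<close>: the identity, and the trivialized differential of the immersion. Orthonormality of the images makes
  the map of coordinates injective on \<open>\<real>\<^sup>3\<close>, hence surjective.\<close>
lemma orthonormal_coordinates:
  fixes b :: "3 \<Rightarrow> real ^ 3" and T :: "real ^ 3 \<Rightarrow> 'a::real_inner"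
  assumes T: "linear T" and o: "\<And>i j. T (b i) \<bullet> T (b j) = (if i = j then 1 else 0)"
  shows "e = (\<Sum>k\<in>UNIV. (T e \<bullet> T (b k)) *\<^sub>R b k)"
proof -
  let ?L = "\<lambda>a :: real ^ 3. \<Sum>k\<in>UNIV. (a $ k) *\<^sub>R b k"
  have L: "linear ?L"
    by (rule linearI) (simp_all add: scaleR_left_distrib sum.distrib scaleR_sum_right)
  have c: "T (?L a) \<bullet> T (b k) = a $ k" for a k
    by (simp add: linear_sum[OF T] linear_scale[OF T] inner_sum_left o if_distrib cong: if_cong)
  have "inj ?L"
    by (rule injI) (metis c vec_eq_iff)
  then have "surj ?L" using linear_injective_imp_surjective[OF L] by simp
  then obtain a where "e = ?L a" by blast
  then show ?thesis using c[of a] by simp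
qed

locale lagrangian_frame =
  fixes V :: "(real ^ 3) set" and F :: "real ^ 3 \<Rightarrow> quat \<times> quat"
    and E :: "3 \<Rightarrow> real ^ 3 \<Rightarrow> real ^ 3" and \<theta> :: "3 \<Rightarrow> real ^ 3 \<Rightarrow> real"
  assumes open_V: "open V" and smooth_F: "smooth_on V F"
    and smooth_E: "\<And>i. smooth_on V (E i)" and smooth_\<theta>: "\<And>i. smooth_on V (\<theta> i)"
    and F_S3S3: "\<And>y. y \<in> V \<Longrightarrow> F y \<in> S3S3"
    and lagrangian: "\<And>y u v. y \<in> V \<Longrightarrow> nk_metric (F y) (\<J> (F y) (deriv_at F y u)) (deriv_at F y v) = 0"
    and orthonormal: "\<And>y i j. y \<in> V \<Longrightarrow> induced_metric F y (E i y) (E j y) = (if i = j then 1 else 0)"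
    and angle: "\<And>y i. y \<in> V \<Longrightarrow> \<P> (F y) (deriv_at F y (E i y)) =
            cos (2 * \<theta> i y) *\<^sub>R deriv_at F y (E i y) +
            sin (2 * \<theta> i y) *\<^sub>R \<J> (F y) (deriv_at F y (E i y))"
begin

definition \<omega> :: "real ^ 3 \<Rightarrow> real ^ 3 \<Rightarrow> alg" where "\<omega> y e = ltriv (F y) (deriv_at F y e)"

definition w :: "3 \<Rightarrow> real ^ 3 \<Rightarrow> alg" where "w i y = \<omega> y (E i y)"

definition b :: "3 \<Rightarrow> real ^ 3 \<Rightarrow> real ^ 3" where
  "b i y = cos (\<theta> i y) *\<^sub>R fst (w i y) + sin (\<theta> i y) *\<^sub>R snd (w i y)"

abbreviation D :: "3 \<Rightarrow> (real ^ 3 \<Rightarrow> 'b::euclidean_space) \<Rightarrow> real ^ 3 \<Rightarrow> 'b" where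
  "D i f y \<equiv> deriv_at f y (E i y)"

definition \<Gamma> :: "3 \<Rightarrow> 3 \<Rightarrow> 3 \<Rightarrow> real ^ 3 \<Rightarrow> real" where "\<Gamma> i j k y = D i (b j) y \<bullet> b k y"

definition c :: "3 \<Rightarrow> 3 \<Rightarrow> 3 \<Rightarrow> real ^ 3 \<Rightarrow> real" where
  "c i j k y = \<omega> y (lie_bracket (E i) (E j) y) \<bullet> w k y"

lemma tangent: "y \<in> V \<Longrightarrow> deriv_at F y e \<in> TS3S3 (F y)"
  by (rule sphere_product_map_tangent[OF open_V _ smooth_on_differentiable[OF smooth_F] F_S3S3])

lemma linear_\<omega>: "y \<in> V \<Longrightarrow> linear (\<omega> y)"
  unfolding \<omega>_def
  by (intro linear_compose[unfolded o_def, OF linear_frechet_derivative]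
      smooth_on_differentiable[OF smooth_F] bounded_linear.linear
      bounded_bilinear.bounded_linear_right[OF bounded_bilinear_ltriv])

lemma w_inner: "y \<in> V \<Longrightarrow> w i y \<bullet> w j y = (if i = j then 1 else 0)"
  using orthonormal[of y i j]
  by (simp add: induced_metric_def nk_metric_ltriv F_S3S3 tangent w_def \<omega>_def)

lemma jrot_\<omega>_inner: "y \<in> V \<Longrightarrow> jrot (\<omega> y u) \<bullet> \<omega> y v = 0"
  using lagrangian[of y u v]
  by (simp add: nk_metric_ltriv F_S3S3 tangent \<omega>_def acs_tangent ltriv_acs)

text \<open>In the coordinates \<open>(u, v)\<close> the operator \<open>\<P>\<close> is complex conjugation of \<open>u + i v\<close> and \<open>\<J>\<close> is multiplication by
  \<open>- i\<close>. The eigenvalue equation therefore says that \<open>u + i v\<close> is \<open>exp (i \<theta>)\<close> times a real vector.\<close>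
lemma w_polar:
  assumes "y \<in> V" shows "w i y = (cos (\<theta> i y) *\<^sub>R b i y, sin (\<theta> i y) *\<^sub>R b i y)"
proof -
  obtain p q where w: "w i y = (p, q)" by force
  let ?c = "cos (\<theta> i y)" and ?s = "sin (\<theta> i y)"
  have "ltriv (F y) (\<P> (F y) (deriv_at F y (E i y))) = ltriv (F y) (cos (2 * \<theta> i y) *\<^sub>R deriv_at F y (E i y) +
            sin (2 * \<theta> i y) *\<^sub>R \<J> (F y) (deriv_at F y (E i y)))"
    by (simp only: angle[OF assms])
  then have "(p, - q) = cos (2 * \<theta> i y) *\<^sub>R (p, q) + sin (2 * \<theta> i y) *\<^sub>R (q, - p)"
    using w
    by (simp add: ltriv_aps ltriv_acs F_S3S3 tangent assms w_def \<omega>_def jrot_def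
      bounded_bilinear.add_right[OF bounded_bilinear_ltriv] bounded_bilinear.scaleR_right[OF bounded_bilinear_ltriv])
  then have e: "p = cos (2 * \<theta> i y) *\<^sub>R p + sin (2 * \<theta> i y) *\<^sub>R q" "- q = cos (2 * \<theta> i y) *\<^sub>R q - sin (2 * \<theta> i y) *\<^sub>R p"
    by (auto simp: prod_eq_iff)
  have 1: "?c * (?c * p $ k + ?s * q $ k) = p $ k" "?s * (?c * p $ k + ?s * q $ k) = q $ k" for k
  proof -
    have "p $ k = cos (2 * \<theta> i y) * p $ k + sin (2 * \<theta> i y) * q $ k"
      "- q $ k = cos (2 * \<theta> i y) * q $ k - sin (2 * \<theta> i y) * p $ k"
      using e by (auto simp: vec_eq_iff)
    moreover have "?s\<^sup>2 = 1 - ?c\<^sup>2" by (simp add: sin_squared_eq)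
    ultimately show "?c * (?c * p $ k + ?s * q $ k) = p $ k" "?s * (?c * p $ k + ?s * q $ k) = q $ k"
      unfolding cos_double sin_double by algebra+
  qed
  then show ?thesis by (simp add: w b_def prod_eq_iff vec_eq_iff)
qed

text \<open>Metric and Kaehler form give \<open>cos (\<theta>\<^sub>i - \<theta>\<^sub>j) (b\<^sub>i \<bullet> b\<^sub>j) = \<delta>\<^sub>i\<^sub>j\<close> and \<open>sin (\<theta>\<^sub>i - \<theta>\<^sub>j) (b\<^sub>i \<bullet> b\<^sub>j) = 0\<close>, and sine and
  cosine have no common zero.\<close>
lemma b_inner:
  assumes "y \<in> V" shows "b i y \<bullet> b j y = (if i = j then 1 else 0)"
proof -
  let ?d = "\<theta> i y - \<theta> j y"
  have 1: "cos ?d * (b i y \<bullet> b j y) = (if i = j then 1 else 0)"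
    using w_inner[OF assms, of i j] unfolding w_polar[OF assms] by (simp add: cos_diff algebra_simps)
  have 2: "sin ?d * (b i y \<bullet> b j y) = 0"
    using jrot_\<omega>_inner[OF assms, of "E i y" "E j y", folded w_def] unfolding w_polar[OF assms] jrot_def
    by (simp add: sin_diff algebra_simps)
  show ?thesis
  proof (cases "i = j")
    case False
    with 1 2 have "cos ?d * (b i y \<bullet> b j y) = 0" by simp
    with 2 show ?thesis using False sin_zero_norm_cos_one[of ?d] by auto
  qed (use 1 in simp)
qed

lemma smooth_w: "smooth_on V (w i)"
  unfolding w_def \<omega>_def
  by (intro smooth_on_bilinear[OF bounded_bilinear_ltriv] smooth_on_deriv_along open_V smooth_F smooth_E)

lemma smooth_b: "smooth_on V (b i)"
  unfolding b_def
  by (intro smooth_on_add smooth_on_bilinear[OF bounded_bilinear_scaleR] smooth_on_cos smooth_on_sin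
      smooth_on_linear_image[OF bounded_linear_fst] smooth_on_linear_image[OF bounded_linear_snd] smooth_w smooth_\<theta> open_V)

lemma smooth_D: "smooth_on V f \<Longrightarrow> smooth_on V (D i f)"
  by (intro smooth_on_deriv_along open_V smooth_E)

lemma smooth_\<Gamma>: "smooth_on V (\<Gamma> i j k)"
  unfolding \<Gamma>_def by (intro smooth_on_bilinear[OF bounded_bilinear_inner] smooth_D smooth_b open_V)

lemma frame_expansion: "y \<in> V \<Longrightarrow> e = (\<Sum>k\<in>UNIV. (\<omega> y e \<bullet> w k y) *\<^sub>R E k y)"
  unfolding w_def by (rule orthonormal_coordinates[OF linear_\<omega>]) (use w_inner in \<open>simp_all add: w_def\<close>)

lemma b_expansion: "y \<in> V \<Longrightarrow> e = (\<Sum>k\<in>UNIV. (e \<bullet> b k y) *\<^sub>R b k y)"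
  using orthonormal_coordinates[of "\<lambda>x. x" "\<lambda>k. b k y"] b_inner linear_id[unfolded id_def] by auto

lemma D_commutator:
  assumes y: "y \<in> V" and f: "smooth_on V f"
  shows "D i (D j f) y - D j (D i f) y = (\<Sum>k\<in>UNIV. c i j k y *\<^sub>R D k f y)"
proof -
  have l: "linear (deriv_at f y)" by (rule linear_frechet_derivative[OF smooth_on_differentiable[OF f y]])
  have "D i (D j f) y - D j (D i f) y = deriv_at f y (lie_bracket (E i) (E j) y)"
    by (rule deriv_along_commutator[OF open_V y f smooth_E smooth_E])
  also have "\<dots> = deriv_at f y (\<Sum>k\<in>UNIV. c i j k y *\<^sub>R E k y)"
    unfolding c_def frame_expansion[OF y, symmetric] ..
  also have "\<dots> = (\<Sum>k\<in>UNIV. c i j k y *\<^sub>R D k f y)"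
    unfolding linear_sum[OF l] linear_scale[OF l] ..
  finally show ?thesis .
qed

text \<open>The mixed second derivatives of \<open>F\<close> cancel up to the Lie bracket of the frame fields. What is
  left comes from differentiating the left translation.\<close>
lemma maurer_cartan:
  assumes y: "y \<in> V"
  shows "D i (w j) y - D j (w i) y + bracket (w i y) (w j y) = (\<Sum>k\<in>UNIV. c i j k y *\<^sub>R w k y)"
proof -
  have 1: "D i (w j) y = ltriv (F y) (D i (D j F) y) + ltriv (D i F y) (D j F y)" for i j
    unfolding w_def \<omega>_def
    by (rule deriv_at_bilinear[OF bounded_bilinear_ltriv])
      (rule smooth_on_differentiable[OF _ y], intro smooth_D smooth_F)+
  have 2: "ltriv (D i F y) (D j F y) - ltriv (D j F y) (D i F y) = bracket (w j y) (w i y)"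
    unfolding w_def \<omega>_def by (rule ltriv_commutator[OF F_S3S3[OF y] tangent[OF y] tangent[OF y]])
  have 3: "bracket (w j y) (w i y) = - bracket (w i y) (w j y)"
    by (simp add: bracket_def prod_eq_iff vec_eq_iff forall_3 cross3_simps algebra_simps
        add_divide_distrib diff_divide_distrib)
  have "ltriv (F y) (D i (D j F) y) - ltriv (F y) (D j (D i F) y) = ltriv (F y) (D i (D j F) y - D j (D i F) y)"
    by (rule bounded_bilinear.diff_right[OF bounded_bilinear_ltriv, symmetric])
  also have "\<dots> = (\<Sum>k\<in>UNIV. c i j k y *\<^sub>R w k y)"
    unfolding D_commutator[OF y smooth_F] w_def \<omega>_def
      bounded_bilinear.sum_right[OF bounded_bilinear_ltriv] bounded_bilinear.scaleR_right[OF bounded_bilinear_ltriv] ..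
  finally show ?thesis using 2 3 unfolding 1 by (simp add: algebra_simps)
qed

lemma differentiable_V: "smooth_on V f \<Longrightarrow> y \<in> V \<Longrightarrow> f differentiable (at y)"
  by (rule smooth_on_differentiable)

lemma D_w:
  assumes y: "y \<in> V"
  shows "D i (w j) y =
    (- (sin (\<theta> j y) * D i (\<theta> j) y) *\<^sub>R b j y + cos (\<theta> j y) *\<^sub>R D i (b j) y,
     (cos (\<theta> j y) * D i (\<theta> j) y) *\<^sub>R b j y + sin (\<theta> j y) *\<^sub>R D i (b j) y)"
proof -
  note dw = differentiable_V[OF smooth_w y]
  note d\<theta> = differentiable_V[OF smooth_\<theta> y] and db = differentiable_V[OF smooth_b y]
  note dc = differentiable_V[OF smooth_on_cos[OF open_V smooth_\<theta>] y]
    and ds = differentiable_V[OF smooth_on_sin[OF open_V smooth_\<theta>] y]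
  have "fst (D i (w j) y) = D i (\<lambda>y. cos (\<theta> j y) *\<^sub>R b j y) y"
    unfolding fst_deriv_at[OF dw]
    by (rule fun_cong[OF deriv_at_cong[OF open_V y]]) (simp add: w_polar)
  moreover have "snd (D i (w j) y) = D i (\<lambda>y. sin (\<theta> j y) *\<^sub>R b j y) y"
    unfolding snd_deriv_at[OF dw]
    by (rule fun_cong[OF deriv_at_cong[OF open_V y]]) (simp add: w_polar)
  ultimately show ?thesis
    unfolding deriv_at_bilinear[OF bounded_bilinear_scaleR dc db] deriv_at_bilinear[OF bounded_bilinear_scaleR ds db]
      deriv_at_cos[OF d\<theta>] deriv_at_sin[OF d\<theta>]
    by (simp add: prod_eq_iff)
qed

lemma D_w_inner:
  assumes y: "y \<in> V"
  shows "D i (w j) y \<bullet> w k y = cos (\<theta> j y - \<theta> k y) * \<Gamma> i j k y"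
    and "D i (w j) y \<bullet> jrot (w k y) = - (if j = k then D i (\<theta> j) y else 0) - sin (\<theta> j y - \<theta> k y) * \<Gamma> i j k y"
proof -
  have "D i (w j) y \<bullet> w k y =
    (cos (\<theta> j y) * sin (\<theta> k y) - sin (\<theta> j y) * cos (\<theta> k y)) * D i (\<theta> j) y * (b j y \<bullet> b k y)
    + cos (\<theta> j y - \<theta> k y) * \<Gamma> i j k y"
    unfolding D_w[OF y] w_polar[OF y] \<Gamma>_def cos_diff by (simp add: inner_add_left algebra_simps)
  then show "D i (w j) y \<bullet> w k y = cos (\<theta> j y - \<theta> k y) * \<Gamma> i j k y"
    by (simp add: b_inner[OF y])
  have "D i (w j) y \<bullet> jrot (w k y) =
    - cos (\<theta> j y - \<theta> k y) * D i (\<theta> j) y * (b j y \<bullet> b k y) - sin (\<theta> j y - \<theta> k y) * \<Gamma> i j k y"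
    unfolding D_w[OF y] w_polar[OF y] \<Gamma>_def sin_diff cos_diff jrot_def
    by (simp add: inner_add_left inner_diff_left algebra_simps)
  then show "D i (w j) y \<bullet> jrot (w k y) = - (if j = k then D i (\<theta> j) y else 0) - sin (\<theta> j y - \<theta> k y) * \<Gamma> i j k y"
    by (simp add: b_inner[OF y])
qed

lemma bracket_w_inner:
  assumes y: "y \<in> V"
  shows "bracket (w i y) (w j y) \<bullet> w k y = (cross3 (b i y) (b j y) \<bullet> b k y) / sqrt 3 *
      ((3 * cos (\<theta> i y) * cos (\<theta> j y) + sin (\<theta> i y) * sin (\<theta> j y)) * cos (\<theta> k y)
        + 3 * sin (\<theta> i y + \<theta> j y) * sin (\<theta> k y))"
    and "bracket (w i y) (w j y) \<bullet> jrot (w k y) = (cross3 (b i y) (b j y) \<bullet> b k y) / sqrt 3 *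
      ((3 * cos (\<theta> i y) * cos (\<theta> j y) + sin (\<theta> i y) * sin (\<theta> j y)) * sin (\<theta> k y)
        - 3 * sin (\<theta> i y + \<theta> j y) * cos (\<theta> k y))"
  unfolding w_polar[OF y] bracket_def jrot_def sin_add
  by (simp_all add: cross_mult_left cross_mult_right inner_add_left inner_diff_left field_simps)
    (simp_all add: mult.assoc[symmetric])

text \<open>The component of the Maurer-Cartan equation along \<open>jrot (w\<^sub>k)\<close>. The structure functions \<open>c\<close> drop out,
  because the immersion is Lagrangian.\<close>
lemma normal_equation:
  assumes y: "y \<in> V"
  shows "bracket (w i y) (w j y) \<bullet> jrot (w k y) = (if j = k then D i (\<theta> j) y else 0) - (if i = k then D j (\<theta> i) y else 0)
    + sin (\<theta> j y - \<theta> k y) * \<Gamma> i j k y - sin (\<theta> i y - \<theta> k y) * \<Gamma> j i k y"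
proof -
  have "(\<Sum>l\<in>UNIV. c i j l y *\<^sub>R w l y) \<bullet> jrot (w k y) = 0"
    using jrot_\<omega>_inner[OF y, of "E k y"] by (simp add: inner_sum_left inner_sum_right w_def inner_commute[of _ "jrot _"])
  then show ?thesis
    unfolding maurer_cartan[OF y, symmetric] inner_add_left inner_diff_left D_w_inner[OF y] by (simp split: if_splits)
qed

lemma tangential_equation:
  assumes y: "y \<in> V"
  shows "c i j k y = cos (\<theta> j y - \<theta> k y) * \<Gamma> i j k y - cos (\<theta> i y - \<theta> k y) * \<Gamma> j i k y
    + bracket (w i y) (w j y) \<bullet> w k y"
proof -
  have "(\<Sum>l\<in>UNIV. c i j l y *\<^sub>R w l y) \<bullet> w k y = c i j k y"
    by (simp add: inner_sum_left w_inner[OF y] if_distrib cong: if_cong)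
  then show ?thesis
    unfolding maurer_cartan[OF y, symmetric] inner_add_left inner_diff_left D_w_inner[OF y] by simp
qed

lemma \<Gamma>_skew:
  assumes y: "y \<in> V" shows "\<Gamma> i k j y = - \<Gamma> i j k y"
proof -
  note db = differentiable_V[OF smooth_b y]
  have "D i (\<lambda>y. b j y \<bullet> b k y) y = 0"
    by (rule deriv_at_zero_of_constant_on[OF open_V y]) (rule b_inner)
  then show ?thesis
    unfolding deriv_at_bilinear[OF bounded_bilinear_inner db db] \<Gamma>_def by (simp add: inner_commute)
qed

lemma D_inner_expansion:
  assumes y: "y \<in> V" shows "D i (b j) y \<bullet> D k (b l) y = (\<Sum>n\<in>UNIV. \<Gamma> i j n y * \<Gamma> k l n y)"
proof -
  have "D i (b j) y = (\<Sum>n\<in>UNIV. \<Gamma> i j n y *\<^sub>R b n y)"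
    unfolding \<Gamma>_def by (rule b_expansion[OF y])
  then have "D i (b j) y \<bullet> D k (b l) y = (\<Sum>n\<in>UNIV. \<Gamma> i j n y *\<^sub>R b n y) \<bullet> D k (b l) y" by (rule arg_cong)
  also have "\<dots> = (\<Sum>n\<in>UNIV. \<Gamma> i j n y * \<Gamma> k l n y)"
    unfolding \<Gamma>_def[of k l] by (simp add: inner_sum_left inner_sum_right inner_commute)
  finally show ?thesis .
qed

text \<open>The \<open>b\<^sub>k\<close> take values in the fixed space \<open>\<real>\<^sup>3\<close>, so \<open>\<Gamma>\<close> is a trivial connection written in a moving basis
  and its curvature vanishes.\<close>
lemma flatness:
  assumes y: "y \<in> V"
  shows "D i (\<Gamma> j k l) y - D j (\<Gamma> i k l) y = (\<Sum>n\<in>UNIV. c i j n y * \<Gamma> n k l y)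
    + (\<Sum>n\<in>UNIV. \<Gamma> j k n y * \<Gamma> i l n y) - (\<Sum>n\<in>UNIV. \<Gamma> i k n y * \<Gamma> j l n y)"
proof -
  have *: "D i (\<Gamma> j k l) y = D j (b k) y \<bullet> D i (b l) y + D i (D j (b k)) y \<bullet> b l y" for i j
    unfolding \<Gamma>_def
    by (rule deriv_at_bilinear[OF bounded_bilinear_inner]; rule differentiable_V[OF _ y]; intro smooth_D smooth_b)
  have "D i (D j (b k)) y \<bullet> b l y - D j (D i (b k)) y \<bullet> b l y = (\<Sum>n\<in>UNIV. c i j n y *\<^sub>R D n (b k) y) \<bullet> b l y"
    unfolding D_commutator[OF y smooth_b, symmetric] inner_diff_left ..
  also have "\<dots> = (\<Sum>n\<in>UNIV. c i j n y * \<Gamma> n k l y)"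
    by (simp add: inner_sum_left \<Gamma>_def)
  finally show ?thesis unfolding * D_inner_expansion[OF y] by linarith
qed

definition \<sigma> :: "real ^ 3 \<Rightarrow> real" where "\<sigma> y = cross3 (b 1 y) (b 2 y) \<bullet> b 3 y"

lemma triple_cyclic:
  "cross3 (b 2 y) (b 3 y) \<bullet> b 1 y = \<sigma> y" "cross3 (b 3 y) (b 1 y) \<bullet> b 2 y = \<sigma> y"
  by (simp_all add: \<sigma>_def cross3_simps inner_vec_def sum_3)

lemma \<sigma>_square: assumes y: "y \<in> V" shows "(\<sigma> y)\<^sup>2 = 1"
proof -
  have "cross3 (b 1 y) (b 2 y) = (\<Sum>k\<in>UNIV. (cross3 (b 1 y) (b 2 y) \<bullet> b k y) *\<^sub>R b k y)"
    by (rule b_expansion[OF y])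
  also have "\<dots> = \<sigma> y *\<^sub>R b 3 y" by (simp add: sum_3 \<sigma>_def dot_cross_self)
  finally have "(norm (cross3 (b 1 y) (b 2 y)))\<^sup>2 = (\<sigma> y)\<^sup>2"
    using b_inner[OF y, of 3 3] by (simp add: power_mult_distrib power2_norm_eq_inner)
  moreover have "(norm (cross3 (b 1 y) (b 2 y)))\<^sup>2 = 1"
    using norm_cross[of "b 1 y" "b 2 y"] by (simp add: power2_norm_eq_inner b_inner[OF y])
  ultimately show ?thesis by simp
qed

text \<open>In the cyclic sum of the three normal equations with distinct indices each \<open>\<Gamma>\<close> occurs twice with opposite signs.
  The bracket terms that remain add up to a multiple of the sine of the angle sum.\<close>
lemma angle_sum: assumes y: "y \<in> V" shows "sin (\<theta> 1 y + \<theta> 2 y + \<theta> 3 y) = 0"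
proof -
  note n = normal_equation[OF y, unfolded bracket_w_inner[OF y]]
  have A: "\<Gamma> i k j y = - \<Gamma> i j k y" for i j k by (rule \<Gamma>_skew[OF y])
  have s: "sin (\<theta> i y - \<theta> j y) = - sin (\<theta> j y - \<theta> i y)" for i j
    using sin_minus[of "\<theta> j y - \<theta> i y"] by simp
  let ?t = "\<lambda>i j k. (3 * cos (\<theta> i y) * cos (\<theta> j y) + sin (\<theta> i y) * sin (\<theta> j y)) * sin (\<theta> k y)
        - 3 * sin (\<theta> i y + \<theta> j y) * cos (\<theta> k y)"
  have "\<sigma> y / sqrt 3 * (?t 1 2 3 + ?t 2 3 1 + ?t 3 1 2) = 0"
    using n[of 1 2 3] n[of 2 3 1] n[of 3 1 2] A[of 1 3 2] A[of 2 1 3] A[of 3 2 1] s[of 3 2] s[of 2 1] s[of 1 3]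
    by (simp add: \<sigma>_def[symmetric] triple_cyclic distrib_left)
  moreover have "\<sigma> y \<noteq> 0" using \<sigma>_square[OF y] by auto
  ultimately have "?t 1 2 3 + ?t 2 3 1 + ?t 3 1 2 = 0" by simp
  moreover have "?t 1 2 3 + ?t 2 3 1 + ?t 3 1 2 = - 3 * sin (\<theta> 1 y + \<theta> 2 y + \<theta> 3 y)"
    unfolding sin_add cos_add by algebra
  ultimately show ?thesis by simp
qed

end

section \<open>Frames with vanishing angle sum\<close>

lemma sum_zero_sin_cos:
  fixes \<alpha> \<beta> \<gamma> :: real assumes "\<alpha> + \<beta> + \<gamma> = 0"
  shows "sin \<gamma> = - (sin \<alpha> * cos \<beta> + cos \<alpha> * sin \<beta>)" "cos \<gamma> = cos \<alpha> * cos \<beta> - sin \<alpha> * sin \<beta>"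
    "(sin \<alpha>)\<^sup>2 + (cos \<alpha>)\<^sup>2 = 1" "(sin \<beta>)\<^sup>2 + (cos \<beta>)\<^sup>2 = 1"
proof -
  have \<gamma>: "\<gamma> = - (\<alpha> + \<beta>)" using assms by simp
  show "sin \<gamma> = - (sin \<alpha> * cos \<beta> + cos \<alpha> * sin \<beta>)" "cos \<gamma> = cos \<alpha> * cos \<beta> - sin \<alpha> * sin \<beta>"
    unfolding \<gamma> by (simp_all only: sin_minus cos_minus sin_add cos_add)
qed simp_all

lemma normal_trig:
  fixes \<alpha> \<beta> \<gamma> :: real assumes "\<alpha> + \<beta> + \<gamma> = 0"
  shows "(3 * cos \<alpha> * cos \<beta> + sin \<alpha> * sin \<beta>) * sin \<gamma> - 3 * sin (\<alpha> + \<beta>) * cos \<gamma>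
    = 2 * cos \<beta> * sin (\<gamma> - \<alpha>) - 2 * cos \<alpha> * sin (\<beta> - \<gamma>)"
  using sum_zero_sin_cos[OF assms] unfolding sin_add sin_diff by algebra

lemma tangential_trig:
  fixes \<alpha> \<beta> \<gamma> :: real assumes "\<alpha> + \<beta> + \<gamma> = 0"
  shows "(3 * cos \<alpha> * cos \<beta> + sin \<alpha> * sin \<beta>) * cos \<gamma> + 3 * sin (\<alpha> + \<beta>) * sin \<gamma>
    = 2 * cos (\<beta> - \<gamma>) * cos \<alpha> + 2 * cos (\<gamma> - \<alpha>) * cos \<beta> - 1"
  using sum_zero_sin_cos[OF assms] unfolding sin_add cos_diff by algebra

lemma sin_cyclic:
  fixes \<alpha> \<beta> \<gamma> :: real assumes "\<alpha> + \<beta> + \<gamma> = 0"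
  shows "sin \<alpha> * cos \<beta> + cos \<alpha> * sin \<beta> = - sin \<gamma>"
  using sum_zero_sin_cos(1)[OF assms] by simp

text \<open>Since \<open>\<sigma> = \<plusminus> 1\<close> records the orientation of \<open>b\<^sub>1, b\<^sub>2, b\<^sub>3\<close>, the constant \<open>\<kappa>\<close> is \<open>\<plusminus> 1 / sqrt 3\<close>; keeping
  the sign in \<open>\<kappa>\<close> avoids a choice of orientation.\<close>
locale normalized_frame = lagrangian_frame +
  fixes \<kappa> :: real
  assumes angle_sum_zero: "\<And>y. y \<in> V \<Longrightarrow> \<theta> 1 y + \<theta> 2 y + \<theta> 3 y = 0"
    and orientation: "\<And>y. y \<in> V \<Longrightarrow> \<sigma> y / sqrt 3 = \<kappa>"
begin

abbreviation s :: "3 \<Rightarrow> 3 \<Rightarrow> real ^ 3 \<Rightarrow> real" where "s i j y \<equiv> sin (\<theta> i y - \<theta> j y)"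
abbreviation d :: "3 \<Rightarrow> 3 \<Rightarrow> real ^ 3 \<Rightarrow> real" where "d i j y \<equiv> cos (\<theta> i y - \<theta> j y)"

text \<open>With angle sum zero the three normal equations with distinct indices say that the expression below does not
  change under cyclic permutation of the indices.\<close>
definition m :: "real ^ 3 \<Rightarrow> real" where
  "m y = s 2 3 y * \<Gamma> 1 2 3 y + 2 * \<kappa> * cos (\<theta> 1 y) * s 2 3 y"

lemma \<kappa>_nonzero: "y \<in> V \<Longrightarrow> \<kappa> \<noteq> 0"
  using orientation[of y] \<sigma>_square[of y] by auto

text \<open>The derivatives of the angles are connection coefficients. They are also, up to sign, the components of the second
  fundamental form with a repeated index.\<close>
lemma D_angle:
  assumes y: "y \<in> V" and "i \<noteq> j" shows "D i (\<theta> j) y = s i j y * \<Gamma> j i j y"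
  using normal_equation[OF y, of i j j] assms(2) by (simp add: bracket_w_inner[OF y] dot_cross_self)

lemma c_repeated:
  assumes y: "y \<in> V" and "i \<noteq> j"
  shows "c i j j y = - d i j y * \<Gamma> j i j y" "c i j i y = d j i y * \<Gamma> i j i y"
  using tangential_equation[OF y, of i j j] tangential_equation[OF y, of i j i]
    \<Gamma>_skew[OF y, of i j j] \<Gamma>_skew[OF y, of j i i]
  by (simp_all add: bracket_w_inner[OF y] dot_cross_self)

lemma m_cyclic:
  assumes y: "y \<in> V"
  shows "m y = s 3 1 y * \<Gamma> 2 3 1 y + 2 * \<kappa> * cos (\<theta> 2 y) * s 3 1 y"
    and "m y = s 1 2 y * \<Gamma> 3 1 2 y + 2 * \<kappa> * cos (\<theta> 3 y) * s 1 2 y"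
proof -
  have A: "\<Gamma> i k j y = - \<Gamma> i j k y" for i j k by (rule \<Gamma>_skew[OF y])
  have s: "s i j y = - s j i y" for i j using sin_minus[of "\<theta> j y - \<theta> i y"] by simp
  note n = normal_equation[OF y, unfolded bracket_w_inner[OF y]]
  note z = angle_sum_zero[OF y]
  have z': "\<theta> 2 y + \<theta> 3 y + \<theta> 1 y = 0" "\<theta> 3 y + \<theta> 1 y + \<theta> 2 y = 0" using z by simp_all
  show 2: "m y = s 3 1 y * \<Gamma> 2 3 1 y + 2 * \<kappa> * cos (\<theta> 2 y) * s 3 1 y"
    using n[of 1 2 3] A[of 2 1 3] s[of 1 3] unfolding normal_trig[OF z]
    by (simp add: m_def \<sigma>_def[symmetric] orientation[OF y] triple_cyclic algebra_simps)
  show "m y = s 1 2 y * \<Gamma> 3 1 2 y + 2 * \<kappa> * cos (\<theta> 3 y) * s 1 2 y"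
    using n[of 2 3 1] A[of 3 2 1] s[of 2 1] unfolding normal_trig[OF z'(1)] 2
    by (simp add: \<sigma>_def[symmetric] orientation[OF y] triple_cyclic algebra_simps)
qed

text \<open>The denominators of the cotangents are cleared, so that the formulas hold at all points.\<close>
lemma c_distinct:
  assumes y: "y \<in> V"
  shows "c 1 2 3 y * (s 2 3 y * s 3 1 y) = - m y * s 1 2 y - \<kappa> * (s 2 3 y * s 3 1 y)"
    and "c 2 3 1 y * (s 3 1 y * s 1 2 y) = - m y * s 2 3 y - \<kappa> * (s 3 1 y * s 1 2 y)"
    and "c 3 1 2 y * (s 1 2 y * s 2 3 y) = - m y * s 3 1 y - \<kappa> * (s 1 2 y * s 2 3 y)"
proof -
  have A: "\<Gamma> i k j y = - \<Gamma> i j k y" for i j k by (rule \<Gamma>_skew[OF y])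
  have d: "d i j y = d j i y" for i j using cos_minus[of "\<theta> j y - \<theta> i y"] by simp
  note t = tangential_equation[OF y, unfolded bracket_w_inner[OF y]]
  note z = angle_sum_zero[OF y]
  have z': "\<theta> 2 y + \<theta> 3 y + \<theta> 1 y = 0" "\<theta> 3 y + \<theta> 1 y + \<theta> 2 y = 0" using z by simp_all
  have e: "c * (p * q) = - mm * r - \<kappa> * (p * q)"
    if "c = dp * a + dq * a' + \<kappa> * (2 * dp * ca + 2 * dq * ca' - 1)"
      "mm = p * a + 2 * \<kappa> * ca * p" "mm = q * a' + 2 * \<kappa> * ca' * q" "p * dq + dp * q = - r"
    for c p q mm r dp dq a a' ca ca' :: real
    using that by algebra
  show "c 1 2 3 y * (s 2 3 y * s 3 1 y) = - m y * s 1 2 y - \<kappa> * (s 2 3 y * s 3 1 y)"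
  proof (rule e)
    show "c 1 2 3 y = d 2 3 y * \<Gamma> 1 2 3 y + d 3 1 y * \<Gamma> 2 3 1 y
      + \<kappa> * (2 * d 2 3 y * cos (\<theta> 1 y) + 2 * d 3 1 y * cos (\<theta> 2 y) - 1)"
      using t[of 1 2 3] A[of 2 1 3] d[of 1 3] unfolding tangential_trig[OF z]
      by (simp add: \<sigma>_def[symmetric] orientation[OF y])
    show "s 2 3 y * d 3 1 y + d 2 3 y * s 3 1 y = - s 1 2 y" by (rule sin_cyclic) simp
  qed (use m_def m_cyclic[OF y] in auto)
  show "c 2 3 1 y * (s 3 1 y * s 1 2 y) = - m y * s 2 3 y - \<kappa> * (s 3 1 y * s 1 2 y)"
  proof (rule e)
    show "c 2 3 1 y = d 3 1 y * \<Gamma> 2 3 1 y + d 1 2 y * \<Gamma> 3 1 2 y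
      + \<kappa> * (2 * d 3 1 y * cos (\<theta> 2 y) + 2 * d 1 2 y * cos (\<theta> 3 y) - 1)"
      using t[of 2 3 1] A[of 3 2 1] d[of 2 1] unfolding tangential_trig[OF z'(1)]
      by (simp add: triple_cyclic orientation[OF y])
    show "s 3 1 y * d 1 2 y + d 3 1 y * s 1 2 y = - s 2 3 y" by (rule sin_cyclic) simp
  qed (use m_def m_cyclic[OF y] in auto)
  show "c 3 1 2 y * (s 1 2 y * s 2 3 y) = - m y * s 3 1 y - \<kappa> * (s 1 2 y * s 2 3 y)"
  proof (rule e)
    show "c 3 1 2 y = d 1 2 y * \<Gamma> 3 1 2 y + d 2 3 y * \<Gamma> 1 2 3 y
      + \<kappa> * (2 * d 1 2 y * cos (\<theta> 3 y) + 2 * d 2 3 y * cos (\<theta> 1 y) - 1)"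
      using t[of 3 1 2] A[of 1 3 2] d[of 3 2] unfolding tangential_trig[OF z'(2)]
      by (simp add: triple_cyclic orientation[OF y])
    show "s 1 2 y * d 2 3 y + d 1 2 y * s 2 3 y = - s 3 1 y" by (rule sin_cyclic) simp
  qed (use m_def m_cyclic[OF y] in auto)
qed
end

section \<open>Elimination in the compatibility equations\<close>

text \<open>The letters stand for values at one point: \<open>s1, s2, s3\<close> and \<open>d3\<close> for sines and cosines of
  angle differences, \<open>c1, c2, c3\<close> for cosines of the angles, \<open>a1, a2, a3\<close> for the \<open>\<Gamma>\<close> with distinct indices,
  \<open>X\<close> and \<open>DG\<close> for derivatives along the first frame field. The lemma is applied to the index triples \<open>(1, 2, 3)\<close>,
  \<open>(1, 3, 2)\<close> and \<open>(2, 3, 1)\<close>; eliminating the \<open>a\<^sub>i\<close> in favour of \<open>m\<close> makes most terms cancel.\<close>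
lemma second_derivative_elimination:
  fixes s1 s2 s3 c1 c2 c3 d3 a1 a2 a3 m k G x X DG c123 :: real
  assumes "x = s3 * G" "X = - (x * d3 * G) + s3 * DG" "DG = - d3 * G\<^sup>2 + c123 * a3 - a1 * a2"
    "m = s1 * a1 + 2 * k * c1 * s1" "m = s2 * a2 + 2 * k * c2 * s2" "m = s3 * a3 + 2 * k * c3 * s3"
    "c123 * (s1 * s2) = - m * s3 - k * (s1 * s2)" "c1 * s1 + c2 * s2 + c3 * s3 = 0" "c3 = 2 * c1 * c2 - d3"
  shows "X * (s1 * s2 * s3) = - 2 * d3 * x\<^sup>2 * s1 * s2 - 2 * m\<^sup>2 * s3\<^sup>2 - k * m * (s1 * s2 * s3)
    - 2 * k\<^sup>2 * d3 * s1 * s2 * s3\<^sup>2"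
proof -
  have a: "s1 * a1 = m - 2 * k * c1 * s1" "s2 * a2 = m - 2 * k * c2 * s2" "s3 * a3 = m - 2 * k * c3 * s3"
    using assms(4-6) by simp_all
  have "X * (s1 * s2 * s3) = - 2 * d3 * x\<^sup>2 * s1 * s2 + s3 * ((c123 * (s1 * s2)) * (s3 * a3)) - s3\<^sup>2 * ((s1 * a1) * (s2 * a2))"
    unfolding assms(1-3) by algebra
  also have "\<dots> = - 2 * d3 * x\<^sup>2 * s1 * s2 - 2 * m\<^sup>2 * s3\<^sup>2 + m * k * s3 * (2 * s3 * (c1 * s1 + c2 * s2 + c3 * s3) - s1 * s2)
      + 2 * k\<^sup>2 * s1 * s2 * s3\<^sup>2 * (c3 - 2 * c1 * c2)"
    unfolding a assms(7) by algebra
  also have "\<dots> = - 2 * d3 * x\<^sup>2 * s1 * s2 - 2 * m\<^sup>2 * s3\<^sup>2 - k * m * (s1 * s2 * s3) - 2 * k\<^sup>2 * d3 * s1 * s2 * s3\<^sup>2"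
    using assms(8,9) by algebra
  finally show ?thesis .
qed

text \<open>Here \<open>M\<close> is the derivative of \<open>m = s2 * a2 + 2 * k * c2 * s2\<close>, and \<open>e2\<close> is the sine of the second angle.\<close>
lemma m_derivative_elimination:
  fixes s1 s2 s3 c1 c2 d2 d3 e2 a1 a2 m M k G G' x c123 :: real
  assumes "x = s3 * G" "x = s2 * G'"
    "M = - (x * d2 * a2) + s2 * Da2 + 2 * k * (- (e2 * x) * s2 + c2 * (- (x * d2)))"
    "Da2 = - d3 * G * a2 - c123 * G' + a1 * G"
    "m = s1 * a1 + 2 * k * c1 * s1" "m = s2 * a2 + 2 * k * c2 * s2"
    "c123 * (s1 * s2) = - m * s3 - k * (s1 * s2)"
    "s2 * d3 + d2 * s3 = - s1" "c1 + s3 * e2 = c2 * d3"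
  shows "M * (s1 * s2 * s3) = x * (k * (s1 * s2 * s3) + m * (s1\<^sup>2 + s2\<^sup>2 + s3\<^sup>2))"
proof -
  have a: "s1 * a1 = m - 2 * k * c1 * s1" "s2 * a2 = m - 2 * k * c2 * s2"
    using assms(5,6) by simp_all
  have "M * (s1 * s2 * s3) = x * (- (s2 * a2) * s1 * (d2 * s3 + s2 * d3) - s3 * (c123 * (s1 * s2)) + s2\<^sup>2 * (s1 * a1)
      - 2 * k * (s1 * s2 * s3) * (e2 * s2 + c2 * d2))"
    unfolding assms(3,4) using assms(1,2) by algebra
  also have "\<dots> = x * (k * (s1 * s2 * s3) + m * (s1\<^sup>2 + s2\<^sup>2 + s3\<^sup>2))"
    unfolding a assms(7) using assms(8,9) by algebra
  finally show ?thesis .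
qed

text \<open>The two formulas for \<open>X\<close> differ by \<open>2 * s1 * S\<close> times the claimed equation.\<close>
lemma first_constraint:
  fixes s1 s2 s3 d1 d2 d3 S m k x X :: real
  assumes "X * (s1 * s2 * s3) = - 2 * d3 * x\<^sup>2 * s1 * s2 - 2 * m\<^sup>2 * s3\<^sup>2 - k * m * (s1 * s2 * s3)
    - 2 * k\<^sup>2 * d3 * s1 * s2 * s3\<^sup>2"
   "X * (s1 * s3 * s2) = - 2 * d2 * x\<^sup>2 * s1 * s3 - 2 * m\<^sup>2 * s2\<^sup>2 - k * m * (s1 * s3 * s2)
    - 2 * k\<^sup>2 * d2 * s1 * s3 * s2\<^sup>2"
   "d3 * s2 - d2 * s3 = - S" "s3\<^sup>2 - s2\<^sup>2 = - s1 * S" "d3 * s3 - d2 * s2 = d1 * S"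
   "S \<noteq> 0" "s1 \<noteq> 0"
  shows "x\<^sup>2 + m\<^sup>2 = k\<^sup>2 * s2 * s3 * d1"
proof -
  have "s1 * S * (x\<^sup>2 + m\<^sup>2 - k\<^sup>2 * s2 * s3 * d1) = 0"
    using assms(1-5) by algebra
  then show ?thesis using assms(6,7) by simp
qed

text \<open>If \<open>x \<noteq> 0\<close>, the differentiated constraint reduces to \<open>d2 * d3 = - s2 * s3\<close>. Then \<open>d1 = - 2 * s2 * s3\<close>, and the
  right-hand side of the constraint becomes negative.\<close>
lemma derivative_of_constraint:
  fixes s1 s2 s3 d1 d2 d3 m M k x X :: real
  assumes X: "X * (s1 * s2 * s3) = - 2 * d3 * x\<^sup>2 * s1 * s2 - 2 * m\<^sup>2 * s3\<^sup>2 - k * m * (s1 * s2 * s3)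
    - 2 * k\<^sup>2 * d3 * s1 * s2 * s3\<^sup>2"
    and M: "M * (s1 * s2 * s3) = x * (k * (s1 * s2 * s3) + m * (s1\<^sup>2 + s2\<^sup>2 + s3\<^sup>2))"
    and D: "2 * x * X + 2 * m * M = k\<^sup>2 * (x * s1 * (d1 - 2 * s2 * s3))"
    and C: "x\<^sup>2 + m\<^sup>2 = k\<^sup>2 * s2 * s3 * d1"
    and t: "s1\<^sup>2 + s2\<^sup>2 - s3\<^sup>2 = - 2 * s1 * s2 * d3" "s2 * d1 + s3 = - s1 * d2" "d1 = d2 * d3 - s2 * s3"
    and nz: "s1 \<noteq> 0" "s2 \<noteq> 0" "s3 \<noteq> 0" "k \<noteq> 0"
  shows "x = 0"
proof (rule ccontr)
  assume x: "x \<noteq> 0"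
  have "(2 * x * X + 2 * m * M) * (s1 * s2 * s3) = 2 * x * (X * (s1 * s2 * s3)) + 2 * m * (M * (s1 * s2 * s3))"
    by algebra
  also have "\<dots> = - 4 * x * d3 * s1 * s2 * (x\<^sup>2 + m\<^sup>2 + k\<^sup>2 * s3\<^sup>2)"
    unfolding X M using t(1) by algebra
  also have "\<dots> = - 4 * x * d3 * s1 * s2 * k\<^sup>2 * s3 * (s2 * d1 + s3)"
    unfolding C by algebra
  also have "\<dots> = 4 * x * k\<^sup>2 * s1\<^sup>2 * s2 * s3 * d2 * d3"
    unfolding t(2) by algebra
  finally have "x * k\<^sup>2 * s1\<^sup>2 * s2 * s3 * (4 * d2 * d3 - (d1 - 2 * s2 * s3)) = 0"
    unfolding D by algebra
  then have "4 * d2 * d3 = d1 - 2 * s2 * s3" using x nz by simp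
  then have "d1 = - 2 * s2 * s3" using t(3) by linarith
  then have "x\<^sup>2 + m\<^sup>2 + 2 * (k * s2 * s3)\<^sup>2 = 0" using C by algebra
  moreover have "x\<^sup>2 > 0" "m\<^sup>2 \<ge> 0" "(k * s2 * s3)\<^sup>2 \<ge> 0" using x by simp_all
  ultimately show False by linarith
qed

lemma second_constraint:
  fixes s1 s2 s3 d1 d3 m k :: real
  assumes X: "0 = - 2 * m\<^sup>2 * s3\<^sup>2 - k * m * (s1 * s2 * s3) - 2 * k\<^sup>2 * d3 * s1 * s2 * s3\<^sup>2"
    and C: "m\<^sup>2 = k\<^sup>2 * s2 * s3 * d1" and t: "s3 * d1 + d3 * s1 = - s2"
    and nz: "s1 \<noteq> 0" "s2 \<noteq> 0" "s3 \<noteq> 0" "k \<noteq> 0"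
  shows "m * s1 = 2 * k * s2 * s3" "d1 * s1\<^sup>2 = 4 * s2 * s3"
proof -
  have "k * s2 * s3 * (m * s1 + 2 * k * s3 * (s3 * d1 + d3 * s1)) = 0" using X C by algebra
  then show m: "m * s1 = 2 * k * s2 * s3" using nz unfolding t by simp
  have "k\<^sup>2 * s2 * s3 * (d1 * s1\<^sup>2 - 4 * s2 * s3) = 0" using m C by algebra
  then show "d1 * s1\<^sup>2 = 4 * s2 * s3" using nz by simp
qed

lemma constraints_contradict:
  fixes s1 s2 s3 d1 m k :: real
  assumes "0 = - 2 * m\<^sup>2 * s1\<^sup>2 - k * m * (s2 * s3 * s1) - 2 * k\<^sup>2 * d1 * s2 * s3 * s1\<^sup>2"
    "m\<^sup>2 = k\<^sup>2 * s2 * s3 * d1" "m * s1 = 2 * k * s2 * s3" "d1 * s1\<^sup>2 = 4 * s2 * s3"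
    and nz: "s2 \<noteq> 0" "s3 \<noteq> 0" "k \<noteq> 0"
  shows False
proof -
  have "k\<^sup>2 * (s2 * s3)\<^sup>2 = 0" using assms(1-4) by algebra
  then show False using nz by simp
qed

text \<open>With angle sum zero, \<open>3 * t\<close> is the difference of the angle differences \<open>t - \<phi>\<close> and \<open>\<psi> - t\<close>. This is where the
  exceptional multiples of \<open>pi / 3\<close> come from.\<close>
lemma angle_difference_trig:
  fixes t \<phi> \<psi> :: real
  assumes "t + \<phi> + \<psi> = 0"
  shows "cos (t - \<phi>) * sin (\<psi> - t) - cos (\<psi> - t) * sin (t - \<phi>) = - sin (3 * t)"
    and "(sin (t - \<phi>))\<^sup>2 - (sin (\<psi> - t))\<^sup>2 = - sin (\<phi> - \<psi>) * sin (3 * t)"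
    and "cos (t - \<phi>) * sin (t - \<phi>) - cos (\<psi> - t) * sin (\<psi> - t) = cos (\<phi> - \<psi>) * sin (3 * t)"
proof -
  have 3: "3 * t = (t - \<phi>) - (\<psi> - t)" using assms by simp
  have e: "\<phi> - \<psi> = - ((t - \<phi>) + (\<psi> - t))" by simp
  define a where "a = t - \<phi>" define b where "b = \<psi> - t"
  have p: "(sin a)\<^sup>2 + (cos a)\<^sup>2 = 1" "(sin b)\<^sup>2 + (cos b)\<^sup>2 = 1" by simp_all
  show "cos (t - \<phi>) * sin (\<psi> - t) - cos (\<psi> - t) * sin (t - \<phi>) = - sin (3 * t)"
    unfolding 3 sin_diff[of "t - \<phi>"] by algebra
  show "(sin (t - \<phi>))\<^sup>2 - (sin (\<psi> - t))\<^sup>2 = - sin (\<phi> - \<psi>) * sin (3 * t)"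
    unfolding 3 e a_def[symmetric] b_def[symmetric] sin_minus sin_diff sin_add using p by algebra
  show "cos (t - \<phi>) * sin (t - \<phi>) - cos (\<psi> - t) * sin (\<psi> - t) = cos (\<phi> - \<psi>) * sin (3 * t)"
    unfolding 3 e a_def[symmetric] b_def[symmetric] cos_minus sin_diff cos_add using p by algebra
qed

section \<open>One constant angle\<close>

locale constant_angle_frame = normalized_frame +
  fixes t :: real
  assumes first_angle: "\<And>y. y \<in> V \<Longrightarrow> \<theta> 1 y = t"
    and t_generic: "sin (3 * t) \<noteq> 0"
begin

abbreviation x :: "3 \<Rightarrow> real ^ 3 \<Rightarrow> real" where "x i y \<equiv> D i (\<theta> 2) y"

lemma D_cong: "y \<in> V \<Longrightarrow> (\<And>y. y \<in> V \<Longrightarrow> f y = g y) \<Longrightarrow> D i f y = D i g y"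
  by (rule fun_cong[OF deriv_at_cong[OF open_V]])

lemma D_eq_0: "y \<in> V \<Longrightarrow> (\<And>y. y \<in> V \<Longrightarrow> f y = 0) \<Longrightarrow> D i f y = 0"
  by (rule deriv_at_zero_of_constant_on[OF open_V])

lemma differentiable_trig:
  assumes "y \<in> V"
  shows "s i j differentiable (at y)" "d i j differentiable (at y)"
    "(\<lambda>y. cos (\<theta> i y)) differentiable (at y)"
proof -
  have "smooth_on V (\<lambda>y. \<theta> i y - \<theta> j y)"
    using smooth_on_add[OF open_V smooth_\<theta>[of i] smooth_on_linear_image[OF bounded_linear_minus[OF bounded_linear_ident] open_V smooth_\<theta>[of j]]]
    by simp
  then show "s i j differentiable (at y)" "d i j differentiable (at y)"
    by (rule differentiable_V[OF smooth_on_sin[OF open_V] assms] differentiable_V[OF smooth_on_cos[OF open_V] assms])+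
  show "(\<lambda>y. cos (\<theta> i y)) differentiable (at y)"
    by (rule differentiable_V[OF smooth_on_cos[OF open_V smooth_\<theta>] assms])
qed

lemma D_first_angle: "y \<in> V \<Longrightarrow> D i (\<theta> 1) y = 0"
  using deriv_at_zero_of_constant_on[OF open_V _ first_angle] .

lemma D_third_angle: assumes y: "y \<in> V" shows "D i (\<theta> 3) y = - x i y"
proof -
  have "D i (\<theta> 3) y = D i (\<lambda>y. - t + (-1) * \<theta> 2 y) y"
    by (rule D_cong[OF y]) (use angle_sum_zero first_angle in force)
  also have "\<dots> = - x i y"
    by (rule fun_cong[OF frechet_derivative_at[symmetric]])
      (use smooth_on_has_derivative[OF smooth_\<theta> y] in \<open>auto intro!: derivative_eq_intros\<close>)
  finally show ?thesis .
qed

lemma D_s: assumes y: "y \<in> V" shows "D k (s i j) y = d i j y * (D k (\<theta> i) y - D k (\<theta> j) y)"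
  by (rule fun_cong[OF frechet_derivative_at[symmetric]])
    (use smooth_on_has_derivative[OF smooth_\<theta> y] in \<open>auto intro!: derivative_eq_intros\<close>)

lemma D_d: assumes y: "y \<in> V" shows "D k (d i j) y = - s i j y * (D k (\<theta> i) y - D k (\<theta> j) y)"
  by (rule fun_cong[OF frechet_derivative_at[symmetric]])
    (use smooth_on_has_derivative[OF smooth_\<theta> y] in \<open>auto intro!: derivative_eq_intros\<close>)

lemmas D_angles = D_first_angle D_third_angle D_s D_d

lemma s_minus: "s i j y = - s j i y" and d_minus: "d i j y = d j i y"
  using sin_minus[of "\<theta> j y - \<theta> i y"] cos_minus[of "\<theta> j y - \<theta> i y"] by simp_all

lemma \<Gamma>_diagonal: "y \<in> V \<Longrightarrow> \<Gamma> i j j y = 0"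
  using \<Gamma>_skew[of y i j j] by simp

lemma trig_relations:
  "s 3 1 y * d 1 2 y + d 3 1 y * s 1 2 y = - s 2 3 y"
  "s 1 2 y * d 2 3 y + d 1 2 y * s 2 3 y = - s 3 1 y"
  "s 3 1 y * d 2 3 y + s 1 2 y = - s 2 3 y * d 3 1 y"
  "d 2 3 y = d 3 1 y * d 1 2 y - s 3 1 y * s 1 2 y"
  "(s 2 3 y)\<^sup>2 + (s 3 1 y)\<^sup>2 - (s 1 2 y)\<^sup>2 = - 2 * s 2 3 y * s 3 1 y * d 1 2 y"
  "cos (\<theta> 1 y) + s 1 2 y * sin (\<theta> 2 y) = cos (\<theta> 2 y) * d 1 2 y"
proof -
  define \<alpha> where "\<alpha> = \<theta> 2 y - \<theta> 3 y" define \<beta> where "\<beta> = \<theta> 3 y - \<theta> 1 y" define \<gamma> where "\<gamma> = \<theta> 1 y - \<theta> 2 y"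
  have z: "\<alpha> + \<beta> + \<gamma> = 0" "\<beta> + \<gamma> + \<alpha> = 0" "\<gamma> + \<alpha> + \<beta> = 0"
    by (simp_all add: \<alpha>_def \<beta>_def \<gamma>_def)
  note f = \<alpha>_def[symmetric] \<beta>_def[symmetric] \<gamma>_def[symmetric]
  note t = sum_zero_sin_cos[OF z(1)]
  show "s 3 1 y * d 1 2 y + d 3 1 y * s 1 2 y = - s 2 3 y" unfolding f by (rule sin_cyclic[OF z(2)])
  show "s 1 2 y * d 2 3 y + d 1 2 y * s 2 3 y = - s 3 1 y" unfolding f by (rule sin_cyclic[OF z(3)])
  show "s 3 1 y * d 2 3 y + s 1 2 y = - s 2 3 y * d 3 1 y" unfolding f using t(1) by simp
  show "d 2 3 y = d 3 1 y * d 1 2 y - s 3 1 y * s 1 2 y" unfolding f by (rule sum_zero_sin_cos(2)[OF z(2)])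
  show "(s 2 3 y)\<^sup>2 + (s 3 1 y)\<^sup>2 - (s 1 2 y)\<^sup>2 = - 2 * s 2 3 y * s 3 1 y * d 1 2 y" unfolding f using t by algebra
  have "cos (\<theta> 1 y) = cos (\<theta> 2 y + \<gamma>)" by (simp add: \<gamma>_def)
  then show "cos (\<theta> 1 y) + s 1 2 y * sin (\<theta> 2 y) = cos (\<theta> 2 y) * d 1 2 y"
    unfolding f by (simp add: cos_add)
qed

lemma angle_difference_relations:
  assumes y: "y \<in> V"
  shows "d 1 2 y * s 3 1 y - d 3 1 y * s 1 2 y = - sin (3 * t)"
    "(s 1 2 y)\<^sup>2 - (s 3 1 y)\<^sup>2 = - s 2 3 y * sin (3 * t)"
    "d 1 2 y * s 1 2 y - d 3 1 y * s 3 1 y = d 2 3 y * sin (3 * t)"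
proof -
  have z: "t + \<theta> 2 y + \<theta> 3 y = 0" using angle_sum_zero[OF y] first_angle[OF y] by simp
  show "d 1 2 y * s 3 1 y - d 3 1 y * s 1 2 y = - sin (3 * t)"
    "(s 1 2 y)\<^sup>2 - (s 3 1 y)\<^sup>2 = - s 2 3 y * sin (3 * t)"
    "d 1 2 y * s 1 2 y - d 3 1 y * s 3 1 y = d 2 3 y * sin (3 * t)"
    using angle_difference_trig[OF z] by (simp_all add: first_angle[OF y])
qed

lemma D_s_values:
  assumes y: "y \<in> V"
  shows "D i (s 3 1) y = - x i y * d 3 1 y" "D i (s 1 2) y = - x i y * d 1 2 y"
    "D i (s 2 3) y = 2 * x i y * d 2 3 y" "D i (d 2 3) y = - 2 * x i y * s 2 3 y"
  by (simp_all add: D_angles[OF y])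

end

text \<open>The assumption is contradictory on a nonempty set. It is made on a whole open set because the equations below are
  differentiated.\<close>
locale generic_frame = constant_angle_frame +
  assumes s_nonzero: "\<And>y. y \<in> V \<Longrightarrow> s 2 3 y \<noteq> 0" "\<And>y. y \<in> V \<Longrightarrow> s 3 1 y \<noteq> 0" "\<And>y. y \<in> V \<Longrightarrow> s 1 2 y \<noteq> 0"
begin

text \<open>Constancy of the first angle makes its derivatives vanish, and the factors in front of the \<open>\<Gamma>\<close> are nonzero.\<close>
lemma \<Gamma>_first: assumes y: "y \<in> V" shows "\<Gamma> 1 2 1 y = 0" "\<Gamma> 1 3 1 y = 0" "\<Gamma> 1 1 2 y = 0" "\<Gamma> 1 1 3 y = 0"
proof -
  show 1: "\<Gamma> 1 2 1 y = 0" "\<Gamma> 1 3 1 y = 0"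
    using D_angle[OF y, of 2 1] D_angle[OF y, of 3 1] D_first_angle[OF y] s_nonzero[OF y] s_minus[of 2 y 1] by auto
  show "\<Gamma> 1 1 2 y = 0" "\<Gamma> 1 1 3 y = 0" using 1 \<Gamma>_skew[OF y] by (metis add.inverse_neutral)+
qed

lemma x1_eq: assumes y: "y \<in> V" shows "x 1 y = s 1 2 y * \<Gamma> 2 1 2 y" "x 1 y = s 3 1 y * \<Gamma> 3 1 3 y"
  using D_angle[OF y, of 1 2] D_angle[OF y, of 1 3] D_third_angle[OF y, of 1] s_minus[of 1 y 3] by auto

lemma c_repeated_values:
  assumes y: "y \<in> V"
  shows "c 1 2 1 y = 0" "c 1 2 2 y = - d 1 2 y * \<Gamma> 2 1 2 y"
    "c 3 1 1 y = 0" "c 3 1 3 y = d 3 1 y * \<Gamma> 3 1 3 y"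
  using c_repeated[OF y, of 1 2] c_repeated[OF y, of 3 1] \<Gamma>_first[OF y] d_minus[of 1 y 3] by simp_all

lemma flatness_values:
  assumes y: "y \<in> V"
  shows "D 1 (\<Gamma> 2 1 2) y = - d 1 2 y * (\<Gamma> 2 1 2 y)\<^sup>2 + c 1 2 3 y * \<Gamma> 3 1 2 y - \<Gamma> 1 2 3 y * \<Gamma> 2 3 1 y"
    and "D 1 (\<Gamma> 3 1 3) y = - d 3 1 y * (\<Gamma> 3 1 3 y)\<^sup>2 + c 3 1 2 y * \<Gamma> 2 3 1 y - \<Gamma> 1 2 3 y * \<Gamma> 3 1 2 y"
    and "D 1 (\<Gamma> 2 3 1) y = - d 1 2 y * \<Gamma> 2 1 2 y * \<Gamma> 2 3 1 y - c 1 2 3 y * \<Gamma> 3 1 3 y + \<Gamma> 1 2 3 y * \<Gamma> 2 1 2 y"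
proof -
  have z: "D i (\<Gamma> 1 1 2) y = 0" "D i (\<Gamma> 1 1 3) y = 0" "D i (\<Gamma> 1 3 1) y = 0" for i
    by (rule D_eq_0[OF y], rule \<Gamma>_first, assumption)+
  note A = \<Gamma>_skew[OF y]
  note v = sum_3 z c_repeated_values[OF y] \<Gamma>_first[OF y] \<Gamma>_diagonal[OF y] power2_eq_square
  show "D 1 (\<Gamma> 2 1 2) y = - d 1 2 y * (\<Gamma> 2 1 2 y)\<^sup>2 + c 1 2 3 y * \<Gamma> 3 1 2 y - \<Gamma> 1 2 3 y * \<Gamma> 2 3 1 y"
    using flatness[OF y, where i = 1 and j = 2 and k = 1 and l = 2] A[of 2 1 3] A[of 1 3 2] by (simp add: v algebra_simps)
  show "D 1 (\<Gamma> 3 1 3) y = - d 3 1 y * (\<Gamma> 3 1 3 y)\<^sup>2 + c 3 1 2 y * \<Gamma> 2 3 1 y - \<Gamma> 1 2 3 y * \<Gamma> 3 1 2 y"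
    using flatness[OF y, where i = 3 and j = 1 and k = 1 and l = 3] A[of 2 1 3] A[of 1 3 2] by (simp add: v algebra_simps)
  show "D 1 (\<Gamma> 2 3 1) y = - d 1 2 y * \<Gamma> 2 1 2 y * \<Gamma> 2 3 1 y - c 1 2 3 y * \<Gamma> 3 1 3 y + \<Gamma> 1 2 3 y * \<Gamma> 2 1 2 y"
    using flatness[OF y, where i = 1 and j = 2 and k = 3 and l = 1] A[of 3 3 1] A[of 1 3 2] by (simp add: v algebra_simps)
qed

lemma cosine_sine_sum: "cos (\<theta> 1 y) * s 2 3 y + cos (\<theta> 2 y) * s 3 1 y + cos (\<theta> 3 y) * s 1 2 y = 0"
  unfolding sin_diff by algebra

lemma cosine_product:
  assumes y: "y \<in> V"
  shows "cos (\<theta> 3 y) = 2 * cos (\<theta> 1 y) * cos (\<theta> 2 y) - d 1 2 y"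
    "cos (\<theta> 2 y) = 2 * cos (\<theta> 1 y) * cos (\<theta> 3 y) - d 3 1 y"
    "cos (\<theta> 1 y) = 2 * cos (\<theta> 2 y) * cos (\<theta> 3 y) - d 2 3 y"
proof -
  have *: "cos \<gamma> = 2 * cos \<alpha> * cos \<beta> - cos (\<alpha> - \<beta>)" if "\<alpha> + \<beta> + \<gamma> = 0" for \<alpha> \<beta> \<gamma> :: real
    using sum_zero_sin_cos[OF that] unfolding cos_diff by algebra
  note z = angle_sum_zero[OF y]
  have z': "\<theta> 1 y + \<theta> 3 y + \<theta> 2 y = 0" "\<theta> 2 y + \<theta> 3 y + \<theta> 1 y = 0" using z by simp_all
  show "cos (\<theta> 3 y) = 2 * cos (\<theta> 1 y) * cos (\<theta> 2 y) - d 1 2 y" by (rule *[OF z])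
  show "cos (\<theta> 2 y) = 2 * cos (\<theta> 1 y) * cos (\<theta> 3 y) - d 3 1 y"
    unfolding d_minus[of 3 y 1] by (rule *[OF z'(1)])
  show "cos (\<theta> 1 y) = 2 * cos (\<theta> 2 y) * cos (\<theta> 3 y) - d 2 3 y" by (rule *[OF z'(2)])
qed

lemma x1_derivative:
  assumes y: "y \<in> V"
  shows "D 1 (x 1) y = - (x 1 y * d 1 2 y * \<Gamma> 2 1 2 y) + s 1 2 y * D 1 (\<Gamma> 2 1 2) y"
    "D 1 (x 1) y = - (x 1 y * d 3 1 y * \<Gamma> 3 1 3 y) + s 3 1 y * D 1 (\<Gamma> 3 1 3) y"
proof -
  note pr = deriv_at_bilinear[OF bounded_bilinear_mult differentiable_trig(1)[OF y] differentiable_V[OF smooth_\<Gamma> y]]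
  have "D 1 (x 1) y = D 1 (\<lambda>y. s 1 2 y * \<Gamma> 2 1 2 y) y" by (rule D_cong[OF y x1_eq(1)])
  then show "D 1 (x 1) y = - (x 1 y * d 1 2 y * \<Gamma> 2 1 2 y) + s 1 2 y * D 1 (\<Gamma> 2 1 2) y"
    by (simp add: pr D_angles[OF y])
  have "D 1 (x 1) y = D 1 (\<lambda>y. s 3 1 y * \<Gamma> 3 1 3 y) y" by (rule D_cong[OF y x1_eq(2)])
  then show "D 1 (x 1) y = - (x 1 y * d 3 1 y * \<Gamma> 3 1 3 y) + s 3 1 y * D 1 (\<Gamma> 3 1 3) y"
    by (simp add: pr D_angles[OF y])
qed

text \<open>The derivative \<open>x 1\<close> of \<open>\<theta>\<^sub>2 = - t - \<theta>\<^sub>3\<close> is a multiple of both \<open>\<Gamma> 2 1 2\<close> and \<open>\<Gamma> 3 1 3\<close>, and each of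
  them satisfies a flatness equation.\<close>
lemma x1_second_derivative:
  assumes y: "y \<in> V"
  shows "D 1 (x 1) y * (s 2 3 y * s 3 1 y * s 1 2 y) = - 2 * d 1 2 y * (x 1 y)\<^sup>2 * s 2 3 y * s 3 1 y
    - 2 * (m y)\<^sup>2 * (s 1 2 y)\<^sup>2 - \<kappa> * m y * (s 2 3 y * s 3 1 y * s 1 2 y)
    - 2 * \<kappa>\<^sup>2 * d 1 2 y * s 2 3 y * s 3 1 y * (s 1 2 y)\<^sup>2"
    "D 1 (x 1) y * (s 2 3 y * s 1 2 y * s 3 1 y) = - 2 * d 3 1 y * (x 1 y)\<^sup>2 * s 2 3 y * s 1 2 y
    - 2 * (m y)\<^sup>2 * (s 3 1 y)\<^sup>2 - \<kappa> * m y * (s 2 3 y * s 1 2 y * s 3 1 y)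
    - 2 * \<kappa>\<^sup>2 * d 3 1 y * s 2 3 y * s 1 2 y * (s 3 1 y)\<^sup>2"
proof -
  note c = c_distinct[OF y] and cs = cosine_sine_sum[of y] and cp = cosine_product[OF y]
  show "D 1 (x 1) y * (s 2 3 y * s 3 1 y * s 1 2 y) = - 2 * d 1 2 y * (x 1 y)\<^sup>2 * s 2 3 y * s 3 1 y
    - 2 * (m y)\<^sup>2 * (s 1 2 y)\<^sup>2 - \<kappa> * m y * (s 2 3 y * s 3 1 y * s 1 2 y)
    - 2 * \<kappa>\<^sup>2 * d 1 2 y * s 2 3 y * s 3 1 y * (s 1 2 y)\<^sup>2"
    by (rule second_derivative_elimination[OF x1_eq(1)[OF y] x1_derivative(1)[OF y] flatness_values(1)[OF y]
      m_def m_cyclic[OF y] c(1) cs cp(1)])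
  have c': "c 3 1 2 y * (s 2 3 y * s 1 2 y) = - m y * s 3 1 y - \<kappa> * (s 2 3 y * s 1 2 y)"
    using c(3) by (simp add: mult.commute)
  have cs': "cos (\<theta> 1 y) * s 2 3 y + cos (\<theta> 3 y) * s 1 2 y + cos (\<theta> 2 y) * s 3 1 y = 0" using cs by simp
  show "D 1 (x 1) y * (s 2 3 y * s 1 2 y * s 3 1 y) = - 2 * d 3 1 y * (x 1 y)\<^sup>2 * s 2 3 y * s 1 2 y
    - 2 * (m y)\<^sup>2 * (s 3 1 y)\<^sup>2 - \<kappa> * m y * (s 2 3 y * s 1 2 y * s 3 1 y)
    - 2 * \<kappa>\<^sup>2 * d 3 1 y * s 2 3 y * s 1 2 y * (s 3 1 y)\<^sup>2"
    by (rule second_derivative_elimination[OF x1_eq(2)[OF y] x1_derivative(2)[OF y] flatness_values(2)[OF y]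
      m_def m_cyclic(2)[OF y] m_cyclic(1)[OF y] c' cs' cp(2)])
qed

lemma constraint:
  assumes y: "y \<in> V"
  shows "(x 1 y)\<^sup>2 + (m y)\<^sup>2 = \<kappa>\<^sup>2 * s 3 1 y * s 1 2 y * d 2 3 y"
  by (rule first_constraint[OF x1_second_derivative[OF y] angle_difference_relations[OF y] t_generic s_nonzero(1)[OF y]])

lemma differentiable_m: assumes y: "y \<in> V" shows "m differentiable (at y)"
proof -
  note dt = differentiable_trig[OF y]
  have "(\<lambda>y. s 2 3 y * \<Gamma> 1 2 3 y + 2 * \<kappa> * cos (\<theta> 1 y) * s 2 3 y) differentiable (at y)"
    by (intro differentiable_add differentiable_mult differentiable_const dt differentiable_V[OF smooth_\<Gamma> y])
  then show ?thesis by (simp add: m_def[abs_def])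
qed

end

context generic_frame
begin

lemma m_derivative:
  assumes y: "y \<in> V"
  shows "D 1 m y * (s 2 3 y * s 3 1 y * s 1 2 y)
    = x 1 y * (\<kappa> * (s 2 3 y * s 3 1 y * s 1 2 y) + m y * ((s 2 3 y)\<^sup>2 + (s 3 1 y)\<^sup>2 + (s 1 2 y)\<^sup>2))"
proof (rule m_derivative_elimination[OF x1_eq[OF y] _ flatness_values(3)[OF y] m_def m_cyclic(1)[OF y]
      c_distinct(1)[OF y] trig_relations(1) trig_relations(6)])
  note ds = differentiable_trig[OF y] and dG = differentiable_V[OF smooth_\<Gamma> y]
  have "D 1 m y = D 1 (\<lambda>y. s 3 1 y * \<Gamma> 2 3 1 y + (2 * \<kappa>) * (cos (\<theta> 2 y) * s 3 1 y)) y"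
    by (rule D_cong[OF y]) (simp add: m_cyclic(1) algebra_simps)
  also have "\<dots> = - (x 1 y * d 3 1 y * \<Gamma> 2 3 1 y) + s 3 1 y * D 1 (\<Gamma> 2 3 1) y
     + 2 * \<kappa> * (- (sin (\<theta> 2 y) * x 1 y) * s 3 1 y + cos (\<theta> 2 y) * - (x 1 y * d 3 1 y))"
    by (simp add: deriv_at_add deriv_at_mult ds dG D_s_values[OF y] deriv_at_const
        deriv_at_cos[OF differentiable_V[OF smooth_\<theta> y]] differentiable_mult)
  finally show "D 1 m y = - (x 1 y * d 3 1 y * \<Gamma> 2 3 1 y) + s 3 1 y * D 1 (\<Gamma> 2 3 1) y
     + 2 * \<kappa> * (- (sin (\<theta> 2 y) * x 1 y) * s 3 1 y + cos (\<theta> 2 y) * - (x 1 y * d 3 1 y))" .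
qed

lemma constraint_derivative:
  assumes y: "y \<in> V"
  shows "2 * x 1 y * D 1 (x 1) y + 2 * m y * D 1 m y = \<kappa>\<^sup>2 * (x 1 y * s 2 3 y * (d 2 3 y - 2 * s 3 1 y * s 1 2 y))"
proof -
  note ds = differentiable_trig[OF y]
  note dx = differentiable_V[OF smooth_D[OF smooth_\<theta>] y] and dm = differentiable_m[OF y]
  have "D 1 (\<lambda>y. x 1 y * x 1 y + m y * m y) y = D 1 (\<lambda>y. \<kappa>\<^sup>2 * (s 3 1 y * (s 1 2 y * d 2 3 y))) y"
    by (rule D_cong[OF y]) (use constraint in \<open>simp add: power2_eq_square mult.assoc\<close>)
  moreover have "D 1 (\<lambda>y. x 1 y * x 1 y + m y * m y) y = 2 * x 1 y * D 1 (x 1) y + 2 * m y * D 1 m y"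
    by (simp add: deriv_at_add deriv_at_mult dx dm differentiable_mult)
  moreover have "D 1 (\<lambda>y. \<kappa>\<^sup>2 * (s 3 1 y * (s 1 2 y * d 2 3 y))) y =
     \<kappa>\<^sup>2 * (x 1 y * (- (s 3 1 y * d 1 2 y + d 3 1 y * s 1 2 y) * d 2 3 y - 2 * s 3 1 y * s 1 2 y * s 2 3 y))"
    by (simp add: deriv_at_mult ds differentiable_mult D_s_values[OF y] deriv_at_const algebra_simps)
  ultimately show ?thesis unfolding trig_relations(1) by (simp add: algebra_simps)
qed

lemma x1_zero: assumes y: "y \<in> V" shows "x 1 y = 0"
  by (rule derivative_of_constraint[OF x1_second_derivative(1)[OF y] m_derivative[OF y] constraint_derivative[OF y]
      constraint[OF y] trig_relations(5) trig_relations(3) trig_relations(4) s_nonzero[OF y] \<kappa>_nonzero[OF y]])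

lemma \<Gamma>_vanish_along_E1: assumes y: "y \<in> V" shows "\<Gamma> 2 1 2 y = 0" "\<Gamma> 3 1 3 y = 0"
  using x1_eq[OF y] x1_zero[OF y] s_nonzero[OF y] by auto

lemma reduced_constraints:
  assumes y: "y \<in> V"
  shows "(m y)\<^sup>2 = \<kappa>\<^sup>2 * s 3 1 y * s 1 2 y * d 2 3 y" "m y * s 2 3 y = 2 * \<kappa> * s 3 1 y * s 1 2 y"
    "d 2 3 y * (s 2 3 y)\<^sup>2 = 4 * s 3 1 y * s 1 2 y"
proof -
  show 1: "(m y)\<^sup>2 = \<kappa>\<^sup>2 * s 3 1 y * s 1 2 y * d 2 3 y" using constraint[OF y] x1_zero[OF y] by simp
  have "D 1 (x 1) y = 0" by (rule D_eq_0[OF y x1_zero])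
  then have "0 = - 2 * (m y)\<^sup>2 * (s 1 2 y)\<^sup>2 - \<kappa> * m y * (s 2 3 y * s 3 1 y * s 1 2 y)
    - 2 * \<kappa>\<^sup>2 * d 1 2 y * s 2 3 y * s 3 1 y * (s 1 2 y)\<^sup>2"
    using x1_second_derivative(1)[OF y] x1_zero[OF y] by simp
  from second_constraint[OF this 1 trig_relations(2) s_nonzero[OF y] \<kappa>_nonzero[OF y]]
  show "m y * s 2 3 y = 2 * \<kappa> * s 3 1 y * s 1 2 y" "d 2 3 y * (s 2 3 y)\<^sup>2 = 4 * s 3 1 y * s 1 2 y" .
qed

text \<open>Differentiating \<open>d\<^sub>1 s\<^sub>1\<^sup>2 = 4 s\<^sub>2 s\<^sub>3\<close> gives \<open>x\<^sub>i s\<^sub>1\<^sup>3 = 0\<close>.\<close>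
lemma x_zero: assumes y: "y \<in> V" shows "x i y = 0"
proof -
  note ds = differentiable_trig[OF y]
  have "D i (\<lambda>y. d 2 3 y * (s 2 3 y * s 2 3 y)) y = D i (\<lambda>y. 4 * (s 3 1 y * s 1 2 y)) y"
    by (rule D_cong[OF y]) (use reduced_constraints(3) in \<open>simp add: power2_eq_square mult.assoc\<close>)
  then have "x i y * (4 * (d 2 3 y)\<^sup>2 * s 2 3 y - 2 * (s 2 3 y)^3) = - 4 * x i y * (s 3 1 y * d 1 2 y + d 3 1 y * s 1 2 y)"
    by (simp add: deriv_at_mult ds differentiable_mult D_s_values[OF y] deriv_at_const algebra_simps
        power2_eq_square power3_eq_cube)
  moreover have "(d 2 3 y)\<^sup>2 = 1 - (s 2 3 y)\<^sup>2" by (simp add: cos_squared_eq)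
  ultimately have "x i y * (s 2 3 y)^3 = 0" unfolding trig_relations(1) by algebra
  then show ?thesis using s_nonzero[OF y] by simp
qed

text \<open>With all derivatives of the angles zero, the flatness equation for the second and third frame field becomes
  algebraic and contradicts the two reduced constraints.\<close>
lemma contradiction: assumes y: "y \<in> V" shows False
proof -
  have G: "\<Gamma> 3 2 3 y = 0" "\<Gamma> 2 2 3 y = 0" if y: "y \<in> V" for y
    using D_angle[OF y, of 2 3] D_angle[OF y, of 3 2] D_third_angle[OF y, of 2] x_zero[OF y] s_nonzero[OF y] s_minus[of 3 y 2]
      \<Gamma>_skew[OF y, of 2 2 3] by auto
  have z: "D i (\<Gamma> 3 2 3) y = 0" "D i (\<Gamma> 2 2 3) y = 0" for i
    by (rule D_eq_0[OF y], rule G, assumption)+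
  note A = \<Gamma>_skew[OF y]
  have f: "0 = c 2 3 1 y * \<Gamma> 1 2 3 y - \<Gamma> 2 3 1 y * \<Gamma> 3 1 2 y"
    using flatness[OF y, where i = 2 and j = 3 and k = 2 and l = 3] A[of 3 2 1] A[of 2 2 1] \<Gamma>_vanish_along_E1[OF y]
    by (simp add: sum_3 z G[OF y] \<Gamma>_diagonal[OF y] algebra_simps)
  have "0 * (s 3 1 y * s 1 2 y * s 2 3 y) = - 2 * d 2 3 y * 0\<^sup>2 * s 3 1 y * s 1 2 y
    - 2 * (m y)\<^sup>2 * (s 2 3 y)\<^sup>2 - \<kappa> * m y * (s 3 1 y * s 1 2 y * s 2 3 y)
    - 2 * \<kappa>\<^sup>2 * d 2 3 y * s 3 1 y * s 1 2 y * (s 2 3 y)\<^sup>2"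
  proof (rule second_derivative_elimination[OF _ _ _ m_cyclic[OF y] m_def c_distinct(2)[OF y] _ cosine_product(3)[OF y]])
    show "0 = - d 2 3 y * 0\<^sup>2 + c 2 3 1 y * \<Gamma> 1 2 3 y - \<Gamma> 2 3 1 y * \<Gamma> 3 1 2 y" using f by simp
    show "cos (\<theta> 2 y) * s 3 1 y + cos (\<theta> 3 y) * s 1 2 y + cos (\<theta> 1 y) * s 2 3 y = 0"
      using cosine_sine_sum[of y] by simp
  qed simp_all
  then show False
    by (intro constraints_contradict[OF _ reduced_constraints[OF y] s_nonzero(2,3)[OF y] \<kappa>_nonzero[OF y]]) simp
qed

end

section \<open>The Levi-Civita connection in the left trivialization\<close>

text \<open>Functions such as the metric are known in the trivialization only on \<open>S\<^sup>3 \<times> S\<^sup>3\<close>. Both functions are composed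
  with a curve on the product of spheres that has velocity \<open>v\<close>.\<close>
lemma derivative_tangent_to_S3S3:
  fixes f g :: "quat \<times> quat \<Rightarrow> 'b::euclidean_space"
  assumes x: "x \<in> S3S3" and v: "v \<in> TS3S3 x"
    and f: "f differentiable (at x)" and g: "g differentiable (at x)"
    and eq: "\<And>z. z \<in> S3S3 \<Longrightarrow> f z = g z"
  shows "deriv_at f x v = deriv_at g x v"
proof -
  \<comment> \<open>A great circle through \<open>p\<close> with velocity \<open>U\<close>; for \<open>U = 0\<close> division by zero yields the constant curve.\<close>
  define \<gamma> :: "quat \<Rightarrow> quat \<Rightarrow> real \<Rightarrow> quat"
    where "\<gamma> p U s = cos (norm U * s) *\<^sub>R p + sin (norm U * s) *\<^sub>R ((1 / norm U) *\<^sub>R U)" for p U s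
  have \<gamma>0: "\<gamma> p U 0 = p" for p U by (simp add: \<gamma>_def)
  have d\<gamma>: "((\<gamma> p U) has_derivative (\<lambda>s. s *\<^sub>R U)) (at 0)" for p U
    unfolding \<gamma>_def by (cases "U = 0") (auto intro!: derivative_eq_intros)
  have n\<gamma>: "norm (\<gamma> p U s) = 1" if "norm p = 1" "p \<bullet> U = 0" for p U s
  proof (cases "U = 0")
    case False
    define W where "W = (1 / norm U) *\<^sub>R U"
    have "norm W = 1" "p \<bullet> W = 0" using False that by (simp_all add: W_def)
    then have "(norm (cos (norm U * s) *\<^sub>R p + sin (norm U * s) *\<^sub>R W))\<^sup>2 = 1"
      using that(1)
      by (simp add: power2_norm_eq_inner inner_add_left inner_add_right inner_commute norm_eq_1
          power2_eq_square[symmetric])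
    then show ?thesis by (simp add: \<gamma>_def W_def[symmetric] power2_eq_1_iff) (smt (verit) norm_ge_zero)
  qed (simp add: \<gamma>_def that)
  define c where "c s = (\<gamma> (fst x) (fst v) s, \<gamma> (snd x) (snd v) s)" for s
  have c0: "c 0 = x" by (simp add: c_def \<gamma>0)
  have cS: "c s \<in> S3S3" for s
    using n\<gamma> S3S3_norm[OF x] v TS3S3_iff_orthogonal[OF x] by (simp add: c_def S3S3_def)
  have dc: "(c has_derivative (\<lambda>s. s *\<^sub>R v)) (at 0)"
    unfolding c_def using has_derivative_Pair[OF d\<gamma> d\<gamma>, of "fst x" "fst v" "snd x" "snd v"]
    by (simp add: scaleR_prod_def)
  have *: "((\<lambda>s. h (c s)) has_derivative (\<lambda>s. deriv_at h x (s *\<^sub>R v))) (at 0)"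
    if "h differentiable (at x)" for h :: "quat \<times> quat \<Rightarrow> 'b"
    by (rule has_derivative_compose[OF dc]) (use that frechet_derivative_works c0 in auto)
  have "(\<lambda>s. f (c s)) = (\<lambda>s. g (c s))" using eq cS by auto
  then have "(\<lambda>s. deriv_at f x (s *\<^sub>R v)) = (\<lambda>s. deriv_at g x (s *\<^sub>R v))"
    using has_derivative_unique[OF *[OF f]] *[OF g] by simp
  from fun_cong[OF this, of 1] show ?thesis by simp
qed

lemma bounded_linear_qcnj: "bounded_linear qcnj"
  by (auto intro!: linear_conv_bounded_linear[THEN iffD1] linearI simp: qcnj_def)

lemma differentiable_qinv:
  assumes f: "f differentiable (at x)" and nz: "f x \<noteq> 0"
  shows "(\<lambda>y. qinv (f y)) differentiable (at x)"
proof -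
  have "(\<lambda>y. (1 / (f y \<bullet> f y)) *\<^sub>R qcnj (f y)) differentiable (at x)"
    by (intro differentiable_bilinear[OF bounded_bilinear_scaleR] differentiable_divide differentiable_const
        differentiable_bilinear[OF bounded_bilinear_inner] f differentiable_linear_image[OF bounded_linear_qcnj])
      (use nz in simp)
  then show ?thesis by (simp add: qinv_def qcnj_def power2_norm_eq_inner)
qed

lemma differentiable_nk_metric:
  assumes x: "x \<in> S3S3" and Y: "Y differentiable (at x)" and Z: "Z differentiable (at x)"
  shows "(\<lambda>y. nk_metric y (Y y) (Z y)) differentiable (at x)"
proof -
  have l: "fst differentiable (at x)" "snd differentiable (at x)"
    using bounded_linear_fst bounded_linear_snd bounded_linear_imp_differentiable by blast+
  have nz: "fst x \<noteq> 0" "snd x \<noteq> 0" using S3S3_norm[OF x] by auto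
  have J: "(\<lambda>y. \<J> y (A y)) differentiable (at x)" if A: "A differentiable (at x)" for A
  proof -
    note fA = differentiable_linear_image[OF bounded_linear_fst A] differentiable_linear_image[OF bounded_linear_snd A]
    show ?thesis unfolding acs_def split_beta fst_conv snd_conv
      by (intro differentiable_linear_image[OF bounded_linear_scaleR_right] differentiable_Pair differentiable_diff
          differentiable_add differentiable_bilinear[OF bounded_bilinear_qmult] differentiable_qinv l fA nz)
  qed
  show ?thesis unfolding nk_metric_def
    by (intro differentiable_linear_image[OF bounded_linear_mult_right] differentiable_add
        differentiable_bilinear[OF bounded_bilinear_inner] J Y Z)
qed

lemma bounded_linear_linv: "bounded_linear (\<lambda>x. linv x \<zeta>)"
  unfolding linv_def
  by (intro bounded_linear_Pair bounded_linear_compose[OF bounded_bilinear.bounded_linear_left[OF bounded_bilinear_qmult]]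
      bounded_linear_fst bounded_linear_snd)

lemma linv_vector_field: "(\<lambda>x. linv x \<zeta>) \<in> vector_fields S3S3 TS3S3"
  unfolding vector_fields_def smooth_near_def
  using smooth_on_linear[OF bounded_linear_linv] linv_tangent by blast

lemma vector_field_differentiable:
  "X \<in> vector_fields S T \<Longrightarrow> x \<in> S \<Longrightarrow> X differentiable (at x)"
  unfolding vector_fields_def smooth_near_def using smooth_on_differentiable by blast

lemma vector_field_tangent: "X \<in> vector_fields S T \<Longrightarrow> x \<in> S \<Longrightarrow> X x \<in> T x"
  unfolding vector_fields_def by blast

definition lcomp :: "(quat \<times> quat \<Rightarrow> quat \<times> quat) \<Rightarrow> quat \<times> quat \<Rightarrow> alg" where
  "lcomp X = (\<lambda>x. ltriv x (X x))"

lemma differentiable_lcomp: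
  "X differentiable (at x) \<Longrightarrow> lcomp X differentiable (at x)"
  unfolding lcomp_def by (rule differentiable_bilinear[OF bounded_bilinear_ltriv differentiable_ident])

lemma lie_bracket_lcomp:
  assumes X: "X \<in> vector_fields S3S3 TS3S3" and Y: "Y \<in> vector_fields S3S3 TS3S3" and x: "x \<in> S3S3"
  shows "ltriv x (lie_bracket X Y x) = deriv_at (lcomp Y) x (X x) - deriv_at (lcomp X) x (Y x)
    + bracket (lcomp X x) (lcomp Y x)"
proof -
  have *: "deriv_at (lcomp Y) x v = ltriv x (deriv_at Y x v) + ltriv v (Y x)"
    if "Y \<in> vector_fields S3S3 TS3S3" for Y v
    unfolding lcomp_def
      deriv_at_bilinear[OF bounded_bilinear_ltriv differentiable_ident vector_field_differentiable[OF that x]]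
      deriv_at_ident ..
  show ?thesis
    unfolding lie_bracket_def bounded_bilinear.diff_right[OF bounded_bilinear_ltriv] *[OF X] *[OF Y]
    unfolding lcomp_def
    using ltriv_commutator[OF x vector_field_tangent[OF X x] vector_field_tangent[OF Y x]]
    by (simp add: algebra_simps)
qed

lemma metric_derivative_lcomp:
  assumes X: "X \<in> vector_fields S3S3 TS3S3" and Y: "Y \<in> vector_fields S3S3 TS3S3" and x: "x \<in> S3S3"
    and v: "v \<in> TS3S3 x"
  shows "deriv_at (\<lambda>y. nk_metric y (X y) (Y y)) x v
    = deriv_at (lcomp X) x v \<bullet> lcomp Y x + lcomp X x \<bullet> deriv_at (lcomp Y) x v"
proof -
  note dX = vector_field_differentiable[OF X x] and dY = vector_field_differentiable[OF Y x]
  have "deriv_at (\<lambda>y. nk_metric y (X y) (Y y)) x v = deriv_at (\<lambda>y. lcomp X y \<bullet> lcomp Y y) x v"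
  proof (rule derivative_tangent_to_S3S3[OF x v differentiable_nk_metric[OF x dX dY]])
    show "(\<lambda>y. lcomp X y \<bullet> lcomp Y y) differentiable (at x)"
      by (intro differentiable_bilinear[OF bounded_bilinear_inner] differentiable_lcomp dX dY)
    show "nk_metric z (X z) (Y z) = lcomp X z \<bullet> lcomp Y z" if "z \<in> S3S3" for z
      unfolding lcomp_def
      by (rule nk_metric_ltriv[OF that vector_field_tangent[OF X that] vector_field_tangent[OF Y that]])
  qed
  then show ?thesis
    unfolding deriv_at_bilinear[OF bounded_bilinear_inner differentiable_lcomp[OF dX] differentiable_lcomp[OF dY]]
    by simp
qed

text \<open>Koszul's formula with a left-invariant third field: the components of \<open>Z\<close> are constant, so no derivative of
  \<open>Z\<close> survives, and testing against all \<open>\<zeta>\<close> determines \<open>D X Y\<close>.\<close>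
lemma koszul_left_invariant:
  assumes L: "levi_civita S3S3 TS3S3 nk_metric D"
    and X: "X \<in> vector_fields S3S3 TS3S3" and Y: "Y \<in> vector_fields S3S3 TS3S3" and x: "x \<in> S3S3"
  shows "2 * (ltriv x (D X Y x) \<bullet> \<zeta>) = 2 * (deriv_at (lcomp Y) x (X x) \<bullet> \<zeta>)
    + bracket (lcomp X x) (lcomp Y x) \<bullet> \<zeta> - bracket (lcomp X x) \<zeta> \<bullet> lcomp Y x
    - bracket (lcomp Y x) \<zeta> \<bullet> lcomp X x"
proof -
  define Z :: "quat \<times> quat \<Rightarrow> quat \<times> quat" where "Z = (\<lambda>x. linv x \<zeta>)"
  have Z: "Z \<in> vector_fields S3S3 TS3S3" unfolding Z_def by (rule linv_vector_field)
  have Zx: "lcomp Z z = \<zeta>" if "z \<in> S3S3" for z unfolding lcomp_def Z_def by (rule ltriv_linv[OF that])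
  have dZ: "deriv_at (lcomp Z) x v = 0" if "v \<in> TS3S3 x" for v
  proof -
    have "deriv_at (lcomp Z) x v = deriv_at (\<lambda>_. \<zeta>) x v"
      by (rule derivative_tangent_to_S3S3[OF x that differentiable_lcomp[OF vector_field_differentiable[OF Z x]]
          differentiable_const Zx])
    then show ?thesis by (simp add: deriv_at_const)
  qed
  have DV: "D X Y \<in> vector_fields S3S3 TS3S3"
    if "X \<in> vector_fields S3S3 TS3S3" "Y \<in> vector_fields S3S3 TS3S3" for X Y
    using L that unfolding levi_civita_def affine_connection_def by blast
  let ?g = "\<lambda>X Y. ltriv x (D X Y x)"
  have met: "deriv_at (lcomp B) x (A x) \<bullet> lcomp C x + lcomp B x \<bullet> deriv_at (lcomp C) x (A x)
     = ?g A B \<bullet> lcomp C x + lcomp B x \<bullet> ?g A C"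
    if A: "A \<in> vector_fields S3S3 TS3S3" and B: "B \<in> vector_fields S3S3 TS3S3" and C: "C \<in> vector_fields S3S3 TS3S3"
    for A B C
  proof -
    have "deriv_at (\<lambda>y. nk_metric y (B y) (C y)) x (A x) = nk_metric x (D A B x) (C x) + nk_metric x (B x) (D A C x)"
      using L x A B C unfolding levi_civita_def by blast
    then show ?thesis
      unfolding metric_derivative_lcomp[OF B C x vector_field_tangent[OF A x]]
      using vector_field_tangent[OF _ x] A B C DV x by (simp add: nk_metric_ltriv lcomp_def)
  qed
  have tor: "?g A B - ?g B A = deriv_at (lcomp B) x (A x) - deriv_at (lcomp A) x (B x) + bracket (lcomp A x) (lcomp B x)"
    if A: "A \<in> vector_fields S3S3 TS3S3" and B: "B \<in> vector_fields S3S3 TS3S3" for A B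
  proof -
    have "D A B x - D B A x = lie_bracket A B x"
      using L x A B unfolding levi_civita_def by blast
    then show ?thesis
      unfolding lie_bracket_lcomp[OF A B x, symmetric] bounded_bilinear.diff_right[OF bounded_bilinear_ltriv, symmetric]
      by simp
  qed
  note t = vector_field_tangent[OF X x] vector_field_tangent[OF Y x]
  have M1: "deriv_at (lcomp Y) x (X x) \<bullet> \<zeta> = ?g X Y \<bullet> \<zeta> + lcomp Y x \<bullet> ?g X Z"
    using met[OF X Y Z] dZ[OF t(1)] Zx[OF x] by simp
  have M2: "deriv_at (lcomp X) x (Y x) \<bullet> \<zeta> = ?g Y X \<bullet> \<zeta> + lcomp X x \<bullet> ?g Y Z"
    using met[OF Y X Z] dZ[OF t(2)] Zx[OF x] by simp
  note M3 = met[OF Z X Y]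
  have T1: "?g X Y \<bullet> \<zeta> - ?g Y X \<bullet> \<zeta> = deriv_at (lcomp Y) x (X x) \<bullet> \<zeta> - deriv_at (lcomp X) x (Y x) \<bullet> \<zeta>
      + bracket (lcomp X x) (lcomp Y x) \<bullet> \<zeta>"
    unfolding inner_diff_left[symmetric] tor[OF X Y] by (simp add: inner_add_left inner_diff_left)
  have T2: "lcomp Y x \<bullet> ?g X Z - lcomp Y x \<bullet> ?g Z X = - (lcomp Y x \<bullet> deriv_at (lcomp X) x (Z x)) + lcomp Y x \<bullet> bracket (lcomp X x) \<zeta>"
    unfolding inner_diff_right[symmetric] tor[OF X Z] using dZ[OF t(1)] Zx[OF x] by (simp add: inner_diff_right)
  have T3: "lcomp X x \<bullet> ?g Y Z - lcomp X x \<bullet> ?g Z Y = - (lcomp X x \<bullet> deriv_at (lcomp Y) x (Z x)) + lcomp X x \<bullet> bracket (lcomp Y x) \<zeta>"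
    unfolding inner_diff_right[symmetric] tor[OF Y Z] using dZ[OF t(2)] Zx[OF x] by (simp add: inner_diff_right)
  have "lcomp Y x \<bullet> ?g Z X = ?g Z X \<bullet> lcomp Y x" "lcomp Y x \<bullet> deriv_at (lcomp X) x (Z x) = deriv_at (lcomp X) x (Z x) \<bullet> lcomp Y x"
    "bracket (lcomp X x) \<zeta> \<bullet> lcomp Y x = lcomp Y x \<bullet> bracket (lcomp X x) \<zeta>"
    "bracket (lcomp Y x) \<zeta> \<bullet> lcomp X x = lcomp X x \<bullet> bracket (lcomp Y x) \<zeta>"
    by (rule inner_commute)+
  with M1 M2 M3 T1 T2 T3 show ?thesis by linarith
qed

section \<open>The second fundamental form in a frame\<close>

lemma second_form_trig:
  fixes \<alpha> \<beta> \<gamma> :: real assumes "\<alpha> + \<beta> + \<gamma> = 0"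
  shows "(3 * cos \<alpha> * cos \<beta> + sin \<alpha> * sin \<beta>) * sin \<gamma> - 3 * sin (\<alpha> + \<beta>) * cos \<gamma>
    + ((3 * cos \<alpha> * sin \<gamma> - sin \<alpha> * cos \<gamma>) * cos \<beta> + 3 * (sin \<alpha> * sin \<gamma> - cos \<alpha> * cos \<gamma>) * sin \<beta>)
    - ((3 * cos \<beta> * sin \<gamma> - sin \<beta> * cos \<gamma>) * cos \<alpha> + 3 * (sin \<beta> * sin \<gamma> - cos \<beta> * cos \<gamma>) * sin \<alpha>)
    = - 4 * cos \<alpha> * sin (\<beta> - \<gamma>)"
  using sum_zero_sin_cos[OF assms] unfolding sin_add sin_diff by algebra

lemma bounded_bilinear_bracket: "bounded_bilinear bracket"
proof -
  have "bilinear bracket"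
    unfolding bilinear_def
    by (auto intro!: linearI simp: bracket_def algebra_simps cross_add_left cross_add_right cross_mult_left cross_mult_right)
  then show ?thesis by (simp add: bilinear_conv_bounded_bilinear)
qed

lemma jrot_skew: "jrot a \<bullet> b = - (a \<bullet> jrot b)"
  by (cases a; cases b) (simp add: jrot_def inner_commute)

context normalized_frame
begin

text \<open>The value of \<open>g (\<nabla>\<^bsub>E\<^sub>i\<^esub> E\<^sub>j, \<J> E\<^sub>k)\<close> according to Koszul's formula. In the first term the derivative has been moved
  from \<open>w\<^sub>j\<close> to \<open>w\<^sub>k\<close>, which is possible because \<open>w\<^sub>j\<close> and \<open>jrot (w\<^sub>k)\<close> are orthogonal.\<close>
definition h :: "3 \<Rightarrow> 3 \<Rightarrow> 3 \<Rightarrow> real ^ 3 \<Rightarrow> real" where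
  "h i j k y = D i (w k) y \<bullet> jrot (w j y) + (bracket (w i y) (w j y) \<bullet> jrot (w k y)
     - bracket (w i y) (jrot (w k y)) \<bullet> w j y - bracket (w j y) (jrot (w k y)) \<bullet> w i y) / 2"

lemma bracket_jrot_inner:
  assumes y: "y \<in> V"
  shows "bracket (w i y) (jrot (w k y)) \<bullet> w j y = (cross3 (b i y) (b k y) \<bullet> b j y) / sqrt 3 *
      ((3 * cos (\<theta> i y) * sin (\<theta> k y) - sin (\<theta> i y) * cos (\<theta> k y)) * cos (\<theta> j y)
        + 3 * (sin (\<theta> i y) * sin (\<theta> k y) - cos (\<theta> i y) * cos (\<theta> k y)) * sin (\<theta> j y))"
  unfolding w_polar[OF y] bracket_def jrot_def
  by (simp add: cross_mult_left cross_mult_right inner_add_left inner_diff_left field_simps)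
    (simp add: mult.assoc[symmetric])

lemma triple_permute:
  "cross3 (b i y) (b k y) \<bullet> b j y = - (cross3 (b i y) (b j y) \<bullet> b k y)"
  "cross3 (b j y) (b k y) \<bullet> b i y = cross3 (b i y) (b j y) \<bullet> b k y"
  by (simp_all add: cross3_simps inner_vec_def sum_3)

lemma h_distinct:
  assumes y: "y \<in> V" and ne: "i \<noteq> j" "j \<noteq> k" "i \<noteq> k"
  shows "h i j k y = - m y"
proof -
  have s: "sin (\<theta> k y - \<theta> j y) = - s j k y" using sin_minus[of "\<theta> j y - \<theta> k y"] by simp
  have z: "\<theta> i y + \<theta> j y + \<theta> k y = 0"
    using angle_sum_zero[OF y] ne exhaust_3[of i] exhaust_3[of j] exhaust_3[of k] by (auto simp: add_ac)
  let ?\<tau> = "cross3 (b i y) (b j y) \<bullet> b k y"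
  have collect: "a + (r * p - (- r * q) - r * q') / 2 = a + r * (p + q - q') / 2" for a r p q q' :: real
    by (simp add: algebra_simps)
  have "h i j k y = - (sin (\<theta> k y - \<theta> j y) * \<Gamma> i k j y) + ?\<tau> / sqrt 3 * (- 4 * cos (\<theta> i y) * s j k y) / 2"
    unfolding h_def D_w_inner[OF y] bracket_w_inner[OF y] bracket_jrot_inner[OF y]
      triple_permute(1)[of i y k j] triple_permute(2)[of j y k i] second_form_trig[OF z, symmetric]
      collect[symmetric]
    using ne by simp
  also have "\<dots> = - (s j k y * \<Gamma> i j k y + 2 * (?\<tau> / sqrt 3) * cos (\<theta> i y) * s j k y)"
    unfolding s \<Gamma>_skew[OF y, of i k j] by (simp add: algebra_simps)
  also have "s j k y * \<Gamma> i j k y + 2 * (?\<tau> / sqrt 3) * cos (\<theta> i y) * s j k y = m y"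
  proof -
    note mm = m_def[of y] m_cyclic[OF y]
    have o: "cross3 (b 1 y) (b 2 y) \<bullet> b 3 y / sqrt 3 = \<kappa>" "cross3 (b 2 y) (b 3 y) \<bullet> b 1 y / sqrt 3 = \<kappa>"
      "cross3 (b 3 y) (b 1 y) \<bullet> b 2 y / sqrt 3 = \<kappa>"
      "cross3 (b 1 y) (b 3 y) \<bullet> b 2 y / sqrt 3 = - \<kappa>" "cross3 (b 2 y) (b 1 y) \<bullet> b 3 y / sqrt 3 = - \<kappa>"
      "cross3 (b 3 y) (b 2 y) \<bullet> b 1 y / sqrt 3 = - \<kappa>"
      using triple_cyclic[of y] orientation[OF y] triple_permute(1)[of 1 y 3 2] triple_permute(1)[of 2 y 1 3]
        triple_permute(1)[of 3 y 2 1]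
      by (simp_all add: \<sigma>_def)
    have sm: "sin (\<theta> 3 y - \<theta> 2 y) = - s 2 3 y" "sin (\<theta> 1 y - \<theta> 3 y) = - s 3 1 y" "sin (\<theta> 2 y - \<theta> 1 y) = - s 1 2 y"
      using sin_minus[of "\<theta> 2 y - \<theta> 3 y"] sin_minus[of "\<theta> 3 y - \<theta> 1 y"] sin_minus[of "\<theta> 1 y - \<theta> 2 y"] by simp_all
    have A: "\<Gamma> 1 3 2 y = - \<Gamma> 1 2 3 y" "\<Gamma> 2 1 3 y = - \<Gamma> 2 3 1 y" "\<Gamma> 3 2 1 y = - \<Gamma> 3 1 2 y"
      by (rule \<Gamma>_skew[OF y])+
    consider "i = 1 \<and> j = 2 \<and> k = 3" | "i = 2 \<and> j = 3 \<and> k = 1" | "i = 3 \<and> j = 1 \<and> k = 2"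
      | "i = 1 \<and> j = 3 \<and> k = 2" | "i = 2 \<and> j = 1 \<and> k = 3" | "i = 3 \<and> j = 2 \<and> k = 1"
      using ne exhaust_3[of i] exhaust_3[of j] exhaust_3[of k] by auto
    then show ?thesis
      by cases (simp_all add: o mm(1), simp_all add: sm A mm(2,3)[symmetric] mm(1)[symmetric])
  qed
  finally show ?thesis .
qed

lemma h_eq_zero:
  assumes y: "y \<in> V" and \<theta>: "\<And>i j. D i (\<theta> j) y = 0" and m: "m y = 0"
  shows "h i j k y = 0"
proof (cases "i \<noteq> j \<and> j \<noteq> k \<and> i \<noteq> k")
  case True then show ?thesis using h_distinct[OF y] m by simp
next
  case False
  have "sin (\<theta> k y - \<theta> j y) * \<Gamma> i k j y = 0"
  proof -
    consider "j = k" | "i = j" "j \<noteq> k" | "i = k" "j \<noteq> k" using False by blast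
    then show ?thesis
    proof cases
      case 2 then show ?thesis using D_angle[OF y, of k j] \<theta> by simp
    next
      case 3
      then have "s j k y * \<Gamma> k j k y = 0" using D_angle[OF y, of j k] \<theta> by simp
      then show ?thesis using 3 \<Gamma>_skew[OF y, of k k j] sin_minus[of "\<theta> j y - \<theta> k y"] by simp
    qed simp
  qed
  moreover have "cross3 (b i y) (b j y) \<bullet> b k y = 0" using False by (auto simp: dot_cross_self)
  ultimately show ?thesis
    unfolding h_def D_w_inner[OF y] bracket_w_inner[OF y] bracket_jrot_inner[OF y]
      triple_permute(1)[of i y k j] triple_permute(2)[of j y k i] using \<theta> by simp
qed

text \<open>Koszul's formula contains a derivative of \<open>Y\<close>, but paired with a normal vector: the components of \<open>Y\<close> are
  orthogonal to \<open>jrot (w\<^sub>k)\<close> along the immersion, and differentiating this equation turns the derivative of \<open>Y\<close> into one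
  of \<open>w\<^sub>k\<close>. Expanding in the frame then leaves the coefficients \<open>h\<close>.\<close>
lemma second_form_vanishes:
  assumes L: "levi_civita S3S3 TS3S3 nk_metric Dc"
    and X: "X \<in> vector_fields S3S3 TS3S3" and Y: "Y \<in> vector_fields S3S3 TS3S3"
    and N: "open N" "y \<in> N" "N \<subseteq> V" and tX: "tangent_along F N X" and tY: "tangent_along F N Y"
    and h: "\<And>i j k. h i j k y = 0"
  shows "ltriv (F y) (Dc X Y (F y)) \<bullet> jrot (\<omega> y e) = 0"
proof -
  have y: "y \<in> V" using N by blast
  note Fy = F_S3S3[OF y]
  obtain u where u: "X (F y) = deriv_at F y u" using tX N unfolding tangent_along_def by blast
  obtain v where v: "Y (F y) = deriv_at F y v" using tY N unfolding tangent_along_def by blast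
  have dY: "lcomp Y differentiable (at (F y))"
    by (rule differentiable_lcomp[OF vector_field_differentiable[OF Y Fy]])
  note dF = smooth_on_has_derivative[OF smooth_F y]
  have comp: "((\<lambda>z. lcomp Y (F z)) has_derivative (\<lambda>e. deriv_at (lcomp Y) (F y) (deriv_at F y e))) (at y)"
    by (rule has_derivative_compose[OF dF]) (use dY in \<open>simp add: frechet_derivative_works\<close>)
  have dw: "(w k has_derivative deriv_at (w k) y) (at y)" for k
    by (rule smooth_on_has_derivative[OF smooth_w y])
  have perp: "lcomp Y (F z) \<bullet> jrot (w k z) = 0" if "z \<in> N" for z k
  proof -
    have "Y (F z) \<in> range (deriv_at F z)" using tY that by (simp add: tangent_along_def)
    then obtain e where "Y (F z) = deriv_at F z e" by (rule imageE)
    then have "lcomp Y (F z) = \<omega> z e" by (simp add: lcomp_def \<omega>_def)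
    moreover have "z \<in> V" using that N(3) by blast
    ultimately show ?thesis unfolding w_def by (simp only: inner_commute[of _ "jrot _"] jrot_\<omega>_inner)
  qed
  have diff: "deriv_at (lcomp Y) (F y) (X (F y)) \<bullet> jrot (w k y) = - (\<omega> y v \<bullet> jrot (deriv_at (w k) y u))" for k
  proof -
    have "((\<lambda>z. lcomp Y (F z) \<bullet> jrot (w k z)) has_derivative
       (\<lambda>e. lcomp Y (F y) \<bullet> jrot (deriv_at (w k) y e) + deriv_at (lcomp Y) (F y) (deriv_at F y e) \<bullet> jrot (w k y))) (at y)"
      by (rule has_derivative_inner[OF comp bounded_linear.has_derivative[OF bounded_linear_jrot dw]])
    from frechet_derivative_at[OF this]
    have "lcomp Y (F y) \<bullet> jrot (deriv_at (w k) y u) + deriv_at (lcomp Y) (F y) (deriv_at F y u) \<bullet> jrot (w k y)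
      = deriv_at (\<lambda>z. lcomp Y (F z) \<bullet> jrot (w k z)) y u" by (rule fun_cong)
    also have "\<dots> = 0" by (rule deriv_at_zero_of_constant_on[OF N(1,2) perp])
    finally show ?thesis by (simp add: u v lcomp_def \<omega>_def)
  qed
  note lw = linear_\<omega>[OF y]
  have exp: "\<omega> y e = (\<Sum>i\<in>UNIV. (\<omega> y e \<bullet> w i y) *\<^sub>R w i y)" for e
  proof -
    have "\<omega> y e = \<omega> y (\<Sum>i\<in>UNIV. (\<omega> y e \<bullet> w i y) *\<^sub>R E i y)" unfolding frame_expansion[OF y, symmetric] ..
    also have "\<dots> = (\<Sum>i\<in>UNIV. (\<omega> y e \<bullet> w i y) *\<^sub>R w i y)"
      unfolding linear_sum[OF lw] linear_scale[OF lw] w_def ..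
    finally show ?thesis .
  qed
  define p where "p i = \<omega> y u \<bullet> w i y" for i
  define q where "q j = \<omega> y v \<bullet> w j y" for j
  have eu: "\<omega> y u = (\<Sum>i\<in>UNIV. p i *\<^sub>R w i y)" and ev: "\<omega> y v = (\<Sum>j\<in>UNIV. q j *\<^sub>R w j y)"
    unfolding p_def q_def by (rule exp)+
  have du: "deriv_at (w k) y u = (\<Sum>i\<in>UNIV. p i *\<^sub>R D i (w k) y)" for k
  proof -
    have l: "linear (deriv_at (w k) y)" by (rule has_derivative_linear[OF dw])
    have "deriv_at (w k) y u = deriv_at (w k) y (\<Sum>i\<in>UNIV. p i *\<^sub>R E i y)"
      unfolding p_def frame_expansion[OF y, symmetric] ..
    then show ?thesis unfolding linear_sum[OF l] linear_scale[OF l] .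
  qed
  have zero: "ltriv (F y) (Dc X Y (F y)) \<bullet> jrot (w k y) = 0" for k
  proof -
    note bb = bounded_bilinear.add_left[OF bounded_bilinear_bracket] bounded_bilinear.add_right[OF bounded_bilinear_bracket]
      bounded_bilinear.scaleR_left[OF bounded_bilinear_bracket] bounded_bilinear.scaleR_right[OF bounded_bilinear_bracket]
    have lj: "linear jrot" by (rule bounded_linear.linear[OF bounded_linear_jrot])
    have "2 * (ltriv (F y) (Dc X Y (F y)) \<bullet> jrot (w k y)) = 2 * (deriv_at (w k) y u \<bullet> jrot (\<omega> y v))
      + bracket (\<omega> y u) (\<omega> y v) \<bullet> jrot (w k y) - bracket (\<omega> y u) (jrot (w k y)) \<bullet> \<omega> y v
      - bracket (\<omega> y v) (jrot (w k y)) \<bullet> \<omega> y u"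
      using koszul_left_invariant[OF L X Y Fy, of "jrot (w k y)"] diff[of k] jrot_skew[of "\<omega> y v" "deriv_at (w k) y u"]
      by (simp add: lcomp_def u v \<omega>_def inner_commute)
    also have "\<dots> = (\<Sum>i\<in>UNIV. \<Sum>j\<in>UNIV. p i * q j * (2 * h i j k y))"
    proof -
      have 1: "deriv_at (w k) y u \<bullet> jrot (\<omega> y v) = (\<Sum>i\<in>UNIV. \<Sum>j\<in>UNIV. p i * q j * (D i (w k) y \<bullet> jrot (w j y)))"
        unfolding du ev by (simp add: linear_sum[OF lj] linear_scale[OF lj] linear_add[OF lj] inner_add_left
            inner_add_right sum_3 algebra_simps)
      have 2: "bracket (\<omega> y u) (\<omega> y v) \<bullet> jrot (w k y) = (\<Sum>i\<in>UNIV. \<Sum>j\<in>UNIV. p i * q j * (bracket (w i y) (w j y) \<bullet> jrot (w k y)))"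
        unfolding eu ev by (simp add: bb inner_add_left inner_add_right scaleR_sum_right sum_3 algebra_simps)
      have 3: "bracket (\<omega> y u) (jrot (w k y)) \<bullet> \<omega> y v = (\<Sum>i\<in>UNIV. \<Sum>j\<in>UNIV. p i * q j * (bracket (w i y) (jrot (w k y)) \<bullet> w j y))"
        unfolding eu ev by (simp add: bb inner_add_left inner_add_right sum_3 algebra_simps)
      have 4: "bracket (\<omega> y v) (jrot (w k y)) \<bullet> \<omega> y u = (\<Sum>i\<in>UNIV. \<Sum>j\<in>UNIV. p i * q j * (bracket (w j y) (jrot (w k y)) \<bullet> w i y))"
        unfolding eu ev by (simp add: bb inner_add_left inner_add_right sum_3 algebra_simps)
      have 5: "p i * q j * (2 * h i j k y) = 2 * (p i * q j * (D i (w k) y \<bullet> jrot (w j y)))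
        + p i * q j * (bracket (w i y) (w j y) \<bullet> jrot (w k y)) - p i * q j * (bracket (w i y) (jrot (w k y)) \<bullet> w j y)
        - p i * q j * (bracket (w j y) (jrot (w k y)) \<bullet> w i y)" for i j
        by (simp add: h_def field_simps)
      show ?thesis unfolding 1 2 3 4 5 sum_distrib_left sum.distrib sum_subtractf ..
    qed
    finally show ?thesis by (simp add: h)
  qed
  have lj: "linear jrot" by (rule bounded_linear.linear[OF bounded_linear_jrot])
  show ?thesis
    by (subst exp[of e]) (simp add: linear_sum[OF lj] linear_scale[OF lj] inner_sum_right zero)
qed

end

section \<open>Local vanishing of the second fundamental form\<close>

lemma lagrangian_frame_subset:
  assumes "lagrangian_frame V F E \<theta>" "open U" "U \<subseteq> V"
  shows "lagrangian_frame U F E \<theta>"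
proof -
  interpret lagrangian_frame V F E \<theta> by fact
  show ?thesis
    using assms(2,3) smooth_on_subset[OF smooth_F assms(3)] smooth_on_subset[OF smooth_E assms(3)]
      smooth_on_subset[OF smooth_\<theta> assms(3)]
    by unfold_locales (auto simp: F_S3S3 lagrangian orthonormal angle subset_iff)
qed

lemma normalized_frame_subset:
  assumes "normalized_frame V F E \<theta> \<kappa>" "open U" "U \<subseteq> V"
  shows "normalized_frame U F E \<theta> \<kappa>"
proof -
  interpret normalized_frame V F E \<theta> \<kappa> by fact
  show ?thesis
    by (intro normalized_frame.intro lagrangian_frame_subset[OF lagrangian_frame_axioms assms(2,3)] normalized_frame_axioms.intro)
      (use assms(3) angle_sum_zero orientation in auto)
qed

context constant_angle_frame
begin

text \<open>The points with three angles different modulo \<open>pi\<close> form an open set, to which \<open>generic_frame.contradiction\<close>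
  applies.\<close>
lemma two_angles_equal: assumes y: "y \<in> V" shows "s 2 3 y = 0 \<or> s 3 1 y = 0 \<or> s 1 2 y = 0"
proof (rule ccontr)
  assume ne: "\<not> ?thesis"
  let ?p = "\<lambda>y. s 2 3 y * (s 3 1 y * s 1 2 y)"
  define U where "U = {y \<in> V. ?p y \<noteq> 0}"
  have c: "continuous_on V ?p"
    by (intro continuous_intros smooth_on_continuous[OF smooth_\<theta>])
  have "open (V \<inter> ?p -` (- {0}))"
    by (rule continuous_open_preimage[OF c open_V open_Compl[OF closed_singleton]])
  also have "V \<inter> ?p -` (- {0}) = U" by (auto simp: U_def)
  finally have oU: "open U" .
  interpret g: generic_frame U F E \<theta> \<kappa> t
    by (intro generic_frame.intro constant_angle_frame.intro normalized_frame_subset[OF normalized_frame_axioms oU]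
        constant_angle_frame_axioms.intro generic_frame_axioms.intro first_angle t_generic)
      (auto simp: U_def)
  show False using g.contradiction[of y] ne y by (auto simp: U_def)
qed

lemma m_zero: assumes y: "y \<in> V" shows "m y = 0"
proof -
  consider "s 2 3 y = 0" | "s 3 1 y = 0" | "s 1 2 y = 0" using two_angles_equal[OF y] by blast
  then show ?thesis
  proof cases
    case 1 then show ?thesis unfolding m_def by simp
  next
    case 2 then show ?thesis unfolding m_cyclic(1)[OF y] by simp
  next
    case 3 then show ?thesis unfolding m_cyclic(2)[OF y] by simp
  qed
qed

text \<open>The product of the three sines vanishes identically, and at no point do two of the factors vanish: all angles would agree
  modulo \<open>pi\<close>, and \<open>3 * t\<close> would be a multiple of \<open>pi\<close>. The derivative of the product thus gives the derivative of
  the vanishing factor.\<close>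
lemma D_angles_zero: assumes y: "y \<in> V" shows "D i (\<theta> j) y = 0"
proof -
  note ds = differentiable_trig(1)[OF y]
  note a = angle_difference_relations[OF y]
  have "D i (\<lambda>y. s 2 3 y * (s 3 1 y * s 1 2 y)) y = 0"
  proof (rule deriv_at_zero_of_constant_on[OF open_V y])
    show "s 2 3 y * (s 3 1 y * s 1 2 y) = 0" if "y \<in> V" for y
      using two_angles_equal[OF that] unfolding mult_eq_0_iff .
  qed
  then have e: "x i y * (2 * d 2 3 y * s 3 1 y * s 1 2 y - s 2 3 y * (s 3 1 y * d 1 2 y + d 3 1 y * s 1 2 y)) = 0"
    by (simp add: deriv_at_mult ds differentiable_mult D_s_values[OF y] algebra_simps)
  have zero: "d 2 3 y \<noteq> 0" if "s 2 3 y = 0" using that sin_cos_squared_add[of "\<theta> 2 y - \<theta> 3 y"] by auto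
  have "x i y = 0"
  proof (cases "s 2 3 y = 0")
    case True
    then have sq: "(s 1 2 y)\<^sup>2 - (s 3 1 y)\<^sup>2 = 0" using a(2) by simp
    have "s 3 1 y \<noteq> 0"
    proof
      assume 0: "s 3 1 y = 0"
      then have "s 1 2 y = 0" using sq by simp
      then show False using 0 a(1) t_generic by simp
    qed
    moreover have "s 1 2 y \<noteq> 0"
    proof
      assume 0: "s 1 2 y = 0"
      then have "s 3 1 y = 0" using sq by simp
      then show False using 0 a(1) t_generic by simp
    qed
    ultimately have "2 * d 2 3 y * s 3 1 y * s 1 2 y \<noteq> 0" using zero[OF True] by simp
    then show ?thesis using e True by simp
  next
    case False
    then have "s 3 1 y * s 1 2 y = 0" using two_angles_equal[OF y] unfolding mult_eq_0_iff by blast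
    then have "x i y * (s 2 3 y)\<^sup>2 = 0" using e unfolding trig_relations(1) by algebra
    then show ?thesis using False by simp
  qed
  moreover have "j = 1 \<or> j = 2 \<or> j = 3" by (rule exhaust_3)
  ultimately show ?thesis
    by (elim disjE) (simp_all add: D_first_angle[OF y] D_third_angle[OF y])
qed

lemmas second_form_zero = second_form_vanishes[OF _ _ _ _ _ _ _ _ h_eq_zero[OF _ D_angles_zero m_zero]]

end

lemma continuous_on_ball_discrete_constant:
  fixes f :: "real ^ 3 \<Rightarrow> real"
  assumes "continuous_on (ball z r) f" "\<And>y. y \<in> ball z r \<Longrightarrow> f y \<in> S"
    "e > 0" "\<And>a b. a \<in> S \<Longrightarrow> b \<in> S \<Longrightarrow> a \<noteq> b \<Longrightarrow> e \<le> \<bar>a - b\<bar>" "y \<in> ball z r"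
  shows "f y = f z"
proof -
  have "f constant_on ball z r"
    by (rule continuous_discrete_range_constant[OF connected_ball assms(1)]) (use assms(2-4) in force)
  moreover have "z \<in> ball z r" using assms(5) by (metis centre_in_ball dist_not_less_zero le_less_trans linorder_not_le mem_ball order.trans)
  ultimately show ?thesis using assms(5) unfolding constant_on_def by metis
qed

text \<open>Near a point the angle sum is a fixed multiple of \<open>pi\<close>, which is subtracted from the third angle: angle functions are
  only determined modulo \<open>pi\<close>. The orientation \<open>\<sigma>\<close> has values in \<open>{-1, 1}\<close> and is also locally constant.\<close>
lemma (in lagrangian_frame) normalization:
  assumes z: "z \<in> V"
  obtains r n \<kappa> where "r > 0" "ball z r \<subseteq> V"
    "normalized_frame (ball z r) F E (\<lambda>i y. if i = 3 then \<theta> 3 y - of_int n * pi else \<theta> i y) \<kappa>"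
proof -
  obtain r where r: "r > 0" "ball z r \<subseteq> V" using open_V z by (rule openE)
  let ?S = "\<lambda>y. \<theta> 1 y + \<theta> 2 y + \<theta> 3 y"
  obtain n :: int where n: "?S z = of_int n * pi"
    using angle_sum[OF z] by (auto simp: sin_zero_iff_int2)
  have S: "?S y = of_int n * pi" if "y \<in> ball z r" for y
  proof -
    have "?S y = ?S z"
    proof (rule continuous_on_ball_discrete_constant[where S = "range (\<lambda>n :: int. of_int n * pi)" and e = pi, OF _ _ _ _ that])
      show "continuous_on (ball z r) ?S"
        by (intro continuous_intros continuous_on_subset[OF smooth_on_continuous[OF smooth_\<theta>] r(2)])
      show "?S y \<in> range (\<lambda>n :: int. of_int n * pi)" if "y \<in> ball z r" for y
        using angle_sum[OF subsetD[OF r(2) that]] by (simp add: sin_zero_iff_int2 image_iff)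
      show "pi \<le> \<bar>a - b\<bar>" if ab: "a \<in> range (\<lambda>n :: int. of_int n * pi)" "b \<in> range (\<lambda>n :: int. of_int n * pi)" "a \<noteq> b" for a b
      proof -
        obtain k l :: int where kl: "a = of_int k * pi" "b = of_int l * pi" using ab by blast
        then have "1 \<le> \<bar>k - l\<bar>" using ab(3) by auto
        then have "1 * pi \<le> of_int \<bar>k - l\<bar> * pi" by (intro mult_right_mono) (auto simp del: of_int_abs)
        also have "\<dots> = \<bar>a - b\<bar>" unfolding kl by (simp add: left_diff_distrib[symmetric] abs_mult)
        finally show ?thesis by simp
      qed
    qed simp
    then show ?thesis using n by simp
  qed
  define \<theta>' where "\<theta>' = (\<lambda>i y. if i = 3 then \<theta> 3 y - of_int n * pi else \<theta> i y)"
  have "smooth_on (ball z r) (\<theta>' i)" for i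
  proof (cases "i = 3")
    case True
    have "smooth_on (ball z r) (\<lambda>y. \<theta> 3 y + - (of_int n * pi))"
      by (intro smooth_on_add smooth_on_const smooth_on_subset[OF smooth_\<theta> r(2)] open_ball)
    then show ?thesis using True by (simp add: \<theta>'_def)
  qed (use smooth_on_subset[OF smooth_\<theta> r(2)] in \<open>simp add: \<theta>'_def\<close>)
  moreover have "cos (2 * \<theta>' i y) = cos (2 * \<theta> i y)" "sin (2 * \<theta>' i y) = sin (2 * \<theta> i y)" for i y
  proof -
    have "cos (2 * (of_int n * pi)) = 1" "sin (2 * (of_int n * pi)) = 0"
      using cos_int_2pin[of n] sin_int_2pin[of n] by (simp_all add: mult_ac)
    then show "cos (2 * \<theta>' i y) = cos (2 * \<theta> i y)" "sin (2 * \<theta>' i y) = sin (2 * \<theta> i y)"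
      by (auto simp: \<theta>'_def cos_diff sin_diff right_diff_distrib)
  qed
  ultimately interpret f: lagrangian_frame "ball z r" F E \<theta>'
    using r(2) smooth_on_subset[OF smooth_F r(2)] smooth_on_subset[OF smooth_E r(2)]
    by unfold_locales (auto simp: F_S3S3 lagrangian orthonormal angle subset_iff)
  have \<sigma>: "f.\<sigma> y = f.\<sigma> z" if "y \<in> ball z r" for y
  proof (rule continuous_on_ball_discrete_constant[where S = "{-1, 1}" and e = 1, OF _ _ _ _ that])
    show "continuous_on (ball z r) f.\<sigma>"
      unfolding f.\<sigma>_def by (intro continuous_intros continuous_on_cross smooth_on_continuous[OF f.smooth_b])
    show "f.\<sigma> y \<in> {-1, 1}" if "y \<in> ball z r" for y
      using f.\<sigma>_square[OF that] by (auto simp: power2_eq_1_iff)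
  qed auto
  have "normalized_frame (ball z r) F E \<theta>' (f.\<sigma> z / sqrt 3)"
    by (intro normalized_frame.intro f.lagrangian_frame_axioms normalized_frame_axioms.intro)
      (use \<sigma> S in \<open>auto simp: \<theta>'_def algebra_simps\<close>)
  with r show ?thesis using that unfolding \<theta>'_def by blast
qed

lemma (in lagrangian_frame) second_form_zero_of_constant_angle:
  assumes t: "\<And>y. y \<in> V \<Longrightarrow> \<theta> 1 y = t" "sin (3 * t) \<noteq> 0"
    and L: "levi_civita S3S3 TS3S3 nk_metric Dc"
    and X: "X \<in> vector_fields S3S3 TS3S3" and Y: "Y \<in> vector_fields S3S3 TS3S3"
    and N: "open N" "y \<in> N" "N \<subseteq> V" and tX: "tangent_along F N X" and tY: "tangent_along F N Y"
  shows "ltriv (F y) (Dc X Y (F y)) \<bullet> jrot (ltriv (F y) (deriv_at F y e)) = 0"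
proof -
  have y: "y \<in> V" using N by blast
  obtain r n \<kappa> where r: "r > 0" "ball y r \<subseteq> V"
    and nf: "normalized_frame (ball y r) F E (\<lambda>i y. if i = 3 then \<theta> 3 y - of_int n * pi else \<theta> i y) \<kappa>"
    by (rule normalization[OF y])
  interpret c: constant_angle_frame "ball y r" F E "\<lambda>i y. if i = 3 then \<theta> 3 y - of_int n * pi else \<theta> i y" \<kappa> t
    by (intro constant_angle_frame.intro nf constant_angle_frame_axioms.intro) (use t r in auto)
  have M: "open (N \<inter> ball y r)" "y \<in> N \<inter> ball y r" "N \<inter> ball y r \<subseteq> ball y r" using N r by auto
  have "tangent_along F (N \<inter> ball y r) X" "tangent_along F (N \<inter> ball y r) Y"
    using tX tY by (auto simp: tangent_along_def)
  from c.second_form_zero[OF L X Y M this] show ?thesis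
    using r(1) by (simp add: c.\<omega>_def)
qed

section \<open>From frames to the manifold\<close>

text \<open>The image of \<open>T\<close> and its rotation by \<open>\<J>\<close> are orthogonal of dimension 3 in a space of dimension 6, so each is
  the orthogonal complement of the other.\<close>
lemma lagrangian_normal_complement:
  fixes T :: "real ^ 3 \<Rightarrow> quat \<times> quat"
  assumes x: "x \<in> S3S3" and T: "linear T" "inj T" and tan: "\<And>e. T e \<in> TS3S3 x"
    and lag: "\<And>u v. jrot (ltriv x (T u)) \<bullet> ltriv x (T v) = 0"
    and W: "W \<in> TS3S3 x" and perp: "\<And>e. ltriv x W \<bullet> jrot (ltriv x (T e)) = 0"
  shows "W \<in> range T"
proof -
  let ?L = "\<lambda>e. ltriv x (T e)" and ?M = "\<lambda>e. jrot (ltriv x (T e))"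
  have linL: "linear ?L"
    by (rule linear_compose[unfolded o_def, OF T(1) bounded_linear.linear])
      (rule bounded_bilinear.bounded_linear_right[OF bounded_bilinear_ltriv])
  have linM: "linear ?M"
    by (rule linear_compose[unfolded o_def, OF linL bounded_linear.linear[OF bounded_linear_jrot]])
  have injL: "inj ?L"
  proof (rule injI)
    fix u v assume "ltriv x (T u) = ltriv x (T v)"
    then have "linv x (ltriv x (T u)) = linv x (ltriv x (T v))" by (rule arg_cong)
    then have "T u = T v" unfolding linv_ltriv[OF x tan] .
    then show "u = v" by (rule injD[OF T(2)])
  qed
  have injM: "inj ?M"
  proof (rule injI)
    fix u v assume "?M u = ?M v"
    then have "?L u = ?L v" by (simp add: jrot_def prod_eq_iff)
    then show "u = v" by (rule injD[OF injL])
  qed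
  have dimL: "dim (range ?L) = 3" and dimM: "dim (range ?M) = 3"
    using dim_image_eq[OF linL, of UNIV] dim_image_eq[OF linM, of UNIV] injL injM by simp_all
  let ?B = "{w \<in> UNIV. \<forall>b\<in>range ?M. orthogonal b w}"
  have "dim ?B + dim (range ?M) = dim (UNIV :: alg set)"
    by (rule dim_subspace_orthogonal_to_vectors[OF linear_subspace_image[OF linM subspace_UNIV] subspace_UNIV subset_UNIV])
  then have dimB: "dim ?B = 3" using dimM by simp
  have "range ?L = ?B"
  proof (rule subspace_dim_equal)
    show "subspace (range ?L)" by (rule linear_subspace_image[OF linL subspace_UNIV])
    show "subspace ?B" using subspace_orthogonal_to_vectors[of "range ?M"] by simp
    show "range ?L \<subseteq> ?B" using lag by (auto simp: orthogonal_def)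
    show "dim ?B \<le> dim (range ?L)" using dimB dimL by simp
  qed
  moreover have "ltriv x W \<in> ?B" using perp by (auto simp: orthogonal_def inner_commute)
  ultimately obtain e where "ltriv x W = ltriv x (T e)" by blast
  then have "linv x (ltriv x W) = linv x (ltriv x (T e))" by (rule arg_cong)
  then have "W = T e" unfolding linv_ltriv[OF x tan] linv_ltriv[OF x W] .
  then show ?thesis by simp
qed

lemma normal_part_of_tangent:
  assumes x: "F y \<in> S3S3" and T: "linear (deriv_at F y)" and tan: "\<And>e. deriv_at F y e \<in> TS3S3 (F y)"
    and W: "W \<in> range (deriv_at F y)"
  shows "normal_part F y W = 0"
  unfolding normal_part_def
proof (rule the_equality)
  have z: "(0 :: quat \<times> quat) \<in> TS3S3 (F y)" using linear_0[OF T] tan[of 0] by simp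
  have "nk_metric (F y) 0 (deriv_at F y u) = 0" for u
    by (simp add: nk_metric_ltriv[OF x z tan] bounded_bilinear.zero_right[OF bounded_bilinear_ltriv])
  then show "0 \<in> normal_space F y \<and> W - 0 \<in> range (deriv_at F y)"
    using z W by (simp add: normal_space_def)
next
  fix n assume n: "n \<in> normal_space F y \<and> W - n \<in> range (deriv_at F y)"
  obtain a where a: "W = deriv_at F y a" using W by blast
  obtain b where b: "W - n = deriv_at F y b" using n by blast
  have nT: "n = deriv_at F y (a - b)" unfolding linear_diff[OF T] a[symmetric] b[symmetric] by simp
  have nt: "n \<in> TS3S3 (F y)" using n by (simp add: normal_space_def)
  have "nk_metric (F y) n (deriv_at F y (a - b)) = 0" using n unfolding normal_space_def by blast
  then have "ltriv (F y) n = 0" unfolding nT[symmetric] nk_metric_ltriv[OF x nt nt] by simp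
  then have "linv (F y) (ltriv (F y) n) = linv (F y) 0" by simp
  also have "\<dots> = 0" by (simp add: linv_def qmult_def prod_eq_iff)
  finally show "n = 0" unfolding linv_ltriv[OF x nt] .
qed

lemma smooth_atlasD:
  assumes "smooth_atlas A" "c \<in> A"
  shows "open (fst c)" "open (chart_image c)" "homeomorphism (fst c) (chart_image c) (snd c) (chart_inv c)"
    "d \<in> A \<Longrightarrow> smooth_on (snd c ` (fst c \<inter> fst d)) (snd d \<circ> chart_inv c)"
  using assms unfolding smooth_atlas_def by blast+

lemma chart_inv_simps:
  assumes "smooth_atlas A" "c \<in> A"
  shows "x \<in> fst c \<Longrightarrow> chart_inv c (snd c x) = x" "y \<in> chart_image c \<Longrightarrow> snd c (chart_inv c y) = y"
    "y \<in> chart_image c \<Longrightarrow> chart_inv c y \<in> fst c" "x \<in> fst c \<Longrightarrow> snd c x \<in> chart_image c"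
  using smooth_atlasD(3)[OF assms] unfolding homeomorphism_def by auto

lemma open_chart_overlap:
  assumes A: "smooth_atlas A" "c \<in> A" "d \<in> A"
  shows "open (snd c ` (fst c \<inter> fst d))"
proof -
  have "openin (top_of_set (fst c)) (fst c \<inter> fst d)"
    using smooth_atlasD(1)[OF A(1,3)] by (rule openin_open_Int)
  from homeomorphism_imp_open_map[OF smooth_atlasD(3)[OF A(1,2)] this]
  show ?thesis using smooth_atlasD(2)[OF A(1,2)] openin_open_trans by blast
qed

lemma open_chart_inv_image:
  assumes A: "smooth_atlas A" "c \<in> A" and V: "open V" "V \<subseteq> chart_image c"
  shows "open (chart_inv c ` V)"
proof -
  have "openin (top_of_set (chart_image c)) V" using V smooth_atlasD(2)[OF A] by (simp add: openin_open_eq)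
  from homeomorphism_imp_open_map[OF homeomorphism_symD[OF smooth_atlasD(3)[OF A]] this]
  show ?thesis using smooth_atlasD(1)[OF A] openin_open_trans by blast
qed

locale immersed_lagrangian =
  fixes A :: "'m::{t2_space, second_countable_topology} chart set" and f :: "'m \<Rightarrow> quat \<times> quat"
  assumes atlas: "smooth_atlas A" and lagrangian: "lagrangian_immersion A f"
begin

lemma local_rep_smooth: "c \<in> A \<Longrightarrow> smooth_on (chart_image c) (local_rep c f)"
  and local_rep_inj: "c \<in> A \<Longrightarrow> y \<in> chart_image c \<Longrightarrow> inj (deriv_at (local_rep c f) y)"
  using lagrangian unfolding lagrangian_immersion_def immersion_into_S3S3_def by blast+

lemma local_rep_S3S3: assumes "c \<in> A" "y \<in> chart_image c" shows "local_rep c f y \<in> S3S3"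
proof -
  have "chart_inv c y \<in> manifold_carrier A"
    unfolding manifold_carrier_def using chart_inv_simps(3)[OF atlas assms] assms(1) by blast
  then show ?thesis using lagrangian unfolding lagrangian_immersion_def immersion_into_S3S3_def local_rep_def by simp
qed

lemma local_rep_linear: "c \<in> A \<Longrightarrow> y \<in> chart_image c \<Longrightarrow> linear (deriv_at (local_rep c f) y)"
  by (rule linear_frechet_derivative[OF smooth_on_differentiable[OF local_rep_smooth]])

lemma local_rep_tangent:
  assumes "c \<in> A" "y \<in> chart_image c" shows "deriv_at (local_rep c f) y e \<in> TS3S3 (local_rep c f y)"
  by (rule sphere_product_map_tangent[OF smooth_atlasD(2)[OF atlas assms(1)] assms(2)
      smooth_on_differentiable[OF local_rep_smooth[OF assms(1)] assms(2)] local_rep_S3S3[OF assms(1)]])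

lemma local_rep_lagrangian:
  assumes "c \<in> A" "y \<in> chart_image c"
  shows "nk_metric (local_rep c f y) (\<J> (local_rep c f y) (deriv_at (local_rep c f) y u)) (deriv_at (local_rep c f) y v) = 0"
  using lagrangian assms unfolding lagrangian_immersion_def normal_space_def by blast

lemma local_rep_lagrangian_ltriv:
  assumes "c \<in> A" "y \<in> chart_image c"
  shows "jrot (ltriv (local_rep c f y) (deriv_at (local_rep c f) y u)) \<bullet> ltriv (local_rep c f y) (deriv_at (local_rep c f) y v) = 0"
  using local_rep_lagrangian[OF assms, of u v] local_rep_S3S3[OF assms] local_rep_tangent[OF assms]
  by (simp add: nk_metric_ltriv acs_tangent ltriv_acs)

text \<open>The chain rule for the transition map. Exchanging the charts gives the other inclusion.\<close>
lemma deriv_at_change_of_chart: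
  assumes c: "c \<in> A" and d: "d \<in> A" and x: "x \<in> fst c" "x \<in> fst d"
  shows "range (deriv_at (local_rep c f) (snd c x)) \<subseteq> range (deriv_at (local_rep d f) (snd d x))"
proof -
  let ?U = "snd c ` (fst c \<inter> fst d)" and ?\<tau> = "snd d \<circ> chart_inv c"
  have U: "open ?U" "snd c x \<in> ?U" using open_chart_overlap[OF atlas c d] x by auto
  have \<tau>x: "?\<tau> (snd c x) = snd d x" using chart_inv_simps(1)[OF atlas c x(1)] by simp
  have eq: "local_rep c f y = local_rep d f (?\<tau> y)" if "y \<in> ?U" for y
    using that chart_inv_simps(1)[OF atlas c] chart_inv_simps(1)[OF atlas d] by (auto simp: local_rep_def)
  have d\<tau>: "(?\<tau> has_derivative deriv_at ?\<tau> (snd c x)) (at (snd c x))"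
    by (rule smooth_on_has_derivative[OF smooth_atlasD(4)[OF atlas c d] U(2)])
  have "(local_rep d f has_derivative deriv_at (local_rep d f) (snd d x)) (at (snd d x))"
    by (rule smooth_on_has_derivative[OF local_rep_smooth[OF d] chart_inv_simps(4)[OF atlas d x(2)]])
  then have "((\<lambda>y. local_rep d f (?\<tau> y)) has_derivative
      (\<lambda>e. deriv_at (local_rep d f) (snd d x) (deriv_at ?\<tau> (snd c x) e))) (at (snd c x))"
    unfolding \<tau>x[symmetric] by (rule has_derivative_compose[OF d\<tau>])
  from frechet_derivative_at[OF this]
  have "deriv_at (\<lambda>y. local_rep d f (?\<tau> y)) (snd c x)
    = (\<lambda>e. deriv_at (local_rep d f) (snd d x) (deriv_at ?\<tau> (snd c x) e))" by (rule sym)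
  then have "deriv_at (local_rep c f) (snd c x)
    = (\<lambda>e. deriv_at (local_rep d f) (snd d x) (deriv_at ?\<tau> (snd c x) e))"
    using deriv_at_cong[OF U eq] by simp
  then show ?thesis by auto
qed

text \<open>The point has an adapted frame in the chart \<open>d\<close>, while the vector fields are tangent along the image of a neighbourhood
  in the chart \<open>c\<close>. Tangency is transferred to \<open>d\<close>, and the resulting normal directions back to \<open>c\<close>.\<close>
lemma second_form_zero_at_adapted_point:
  assumes L: "levi_civita S3S3 TS3S3 nk_metric D"
    and X: "X \<in> vector_fields S3S3 TS3S3" and Y: "Y \<in> vector_fields S3S3 TS3S3"
    and t: "sin (3 * t) \<noteq> 0" and c: "c \<in> A" and N: "open N" "N \<subseteq> chart_image c"
    and tX: "tangent_along (local_rep c f) N X" and tY: "tangent_along (local_rep c f) N Y"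
    and x: "x \<in> fst c" "snd c x \<in> N" and d: "d \<in> A" "x \<in> fst d"
    and M: "open M" "snd d x \<in> M" "M \<subseteq> chart_image d"
    and ang: "angle_functions_on (local_rep d f) M \<theta>" "\<And>y. y \<in> M \<Longrightarrow> \<theta> 1 y = t"
  shows "ltriv (f x) (D X Y (f x)) \<bullet> jrot (ltriv (f x) (deriv_at (local_rep c f) (snd c x) e)) = 0"
proof -
  let ?F = "local_rep d f"
  obtain E where E: "\<And>i. smooth_on M (E i)"
    "\<And>y i j. y \<in> M \<Longrightarrow> induced_metric ?F y (E i y) (E j y) = (if i = j then 1 else 0)"
    "\<And>y i. y \<in> M \<Longrightarrow> \<P> (?F y) (deriv_at ?F y (E i y)) =
            cos (2 * \<theta> i y) *\<^sub>R deriv_at ?F y (E i y) +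
            sin (2 * \<theta> i y) *\<^sub>R \<J> (?F y) (deriv_at ?F y (E i y))"
    and \<theta>: "\<And>i. smooth_on M (\<theta> i)"
    using ang(1) unfolding angle_functions_on_def by blast
  interpret fr: lagrangian_frame M ?F E \<theta>
    by unfold_locales
      (use M E \<theta> smooth_on_subset[OF local_rep_smooth[OF d(1)] M(3)] local_rep_S3S3[OF d(1)]
        local_rep_lagrangian[OF d(1)] in \<open>simp_all add: subset_iff\<close>)
  define N' where "N' = M \<inter> snd d ` (fst d \<inter> chart_inv c ` N)"
  have "open (chart_inv c ` N)" by (rule open_chart_inv_image[OF atlas c N])
  then have "openin (top_of_set (fst d)) (fst d \<inter> chart_inv c ` N)" by (rule openin_open_Int)
  from homeomorphism_imp_open_map[OF smooth_atlasD(3)[OF atlas d(1)] this]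
  have "open (snd d ` (fst d \<inter> chart_inv c ` N))"
    using smooth_atlasD(2)[OF atlas d(1)] openin_open_trans by blast
  then have N'o: "open N'" unfolding N'_def using M(1) by blast
  have "x \<in> chart_inv c ` N" using x chart_inv_simps(1)[OF atlas c x(1)] by (metis imageI)
  then have xN': "snd d x \<in> N'" unfolding N'_def using M(2) d(2) by blast
  have tan: "tangent_along ?F N' Z" if Z: "tangent_along (local_rep c f) N Z" for Z
    unfolding tangent_along_def
  proof
    fix z assume "z \<in> N'"
    then obtain y where y: "y \<in> N" "chart_inv c y \<in> fst d" "z = snd d (chart_inv c y)"
      unfolding N'_def by blast
    have yc: "y \<in> chart_image c" using y N by blast
    have "Z (local_rep c f y) \<in> range (deriv_at (local_rep c f) y)"
      using Z y(1) unfolding tangent_along_def by blast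
    moreover have "local_rep c f y = ?F z"
      using chart_inv_simps(1)[OF atlas d(1) y(2)] y(3) by (simp add: local_rep_def)
    moreover have "range (deriv_at (local_rep c f) y) \<subseteq> range (deriv_at ?F z)"
      using deriv_at_change_of_chart[OF c d(1) chart_inv_simps(3)[OF atlas c yc] y(2)]
      unfolding chart_inv_simps(2)[OF atlas c yc] y(3) .
    ultimately show "Z (?F z) \<in> range (deriv_at ?F z)" by auto
  qed
  have Fx: "?F (snd d x) = f x" using chart_inv_simps(1)[OF atlas d] by (simp add: local_rep_def)
  have "deriv_at (local_rep c f) (snd c x) e \<in> range (deriv_at ?F (snd d x))"
    using deriv_at_change_of_chart[OF c d(1) x(1) d(2)] by blast
  then obtain e' where e': "deriv_at (local_rep c f) (snd c x) e = deriv_at ?F (snd d x) e'" by blast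
  show ?thesis
    unfolding e' Fx[symmetric]
    by (rule fr.second_form_zero_of_constant_angle[OF ang(2) t L X Y N'o xN' _ tan[OF tX] tan[OF tY]])
      (auto simp: N'_def)
qed

text \<open>For a fixed direction \<open>e\<close> the expression is continuous in \<open>y\<close>. Were it nonzero at \<open>y\<close>, it would be nonzero on a neighbourhood,
  which contains a point with an adapted frame by density.\<close>
lemma second_form_zero:
  assumes angle: "constant_first_angle A f t" and t: "sin (3 * t) \<noteq> 0"
    and L: "levi_civita S3S3 TS3S3 nk_metric D"
    and X: "X \<in> vector_fields S3S3 TS3S3" and Y: "Y \<in> vector_fields S3S3 TS3S3"
    and c: "c \<in> A" and N: "open N" "N \<subseteq> chart_image c" and y: "y \<in> N"
    and tX: "tangent_along (local_rep c f) N X" and tY: "tangent_along (local_rep c f) N Y"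
  shows "ltriv (local_rep c f y) (D X Y (local_rep c f y)) \<bullet>
    jrot (ltriv (local_rep c f y) (deriv_at (local_rep c f) y e)) = 0"
proof (rule ccontr)
  let ?F = "local_rep c f"
  let ?G = "\<lambda>y. ltriv (?F y) (D X Y (?F y)) \<bullet> jrot (ltriv (?F y) (deriv_at ?F y e))"
  assume ne: "?G y \<noteq> 0"
  have F: "continuous_on N ?F"
    using smooth_on_continuous[OF local_rep_smooth[OF c]] N(2) by (rule continuous_on_subset)
  have "D X Y \<in> vector_fields S3S3 TS3S3"
    using L X Y unfolding levi_civita_def affine_connection_def by blast
  then obtain U where U: "S3S3 \<subseteq> U" "smooth_on U (D X Y)"
    unfolding vector_fields_def smooth_near_def by blast
  have "?F ` N \<subseteq> U" using local_rep_S3S3[OF c] N(2) U(1) by blast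
  then have DXY: "continuous_on N (\<lambda>y. D X Y (?F y))"
    using continuous_on_compose2[OF smooth_on_continuous[OF U(2)] F] by blast
  have dF: "continuous_on N (\<lambda>y. deriv_at ?F y e)"
    using smooth_on_continuous[OF smooth_on_deriv[OF local_rep_smooth[OF c]]] N(2) by (rule continuous_on_subset)
  have G: "continuous_on N ?G"
    by (intro continuous_on_inner bounded_bilinear.continuous_on[OF bounded_bilinear_ltriv]
        bounded_linear.continuous_on[OF bounded_linear_jrot] F DXY dF)
  let ?O = "N \<inter> ?G -` (- {0})"
  have O: "open ?O" by (rule continuous_open_preimage[OF G N(1) open_Compl[OF closed_singleton]])
  have Oc: "?O \<subseteq> chart_image c" using N(2) by blast
  obtain W where W: "manifold_carrier A \<subseteq> closure W"
    "\<And>x. x \<in> W \<Longrightarrow> \<exists>d\<in>A. x \<in> fst d \<and> (\<exists>M \<theta>. open M \<and> snd d x \<in> M \<and> M \<subseteq> chart_image d \<and>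
       angle_functions_on (local_rep d f) M \<theta> \<and> (\<forall>y\<in>M. \<theta> 1 y = t))"
    using angle unfolding constant_first_angle_def by blast
  have "chart_inv c y \<in> chart_inv c ` ?O" using y ne by blast
  moreover have "chart_inv c y \<in> closure W"
    using W(1) chart_inv_simps(3)[OF atlas c] y N(2) c unfolding manifold_carrier_def by blast
  ultimately obtain x where x: "x \<in> W" "x \<in> chart_inv c ` ?O"
    using open_chart_inv_image[OF atlas c O Oc] open_Int_closure_eq_empty[of "chart_inv c ` ?O" W] by blast
  obtain z where z: "z \<in> ?O" "x = chart_inv c z" using x(2) by blast
  have zc: "z \<in> chart_image c" using z(1) Oc by blast
  have xz: "x \<in> fst c" "snd c x = z" using chart_inv_simps(2,3)[OF atlas c zc] z(2) by simp_all
  obtain d M \<theta> where d: "d \<in> A" "x \<in> fst d" and M: "open M" "snd d x \<in> M" "M \<subseteq> chart_image d"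
    and ang: "angle_functions_on (local_rep d f) M \<theta>" "\<And>y. y \<in> M \<Longrightarrow> \<theta> 1 y = t"
    using W(2)[OF x(1)] by blast
  have "ltriv (f x) (D X Y (f x)) \<bullet> jrot (ltriv (f x) (deriv_at ?F (snd c x) e)) = 0"
    by (rule second_form_zero_at_adapted_point[OF L X Y t c N tX tY xz(1) _ d M ang]) (use z xz in simp)
  moreover have "?F z = f x" using z(2) by (simp add: local_rep_def)
  ultimately show False using z(1) xz(2) by simp
qed

lemma totally_geodesic_of_constant_angle:
  assumes angle: "constant_first_angle A f t" and t: "sin (3 * t) \<noteq> 0"
  shows "totally_geodesic A f"
  unfolding totally_geodesic_def
proof (intro allI ballI impI, elim conjE)
  fix D c y X Y N
  assume L: "levi_civita S3S3 TS3S3 nk_metric D" and c: "c \<in> A" and y: "y \<in> chart_image c"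
    and X: "X \<in> vector_fields S3S3 TS3S3" and Y: "Y \<in> vector_fields S3S3 TS3S3"
    and N: "open N" "y \<in> N" "N \<subseteq> chart_image c"
    and tX: "tangent_along (local_rep c f) N X" and tY: "tangent_along (local_rep c f) N Y"
  let ?F = "local_rep c f"
  have "D X Y \<in> vector_fields S3S3 TS3S3"
    using L X Y unfolding levi_civita_def affine_connection_def by blast
  then have W: "D X Y (?F y) \<in> TS3S3 (?F y)"
    by (rule vector_field_tangent[OF _ local_rep_S3S3[OF c y]])
  have "D X Y (?F y) \<in> range (deriv_at ?F y)"
    by (rule lagrangian_normal_complement[OF local_rep_S3S3[OF c y] local_rep_linear[OF c y] local_rep_inj[OF c y]
        local_rep_tangent[OF c y] local_rep_lagrangian_ltriv[OF c y] W
        second_form_zero[OF angle t L X Y c N(1,3,2) tX tY]])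
  then show "second_fundamental_form D ?F X Y y = 0"
    unfolding second_fundamental_form_def
    by (rule normal_part_of_tangent[OF local_rep_S3S3[OF c y] local_rep_linear[OF c y] local_rep_tangent[OF c y]])
qed

end

lemma sin_triple_zero:
  assumes "sin (3 * t) = (0 :: real)"
  shows "\<exists>k::int. t = of_int k * pi \<or> t = pi / 3 + of_int k * pi \<or> t = 2 * pi / 3 + of_int k * pi"
proof -
  obtain n :: int where n: "3 * t = of_int n * pi" using assms by (auto simp: sin_zero_iff_int2)
  define k where "k = n div 3"
  have "n = 3 * k \<or> n = 3 * k + 1 \<or> n = 3 * k + 2" unfolding k_def by presburger
  then have "t = of_int k * pi \<or> t = pi / 3 + of_int k * pi \<or> t = 2 * pi / 3 + of_int k * pi"
    using n by (auto simp: field_simps)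
  then show ?thesis by blast
qed

theorem theorem2:
  fixes A :: "'m::{t2_space, second_countable_topology} chart set"
    and f :: "'m \<Rightarrow> quat \<times> quat"
    and \<theta>\<^sub>1 :: real
  assumes "smooth_atlas A"
    and "lagrangian_immersion A f"
    and "\<not> totally_geodesic A f"
    and "\<not> constant_sectional_curvature A f"
    and "constant_first_angle A f \<theta>\<^sub>1"
  shows "\<exists>k::int. \<theta>\<^sub>1 = of_int k * pi \<or> \<theta>\<^sub>1 = pi / 3 + of_int k * pi \<or>
                  \<theta>\<^sub>1 = 2 * pi / 3 + of_int k * pi"
proof -
  interpret immersed_lagrangian A f using assms(1,2) by unfold_locales
  have "sin (3 * \<theta>\<^sub>1) = 0" using totally_geodesic_of_constant_angle[OF assms(5)] assms(3) by blast
  then show ?thesis by (rule sin_triple_zero)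
qed

end
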